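(* Let $n\ge 3$ be an integer, let $p_1,\ldots,p_n$ be distinct prime numbers, let $S=\{p_1,\ldots,p_n\}$ and $\mathbb{Z}_S=\mathbb{Z}[\frac1{p_1},\ldots,\frac1{p_n}]$, and let $N,N'$ be arbitrary positive integers. Let $\mathcal{T}=\mathbb{G}_m\times_{\operatorname{spec}\mathbb{Z}_S}\mathbb{G}_m$, and let $\Lambda,\Lambda'\subset \mathcal{T}(\mathbb{Z}_S)=\mathbb{Z}_S^\times\times\mathbb{Z}_S^\times$ be the subgroups defined in the context. Consider the Deligne 1-motives $[\Lambda\to\mathcal{T}]$, $[\Lambda'\to\mathcal{T}]$, $[\Lambda\cap\Lambda'\to\mathcal{T}]$ and $[\Lambda\cdot\Lambda'\to\mathcal{T}]$ over $\operatorname{spec}\mathbb{Z}_S$. Then, for each prime $p\notin S$, after changing the base to $\operatorname{spec}\mathbb{F}_p$ and taking the images of the subgroups $\Lambda,\Lambda',\Lambda\cap\Lambda',\Lambda\cdot\Lambda'$ in $T_p(\mathbb{F}_p)=\mathbb{F}_p^\times\times\mathbb{F}_p^\times$ under the reduction map $r_p$, the torsion 1-motives $[r_p(\Lambda)\to T_p]$, $[r_p(\Lambda')\to T_p]$, $[r_p(\Lambda\cap\Lambda')\to T_p]$ and $[r_p(\Lambda\cdot\Lambda')\to T_p]$ are all equal.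
   Context: Elements of $\mathbb{Z}_S^\times\times\mathbb{Z}_S^\times$ are written as column vectors, with componentwise multiplication. Put $$\lambda=\begin{bmatrix}1\\ p_1^{N}\end{bmatrix},\quad \lambda_1=\begin{bmatrix}p_1\\ 1\end{bmatrix},\quad \lambda_i=\begin{bmatrix}p_i\\ p_{i-1}\end{bmatrix}\ (2\le i\le n),\quad \lambda_{n+1}=\begin{bmatrix}1\\ p_n\end{bmatrix},\quad \lambda'=\begin{bmatrix}p_n^{N'}\\ 1\end{bmatrix},$$ $$\Lambda=\lambda^{\mathbb{Z}}\cdot\lambda_1^{\mathbb{Z}}\cdot\lambda_2^{\mathbb{Z}}\cdots\lambda_{n+1}^{\mathbb{Z}},\qquad \Lambda'=\lambda_1^{\mathbb{Z}}\cdot\lambda_2^{\mathbb{Z}}\cdots\lambda_{n+1}^{\mathbb{Z}}\cdot\lambda'^{\mathbb{Z}}.$$ For a prime $p\notin S$, $r_p:\mathbb{Z}_S^\times\times\mathbb{Z}_S^\times\to\mathbb{F}_p^\times\times\mathbb{F}_p^\times$ is componentwise reduction modulo $p$, and $T_p=\mathbb{G}_m^2$ over $\mathbb{F}_p$. A torsion 1-motive over a noetherian regular scheme $\mathcal{S}$, written $[\mathcal{Y}\to\mathcal{Z}]$, is a diagram in the category of sheaves of commutative groups on the fppf site over $\mathcal{S}$ consisting of an exact sequence $0\to\mathcal{X}\to\mathcal{Z}\to\mathcal{A}\to0$ and a morphism $u:\mathcal{Y}\to\mathcal{Z}$, where $\mathcal{Y}$ is an extension of a lattice by a finite flat group scheme,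 $\mathcal{X}$ is an extension of a finite flat group scheme by a torus, and $\mathcal{A}$ is an abelian scheme. A Deligne 1-motive is the case where $\mathcal{Y}$ is a lattice and $\mathcal{X}$ is a torus (so $\mathcal{Z}$ is a semiabelian scheme). Here $\mathcal{A}=0$. For a subgroup $\Lambda_0$ of $\mathbb{Z}_S^\times\times\mathbb{Z}_S^\times$ that is a lattice, $[\Lambda_0\to\mathcal{T}]$ is given by the inclusion $\Lambda_0\subset\mathcal{T}(\mathbb{Z}_S)$, and $[r_p(\Lambda_0)\to T_p]$ is given by the inclusion of the finite group $r_p(\Lambda_0)\subset T_p(\mathbb{F}_p)$ (viewed as a constant group scheme). *)

theory Defs
  imports
    "HOL-Algebra.Free_Abelian_Groups"
    "HOL-Algebra.Product_Groups"
    "HOL-Algebra.QuotRing"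
    "HOL-Number_Theory.Residues"
    "HOL-Library.Infinite_Typeclass"
begin

section \<open>Algebras over a base ring and the affine fppf site\<close>

text \<open>
  Sheaves on the fppf site of \<open>Spec k\<close> are determined by their values on affine schemes over
  \<open>k\<close>, so the site used here consists of the commutative \<open>k\<close>-algebras.  They have their carrier in
  a type \<open>'u\<close>, which bounds the size of the site.  If \<open>'u\<close> is infinite, the site is closed under
  finitely presented algebras, finite products and tensor products of its objects.
  An algebra is a ring together with its structure map.
\<close>

type_synonym ('k, 'u) alg = "'u ring \<times> ('k \<Rightarrow> 'u)"

definition is_alg :: "'k ring \<Rightarrow> ('k, 'u) alg \<Rightarrow> bool" where
  "is_alg k A \<longleftrightarrow> cring (fst A) \<and> snd A \<in> ring_hom k (fst A)"

definition is_alg_hom ::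
    "'k ring \<Rightarrow> ('k, 'u) alg \<Rightarrow> ('k, 'u) alg \<Rightarrow> ('u \<Rightarrow> 'u) \<Rightarrow> bool" where
  "is_alg_hom k A B f \<longleftrightarrow>
     is_alg k A \<and> is_alg k B \<and> f \<in> ring_hom (fst A) (fst B) \<and>
     (\<forall>c\<in>carrier k. f (snd A c) = snd B c)"

text \<open>
  Equational criterion for the flatness of \<open>B\<close> over \<open>R\<close>: every linear relation in \<open>B\<close> with
  coefficients in \<open>R\<close> is a consequence of relations in \<open>R\<close>.
\<close>

definition flat_hom :: "'r ring \<Rightarrow> 'b ring \<Rightarrow> ('r \<Rightarrow> 'b) \<Rightarrow> bool" where
  "flat_hom R B f \<longleftrightarrow>
     (\<forall>(n::nat) a b.
        a \<in> {..<n} \<rightarrow> carrier R \<and> b \<in> {..<n} \<rightarrow> carrier B \<and>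
        (\<Oplus>\<^bsub>B\<^esub>i\<in>{..<n}. f (a i) \<otimes>\<^bsub>B\<^esub> b i) = \<zero>\<^bsub>B\<^esub> \<longrightarrow>
        (\<exists>(m::nat) c d.
           (\<forall>i<n. \<forall>j<m. c i j \<in> carrier R) \<and> d \<in> {..<m} \<rightarrow> carrier B \<and>
           (\<forall>i<n. b i = (\<Oplus>\<^bsub>B\<^esub>j\<in>{..<m}. f (c i j) \<otimes>\<^bsub>B\<^esub> d j)) \<and>
           (\<forall>j<m. (\<Oplus>\<^bsub>R\<^esub>i\<in>{..<n}. a i \<otimes>\<^bsub>R\<^esub> c i j) = \<zero>\<^bsub>R\<^esub>)))"

text \<open>Polynomials in the variables \<open>X\<^sub>0, X\<^sub>1, \<dots>\<close>, represented by polynomial expressions.\<close>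

datatype 'r poly_expr =
    Coef 'r
  | Var nat
  | Plus "'r poly_expr" "'r poly_expr"
  | Times "'r poly_expr" "'r poly_expr"

primrec poly_expr_over :: "'r ring \<Rightarrow> nat \<Rightarrow> 'r poly_expr \<Rightarrow> bool" where
  "poly_expr_over R n (Coef r) \<longleftrightarrow> r \<in> carrier R"
| "poly_expr_over R n (Var i) \<longleftrightarrow> i < n"
| "poly_expr_over R n (Plus s t) \<longleftrightarrow> poly_expr_over R n s \<and> poly_expr_over R n t"
| "poly_expr_over R n (Times s t) \<longleftrightarrow> poly_expr_over R n s \<and> poly_expr_over R n t"

primrec poly_expr_value ::
    "'b ring \<Rightarrow> ('r \<Rightarrow> 'b) \<Rightarrow> (nat \<Rightarrow> 'b) \<Rightarrow> 'r poly_expr \<Rightarrow> 'b" where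
  "poly_expr_value B f b (Coef r) = f r"
| "poly_expr_value B f b (Var i) = b i"
| "poly_expr_value B f b (Plus s t) = poly_expr_value B f b s \<oplus>\<^bsub>B\<^esub> poly_expr_value B f b t"
| "poly_expr_value B f b (Times s t) = poly_expr_value B f b s \<otimes>\<^bsub>B\<^esub> poly_expr_value B f b t"

text \<open>
  \<open>B\<close> is generated over \<open>R\<close> by \<open>b 0, \<dots>, b (n - 1)\<close> and has the universal property of
  \<open>R[X\<^sub>0, \<dots>, X\<^sub>n\<^sub>-\<^sub>1] / (E)\<close> for a finite set \<open>E\<close> of polynomials.
\<close>

definition finitely_presented_hom :: "'u ring \<Rightarrow> 'u ring \<Rightarrow> ('u \<Rightarrow> 'u) \<Rightarrow> bool" where
  "finitely_presented_hom R B f \<longleftrightarrow>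
     (\<exists>(n::nat) b E.
        b \<in> {..<n} \<rightarrow> carrier B \<and>
        finite E \<and> (\<forall>e\<in>E. poly_expr_over R n e \<and> poly_expr_value B f b e = \<zero>\<^bsub>B\<^esub>) \<and>
        (\<forall>x\<in>carrier B. \<exists>e. poly_expr_over R n e \<and> poly_expr_value B f b e = x) \<and>
        (\<forall>(C :: 'u ring) g c.
           cring C \<and> g \<in> ring_hom R C \<and> c \<in> {..<n} \<rightarrow> carrier C \<and>
           (\<forall>e\<in>E. poly_expr_value C g c e = \<zero>\<^bsub>C\<^esub>) \<longrightarrow>
           (\<exists>h\<in>ring_hom B C. (\<forall>r\<in>carrier R. h (f r) = g r) \<and> (\<forall>i<n. h (b i) = c i))))"

text \<open>
  An fppf covering of \<open>Spec A\<close> is a finite family of flat, finitely presented algebras whose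
  spectra jointly surject onto \<open>Spec A\<close>.
\<close>

definition fppf_covering ::
    "'k ring \<Rightarrow> ('k, 'u) alg \<Rightarrow> (('k, 'u) alg \<times> ('u \<Rightarrow> 'u)) set \<Rightarrow> bool" where
  "fppf_covering k A U \<longleftrightarrow>
     finite U \<and>
     (\<forall>(B, f)\<in>U. is_alg_hom k A B f \<and> flat_hom (fst A) (fst B) f \<and>
        finitely_presented_hom (fst A) (fst B) f) \<and>
     (\<forall>P. primeideal P (fst A) \<longrightarrow>
        (\<exists>(B, f)\<in>U. \<exists>Q. primeideal Q (fst B) \<and> {x \<in> carrier (fst A). f x \<in> Q} = P))"

section \<open>Sheaves of commutative groups\<close>

text \<open>Homomorphisms are functions on a whole type, of which only the values on the carrier matter.\<close>

record ('k, 'u, 's) group_functor =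
  sections :: "('k, 'u) alg \<Rightarrow> 's monoid"
  restr :: "('k, 'u) alg \<Rightarrow> ('k, 'u) alg \<Rightarrow> ('u \<Rightarrow> 'u) \<Rightarrow> 's \<Rightarrow> 's"

definition group_presheaf :: "'k ring \<Rightarrow> ('k, 'u, 's) group_functor \<Rightarrow> bool" where
  "group_presheaf k F \<longleftrightarrow>
     (\<forall>A. is_alg k A \<longrightarrow> comm_group (sections F A)) \<and>
     (\<forall>A B f. is_alg_hom k A B f \<longrightarrow> restr F A B f \<in> hom (sections F A) (sections F B)) \<and>
     (\<forall>A B f g. is_alg_hom k A B f \<and> is_alg_hom k A B g \<and>
        (\<forall>x\<in>carrier (fst A). f x = g x) \<longrightarrow>
        (\<forall>s\<in>carrier (sections F A). restr F A B f s = restr F A B g s)) \<and>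
     (\<forall>A. is_alg k A \<longrightarrow> (\<forall>s\<in>carrier (sections F A). restr F A A id s = s)) \<and>
     (\<forall>A B C f g. is_alg_hom k A B f \<and> is_alg_hom k B C g \<longrightarrow>
        (\<forall>s\<in>carrier (sections F A). restr F A C (g \<circ> f) s = restr F B C g (restr F A B f s)))"

text \<open>
  Compatibility of a family of sections on a covering is tested on all algebras \<open>C\<close> that receive
  compatible maps from two members \<open>B\<close> and \<open>B'\<close> of the covering; this is the same as testing it on
  the tensor product of \<open>B\<close> and \<open>B'\<close> over \<open>A\<close>, which is the universal such \<open>C\<close>.
\<close>

definition fppf_sheaf :: "'k ring \<Rightarrow> ('k, 'u, 's) group_functor \<Rightarrow> bool" where
  "fppf_sheaf k F \<longleftrightarrow>
     group_presheaf k F \<and>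
     (\<forall>A U s.
        is_alg k A \<and> fppf_covering k A U \<and>
        (\<forall>(B, f)\<in>U. s (B, f) \<in> carrier (sections F B)) \<and>
        (\<forall>(B, f)\<in>U. \<forall>(B', f')\<in>U. \<forall>C g g'.
           is_alg_hom k B C g \<and> is_alg_hom k B' C g' \<and>
           (\<forall>x\<in>carrier (fst A). g (f x) = g' (f' x)) \<longrightarrow>
           restr F B C g (s (B, f)) = restr F B' C g' (s (B', f'))) \<longrightarrow>
        (\<exists>!t. t \<in> carrier (sections F A) \<and> (\<forall>(B, f)\<in>U. restr F A B f t = s (B, f))))"

definition sheaf_hom ::
    "'k ring \<Rightarrow> ('k, 'u, 's) group_functor \<Rightarrow> ('k, 'u, 't) group_functor \<Rightarrow>
     (('k, 'u) alg \<Rightarrow> 's \<Rightarrow> 't) \<Rightarrow> bool" where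
  "sheaf_hom k F G m \<longleftrightarrow>
     (\<forall>A. is_alg k A \<longrightarrow> m A \<in> hom (sections F A) (sections G A)) \<and>
     (\<forall>A B f. is_alg_hom k A B f \<longrightarrow>
        (\<forall>s\<in>carrier (sections F A). m B (restr F A B f s) = restr G A B f (m A s)))"

text \<open>Exactness of \<open>0 \<rightarrow> F \<rightarrow> G \<rightarrow> H \<rightarrow> 0\<close>; surjectivity means surjectivity locally for the fppf topology.\<close>

definition short_exact ::
    "'k ring \<Rightarrow> ('k, 'u, 'f) group_functor \<Rightarrow> (('k, 'u) alg \<Rightarrow> 'f \<Rightarrow> 'g) \<Rightarrow>
     ('k, 'u, 'g) group_functor \<Rightarrow> (('k, 'u) alg \<Rightarrow> 'g \<Rightarrow> 'h) \<Rightarrow>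
     ('k, 'u, 'h) group_functor \<Rightarrow> bool" where
  "short_exact k F i G q H \<longleftrightarrow>
     fppf_sheaf k F \<and> fppf_sheaf k G \<and> fppf_sheaf k H \<and> sheaf_hom k F G i \<and> sheaf_hom k G H q \<and>
     (\<forall>A. is_alg k A \<longrightarrow>
        inj_on (i A) (carrier (sections F A)) \<and>
        i A ` carrier (sections F A) = kernel (sections G A) (sections H A) (q A) \<and>
        (\<forall>h\<in>carrier (sections H A). \<exists>U. fppf_covering k A U \<and>
           (\<forall>(B, f)\<in>U. restr H A B f h \<in> q B ` carrier (sections G B))))"

text \<open>The restrictions of \<open>F\<close> and \<open>G\<close> to the site of \<open>B\<close>-algebras are isomorphic.\<close>

definition isomorphic_over ::
    "'k ring \<Rightarrow> ('k, 'u) alg \<Rightarrow> ('k, 'u, 's) group_functor \<Rightarrow> ('k, 'u, 't) group_functor \<Rightarrow> bool" where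
  "isomorphic_over k B F G \<longleftrightarrow>
     (\<exists>m. (\<forall>C h. is_alg_hom k B C h \<longrightarrow> m C h \<in> iso (sections F C) (sections G C)) \<and>
          (\<forall>C D h g. is_alg_hom k B C h \<and> is_alg_hom k C D g \<longrightarrow>
             (\<forall>s\<in>carrier (sections F C).
                m D (g \<circ> h) (restr F C D g s) = restr G C D g (m C h s))))"

section \<open>Group schemes\<close>

definition zero_sheaf :: "('k, 'u, unit) group_functor" where
  "zero_sheaf = \<lparr>sections = (\<lambda>A. singleton_group ()), restr = (\<lambda>A B f s. s)\<rparr>"

definition is_zero_sheaf :: "'k ring \<Rightarrow> ('k, 'u, 's) group_functor \<Rightarrow> bool" where
  "is_zero_sheaf k F \<longleftrightarrow>
     fppf_sheaf k F \<and> (\<forall>A. is_alg k A \<longrightarrow> carrier (sections F A) = {\<one>\<^bsub>sections F A\<^esub>})"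

text \<open>
  The constant group scheme attached to an abstract group \<open>G\<close>.  A map from \<open>Spec R\<close> to the
  disjoint union of copies of the base indexed by \<open>G\<close> is a decomposition of \<open>Spec R\<close> into open and
  closed pieces indexed by \<open>G\<close>, that is, a family of orthogonal idempotents \<open>e g\<close> of \<open>R\<close>, almost
  all zero and with sum \<open>1\<close>; the map has the constant value \<open>g\<close> where \<open>e g = 1\<close>.  Idempotency
  follows from the other conditions, and the product of sections is given by convolution.
\<close>

definition constant_sections :: "'g monoid \<Rightarrow> 'u ring \<Rightarrow> ('g \<Rightarrow> 'u) monoid" where
  "constant_sections G R =
     \<lparr>carrier = {e. (\<forall>g. e g \<in> carrier R) \<and> (\<forall>g. g \<notin> carrier G \<longrightarrow> e g = \<zero>\<^bsub>R\<^esub>) \<and>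
                    finite {g. e g \<noteq> \<zero>\<^bsub>R\<^esub>} \<and>
                    (\<forall>g h. g \<noteq> h \<longrightarrow> e g \<otimes>\<^bsub>R\<^esub> e h = \<zero>\<^bsub>R\<^esub>) \<and>
                    (\<Oplus>\<^bsub>R\<^esub>g\<in>{g. e g \<noteq> \<zero>\<^bsub>R\<^esub>}. e g) = \<one>\<^bsub>R\<^esub>},
      monoid.mult = (\<lambda>e e' g.
         if g \<in> carrier G
         then (\<Oplus>\<^bsub>R\<^esub>h\<in>{h. e h \<noteq> \<zero>\<^bsub>R\<^esub>}. e h \<otimes>\<^bsub>R\<^esub> e' (inv\<^bsub>G\<^esub> h \<otimes>\<^bsub>G\<^esub> g))
         else \<zero>\<^bsub>R\<^esub>),
      one = (\<lambda>g. if g = \<one>\<^bsub>G\<^esub> then \<one>\<^bsub>R\<^esub> else \<zero>\<^bsub>R\<^esub>)\<rparr>"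

definition constant_sheaf :: "'g monoid \<Rightarrow> ('k, 'u, 'g \<Rightarrow> 'u) group_functor" where
  "constant_sheaf G =
     \<lparr>sections = (\<lambda>A. constant_sections G (fst A)), restr = (\<lambda>A B f e. f \<circ> e)\<rparr>"

definition Gm_power :: "nat \<Rightarrow> ('k, 'u, nat \<Rightarrow> 'u) group_functor" where
  "Gm_power r =
     \<lparr>sections = (\<lambda>A. product_group {..<r} (\<lambda>i. units_of (fst A))),
      restr = (\<lambda>A B f x. restrict (f \<circ> x) {..<r})\<rparr>"

definition Gm_times_Gm :: "('k, 'u, 'u \<times> 'u) group_functor" where
  "Gm_times_Gm =
     \<lparr>sections = (\<lambda>A. units_of (fst A) \<times>\<times> units_of (fst A)), restr = (\<lambda>A B f. map_prod f f)\<rparr>"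

definition torus :: "'k ring \<Rightarrow> ('k, 'u, 's) group_functor \<Rightarrow> bool" where
  "torus k F \<longleftrightarrow>
     fppf_sheaf k F \<and>
     (\<forall>A. is_alg k A \<longrightarrow>
        (\<exists>U. fppf_covering k A U \<and> (\<forall>(B, f)\<in>U. \<exists>r. isomorphic_over k B F (Gm_power r))))"

definition lattice_scheme :: "'k ring \<Rightarrow> ('k, 'u, 's) group_functor \<Rightarrow> bool" where
  "lattice_scheme k F \<longleftrightarrow>
     fppf_sheaf k F \<and>
     (\<forall>A. is_alg k A \<longrightarrow>
        (\<exists>U. fppf_covering k A U \<and>
           (\<forall>(B, f)\<in>U. \<exists>r::nat. isomorphic_over k B F (constant_sheaf (free_Abelian_group {..<r})))))"

text \<open>
  \<open>F\<close> is represented by an algebra \<open>E\<close> that is flat over \<open>k\<close> and finitely generated as a module;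
  \<open>x\<close> is the universal section.
\<close>

definition finite_flat_group_scheme :: "'k ring \<Rightarrow> ('k, 'u, 's) group_functor \<Rightarrow> bool" where
  "finite_flat_group_scheme k F \<longleftrightarrow>
     group_presheaf k F \<and>
     (\<exists>E x. is_alg k E \<and> flat_hom k (fst E) (snd E) \<and>
        (\<exists>T. finite T \<and> T \<subseteq> carrier (fst E) \<and>
           (\<forall>y\<in>carrier (fst E). \<exists>c\<in>T \<rightarrow> carrier k.
              y = (\<Oplus>\<^bsub>fst E\<^esub>t\<in>T. snd E (c t) \<otimes>\<^bsub>fst E\<^esub> t))) \<and>
        x \<in> carrier (sections F E) \<and>
        (\<forall>A. is_alg k A \<longrightarrow> (\<forall>y\<in>carrier (sections F A).
           (\<exists>f. is_alg_hom k E A f \<and> restr F E A f x = y) \<and>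
           (\<forall>f g. is_alg_hom k E A f \<and> is_alg_hom k E A g \<and>
              restr F E A f x = y \<and> restr F E A g x = y \<longrightarrow>
              (\<forall>z\<in>carrier (fst E). f z = g z)))))"

section \<open>1-motives without abelian part\<close>

text \<open>
  A diagram consisting of \<open>0 \<rightarrow> X \<rightarrow> Z \<rightarrow> A \<rightarrow> 0\<close>, with maps \<open>incl\<close> and \<open>proj\<close>, and \<open>u : Y \<rightarrow> Z\<close>.
\<close>

record ('k, 'u, 'y, 'x, 'z, 'a) one_motive =
  Ypart :: "('k, 'u, 'y) group_functor"
  Xpart :: "('k, 'u, 'x) group_functor"
  Zpart :: "('k, 'u, 'z) group_functor"
  Apart :: "('k, 'u, 'a) group_functor"
  incl :: "('k, 'u) alg \<Rightarrow> 'x \<Rightarrow> 'z"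
  proj :: "('k, 'u) alg \<Rightarrow> 'z \<Rightarrow> 'a"
  umap :: "('k, 'u) alg \<Rightarrow> 'y \<Rightarrow> 'z"

text \<open>
  The abelian scheme is required to be zero here and below, the only case considered in this theory.
\<close>

definition one_motive_diagram :: "'k ring \<Rightarrow> ('k, 'u, 'y, 'x, 'z, 'a) one_motive \<Rightarrow> bool" where
  "one_motive_diagram k M \<longleftrightarrow>
     short_exact k (Xpart M) (incl M) (Zpart M) (proj M) (Apart M) \<and>
     fppf_sheaf k (Ypart M) \<and> sheaf_hom k (Ypart M) (Zpart M) (umap M) \<and>
     is_zero_sheaf k (Apart M)"

text \<open>
  \<open>G\<close> is an extension of a sheaf with property \<open>Q\<close> by a sheaf with property \<open>P\<close>.  Up to
  isomorphism the subsheaf has its sections among those of \<open>G\<close>.  The quotients that occur are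
  lattices and finite flat group schemes; these have at most as many sections over each algebra as
  the infinite type \<open>'u\<close> has elements, so that up to isomorphism their sections can be taken in \<open>'u\<close>.
\<close>

definition extension_of_by ::
    "'k ring \<Rightarrow> ('k, 'u, 's) group_functor \<Rightarrow> (('k, 'u, 'u) group_functor \<Rightarrow> bool) \<Rightarrow>
     (('k, 'u, 's) group_functor \<Rightarrow> bool) \<Rightarrow> bool" where
  "extension_of_by k G Q P \<longleftrightarrow>
     (\<exists>(F :: ('k, 'u, 's) group_functor) i q (H :: ('k, 'u, 'u) group_functor).
        short_exact k F i G q H \<and> P F \<and> Q H)"

definition torsion_one_motive ::
    "'k ring \<Rightarrow> ('k, 'u::infinite, 'y, 'x, 'z, 'a) one_motive \<Rightarrow> bool" where
  "torsion_one_motive k M \<longleftrightarrow>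
     one_motive_diagram k M \<and>
     extension_of_by k (Ypart M) (lattice_scheme k) (finite_flat_group_scheme k) \<and>
     extension_of_by k (Xpart M) (finite_flat_group_scheme k) (torus k)"

definition Deligne_one_motive ::
    "'k ring \<Rightarrow> ('k, 'u::infinite, 'y, 'x, 'z, 'a) one_motive \<Rightarrow> bool" where
  "Deligne_one_motive k M \<longleftrightarrow>
     one_motive_diagram k M \<and> lattice_scheme k (Ypart M) \<and> torus k (Xpart M)"

definition unit_pairs :: "'k ring \<Rightarrow> ('k \<times> 'k) monoid" where
  "unit_pairs k = units_of k \<times>\<times> units_of k"

text \<open>
  The 1-motive given by the inclusion of a subgroup \<open>L\<close> of the group of \<open>k\<close>-points of the torus
  \<open>T = G\<^sub>m \<times> G\<^sub>m\<close>.  A section of the constant sheaf, which equals \<open>g\<close> on the piece cut out by the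
  idempotent \<open>e g\<close>, is sent to the \<open>R\<close>-point of \<open>T\<close> that equals \<open>g\<close> on that piece.
\<close>

definition inclusion_map :: "('k, 'u) alg \<Rightarrow> ('k \<times> 'k \<Rightarrow> 'u) \<Rightarrow> 'u \<times> 'u" where
  "inclusion_map A e =
     ((\<Oplus>\<^bsub>fst A\<^esub>g\<in>{g. e g \<noteq> \<zero>\<^bsub>fst A\<^esub>}. e g \<otimes>\<^bsub>fst A\<^esub> snd A (fst g)),
      (\<Oplus>\<^bsub>fst A\<^esub>g\<in>{g. e g \<noteq> \<zero>\<^bsub>fst A\<^esub>}. e g \<otimes>\<^bsub>fst A\<^esub> snd A (snd g)))"

type_synonym ('k, 'u) inclusion_motive_type =
  "('k, 'u, 'k \<times> 'k \<Rightarrow> 'u, 'u \<times> 'u, 'u \<times> 'u, unit) one_motive"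

definition inclusion_motive ::
    "'k ring \<Rightarrow> ('k \<times> 'k) set \<Rightarrow> ('k, 'u::infinite) inclusion_motive_type" where
  "inclusion_motive k L =
     \<lparr>Ypart = constant_sheaf ((unit_pairs k)\<lparr>carrier := L\<rparr>),
      Xpart = Gm_times_Gm, Zpart = Gm_times_Gm, Apart = zero_sheaf,
      incl = (\<lambda>A x. x), proj = (\<lambda>A z. ()), umap = inclusion_map\<rparr>"

section \<open>The rings and the subgroups\<close>

definition S_integers :: "nat set \<Rightarrow> rat ring" where
  "S_integers S =
     \<lparr>carrier = {of_int a / of_nat m | a m. m > 0 \<and> prime_factors m \<subseteq> S},
      monoid.mult = (*), one = 1, ring.zero = 0, ring.add = (+)\<rparr>"

abbreviation prime_field :: "nat \<Rightarrow> int ring" where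
  "prime_field q \<equiv> residue_ring (int q)"

definition reduce_mod :: "nat \<Rightarrow> rat \<Rightarrow> int" where
  "reduce_mod q x =
     (case quotient_of x of (a, m) \<Rightarrow>
        (a mod int q) \<otimes>\<^bsub>prime_field q\<^esub> inv\<^bsub>prime_field q\<^esub> (m mod int q))"

abbreviation reduce_pair :: "nat \<Rightarrow> rat \<times> rat \<Rightarrow> int \<times> int" where
  "reduce_pair q \<equiv> map_prod (reduce_mod q) (reduce_mod q)"

definition lam :: "(nat \<Rightarrow> nat) \<Rightarrow> nat \<Rightarrow> rat \<times> rat" where
  "lam p N = (1, of_nat (p 1) ^ N)"

definition lam_idx :: "(nat \<Rightarrow> nat) \<Rightarrow> nat \<Rightarrow> nat \<Rightarrow> rat \<times> rat" where
  "lam_idx p n i =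
     (if i = 1 then (of_nat (p 1), 1)
      else if i \<le> n then (of_nat (p i), of_nat (p (i - 1)))
      else (1, of_nat (p n)))"

definition lam' :: "(nat \<Rightarrow> nat) \<Rightarrow> nat \<Rightarrow> nat \<Rightarrow> rat \<times> rat" where
  "lam' p n N' = (of_nat (p n) ^ N', 1)"

definition Lam :: "(nat \<Rightarrow> nat) \<Rightarrow> nat \<Rightarrow> nat \<Rightarrow> (rat \<times> rat) set" where
  "Lam p n N =
     (let G = unit_pairs (S_integers (p ` {1..n})) in
      {lam p N [^]\<^bsub>G\<^esub> a \<otimes>\<^bsub>G\<^esub> (\<Otimes>\<^bsub>G\<^esub>i\<in>{1..n + 1}. lam_idx p n i [^]\<^bsub>G\<^esub> x i)
         | (a :: int) (x :: nat \<Rightarrow> int). True})"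

definition Lam' :: "(nat \<Rightarrow> nat) \<Rightarrow> nat \<Rightarrow> nat \<Rightarrow> (rat \<times> rat) set" where
  "Lam' p n N' =
     (let G = unit_pairs (S_integers (p ` {1..n})) in
      {(\<Otimes>\<^bsub>G\<^esub>i\<in>{1..n + 1}. lam_idx p n i [^]\<^bsub>G\<^esub> x i) \<otimes>\<^bsub>G\<^esub> lam' p n N' [^]\<^bsub>G\<^esub> a
         | (a :: int) (x :: nat \<Rightarrow> int). True})"

end

theory Submission
  imports Defs "HOL-Library.Multiset" "HOL-Algebra.Weak_Morphisms"
begin

text \<open>
  Modulo a prime outside \<open>S\<close>, write \<open>p\<^sub>i = g ^ e\<^sub>i\<close> for a primitive root \<open>g\<close>. An element with exponent vectors
  \<open>(u, w)\<close> reduces to \<open>(g ^ (\<Sum>i. e\<^sub>i u\<^sub>i), g ^ (\<Sum>i. e\<^sub>i w\<^sub>i))\<close>, and both sums are already attained by a pair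
  \<open>(x\<^sub>i), (x\<^sub>i\<^sub>+\<^sub>1)\<close>, that is, by a product of the generators common to the two lattices. So all four
  lattices reduce to the image of their common part.

  That the diagrams are 1-motives rests on fppf descent. Given a compatible family \<open>b\<close> on a covering of \<open>A\<close>, the
  equational criterion for flatness shows that the ideal of those \<open>a\<close> for which \<open>a b\<close> comes from \<open>A\<close> lies in no
  prime ideal. Hence the multiplicative group and the constant groups are sheaves. A constant group scheme
  of a finite group is represented by a finite product of copies of the base field.
\<close>

section \<open>Linear relations over flat algebras\<close>

text \<open>That both sums are attained rests on a fact about integers. The pairs of sums reached by
  shifted vectors form the lattice in Z x Z spanned by (e(i+1), e(i)) for 0 \<le> i \<le> n, with
  zeros put at both ends. The zeros allow elimination from one end to the other, and this shows that
  the lattice contains every pair of multiples of the gcd of the exponents. Arbitrary exponent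
  vectors produce only such multiples.

  The sheaf part is shaped by the site. A compatible family is tested only on algebras whose carrier
  lies in \<open>'u\<close>, so the test must be carried out on a concrete algebra there, and
  equality in that algebra must have a consequence that can be read off over A. A quotient of an
  integer polynomial ring offers both: since \<open>'u\<close> is infinite it fits into
  \<open>'u\<close>, and its elements vanish for explicit finite reasons. Flatness then turns such a
  reason into denominators: 1 is a combination in B of elements of A, each of which multiplies b'
  into the image of A.\<close>

lemma (in abelian_monoid) finsum_lessThan_Suc:
  "f \<in> {..<Suc n} \<rightarrow> carrier G \<Longrightarrow> finsum G f {..<Suc n} = f n \<oplus> finsum G f {..<n}"
  by (subst lessThan_Suc, subst finsum_insert) auto

lemma (in abelian_monoid) finsum_lessThan_add:
  fixes m n :: nat
  shows "f \<in> {..<m + n} \<rightarrow> carrier G \<Longrightarrow>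
    finsum G f {..<m + n} = finsum G f {..<m} \<oplus> finsum G (\<lambda>j. f (m + j)) {..<n}"
proof (induction n)
  case 0
  then show ?case by (auto simp: Pi_iff)
next
  case (Suc n)
  then have c: "f \<in> {..<m} \<rightarrow> carrier G" "f (m + n) \<in> carrier G"
    "(\<lambda>j. f (m + j)) \<in> {..<n} \<rightarrow> carrier G" "f \<in> {..<m+n} \<rightarrow> carrier G"
    "f \<in> {..<Suc (m+n)} \<rightarrow> carrier G" "(\<lambda>j. f (m + j)) \<in> {..<Suc n} \<rightarrow> carrier G"
    by (auto simp: Pi_iff)
  have "finsum G f {..<m + Suc n} = f (m + n) \<oplus> finsum G f {..<m + n}"
    using finsum_lessThan_Suc[of f "m + n"] c by simp
  also have "\<dots> = finsum G f {..<m} \<oplus> (f (m + n) \<oplus> finsum G (\<lambda>j. f (m + j)) {..<n})"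
    using Suc.IH c by (simp add: a_lcomm)
  also have "f (m + n) \<oplus> finsum G (\<lambda>j. f (m + j)) {..<n} = finsum G (\<lambda>j. f (m + j)) {..<Suc n}"
    using finsum_lessThan_Suc[of "\<lambda>j. f (m + j)" n] c by simp
  finally show ?case .
qed

lemma (in abelian_monoid) finsum_swap:
  assumes "finite I" "finite J" "\<And>i j. i \<in> I \<Longrightarrow> j \<in> J \<Longrightarrow> f i j \<in> carrier G"
  shows "(\<Oplus>i\<in>I. \<Oplus>j\<in>J. f i j) = (\<Oplus>j\<in>J. \<Oplus>i\<in>I. f i j)"
  using assms(1,3)
proof (induction I)
  case (insert x I)
  have "(\<Oplus>i\<in>insert x I. \<Oplus>j\<in>J. f i j) = (\<Oplus>j\<in>J. f x j) \<oplus> (\<Oplus>j\<in>J. \<Oplus>i\<in>I. f i j)"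
    using insert by (subst finsum_insert) (auto intro!: finsum_closed)
  also have "\<dots> = (\<Oplus>j\<in>J. f x j \<oplus> (\<Oplus>i\<in>I. f i j))"
    using insert assms(2) by (subst finsum_addf) (auto intro!: finsum_closed)
  also have "\<dots> = (\<Oplus>j\<in>J. \<Oplus>i\<in>insert x I. f i j)"
    using insert by (intro finsum_cong') (auto intro!: finsum_closed)
  finally show ?case .
qed simp

text \<open>Associativity of row times matrix times column. Every change of the auxiliary column in
  a factorization passes through this identity.\<close>

lemma (in cring) finsum_assoc_swap:
  assumes "finite I" "finite J" and a: "\<And>i. i \<in> I \<Longrightarrow> a i \<in> carrier R"
    and c: "\<And>i j. i \<in> I \<Longrightarrow> j \<in> J \<Longrightarrow> c i j \<in> carrier R"
    and w: "\<And>j. j \<in> J \<Longrightarrow> w j \<in> carrier R"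
  shows "(\<Oplus>i\<in>I. a i \<otimes> (\<Oplus>j\<in>J. c i j \<otimes> w j)) = (\<Oplus>j\<in>J. (\<Oplus>i\<in>I. a i \<otimes> c i j) \<otimes> w j)"
proof -
  have "(\<Oplus>i\<in>I. a i \<otimes> (\<Oplus>j\<in>J. c i j \<otimes> w j)) = (\<Oplus>i\<in>I. \<Oplus>j\<in>J. a i \<otimes> c i j \<otimes> w j)"
    using assms by (intro finsum_cong') (auto simp: finsum_rdistr m_assoc intro!: finsum_closed finsum_cong')
  also have "\<dots> = (\<Oplus>j\<in>J. \<Oplus>i\<in>I. a i \<otimes> c i j \<otimes> w j)"
    using assms by (intro finsum_swap) auto
  also have "\<dots> = (\<Oplus>j\<in>J. (\<Oplus>i\<in>I. a i \<otimes> c i j) \<otimes> w j)"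
    using assms by (intro finsum_cong') (auto simp: finsum_ldistr intro!: finsum_closed)
  finally show ?thesis .
qed

section \<open>The equational criterion for flatness in matrix form\<close>

locale flat_ring_hom = ring_hom_cring R S h for R :: "'a ring" (structure) and S :: "'b ring" (structure) and h +
  assumes flat: "flat_hom R S h"
begin

text \<open>In matrix form \<open>b = h(c) d\<close>, while \<open>relations\<close> below says that
  each row \<open>a k\<close> kills \<open>c\<close>. The flatness criterion then reads: a row
  relation on the column \<open>b\<close> lifts to a factorization whose matrix is killed by that
  row.\<close>

definition factorization ::
    "nat \<Rightarrow> (nat \<Rightarrow> 'b) \<Rightarrow> nat \<Rightarrow> (nat \<Rightarrow> nat \<Rightarrow> 'a) \<Rightarrow> (nat \<Rightarrow> 'b) \<Rightarrow> bool" where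
  "factorization n b m c d \<longleftrightarrow>
     (\<forall>i<n. \<forall>j<m. c i j \<in> carrier R) \<and> (\<forall>j<m. d j \<in> carrier S) \<and>
     (\<forall>i<n. b i = (\<Oplus>\<^bsub>S\<^esub>j\<in>{..<m}. h (c i j) \<otimes>\<^bsub>S\<^esub> d j))"

definition relations :: "'k set \<Rightarrow> ('k \<Rightarrow> nat \<Rightarrow> 'a) \<Rightarrow> nat \<Rightarrow> nat \<Rightarrow> (nat \<Rightarrow> nat \<Rightarrow> 'a) \<Rightarrow> bool" where
  "relations K a n m c \<longleftrightarrow> (\<forall>k\<in>K. \<forall>j<m. (\<Oplus>i\<in>{..<n}. a k i \<otimes> c i j) = \<zero>)"

lemma factorizationD:
  assumes "factorization n b m c d"
  shows "\<And>i j. i < n \<Longrightarrow> j < m \<Longrightarrow> c i j \<in> carrier R" "\<And>j. j < m \<Longrightarrow> d j \<in> carrier S"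
    "\<And>i. i < n \<Longrightarrow> b i = (\<Oplus>\<^bsub>S\<^esub>j\<in>{..<m}. h (c i j) \<otimes>\<^bsub>S\<^esub> d j)"
  using assms by (simp_all add: factorization_def)

lemma factorization_comp:
  assumes 1: "factorization n b m c d" and 2: "factorization m d m' c' d'"
  shows "factorization n b m' (\<lambda>i s. \<Oplus>j\<in>{..<m}. c i j \<otimes> c' j s) d'"
proof -
  note m = factorizationD[OF 1] and m' = factorizationD[OF 2]
  have "b i = (\<Oplus>\<^bsub>S\<^esub>s\<in>{..<m'}. h (\<Oplus>j\<in>{..<m}. c i j \<otimes> c' j s) \<otimes>\<^bsub>S\<^esub> d' s)" if "i < n" for i
  proof -
    have "b i = (\<Oplus>\<^bsub>S\<^esub>j\<in>{..<m}. h (c i j) \<otimes>\<^bsub>S\<^esub> (\<Oplus>\<^bsub>S\<^esub>s\<in>{..<m'}. h (c' j s) \<otimes>\<^bsub>S\<^esub> d' s))"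
      unfolding m(3)[OF that] using m m' that by (intro S.finsum_cong') (auto intro!: S.finsum_closed)
    also have "\<dots> = (\<Oplus>\<^bsub>S\<^esub>s\<in>{..<m'}. (\<Oplus>\<^bsub>S\<^esub>j\<in>{..<m}. h (c i j) \<otimes>\<^bsub>S\<^esub> h (c' j s)) \<otimes>\<^bsub>S\<^esub> d' s)"
      using m m' that by (intro S.finsum_assoc_swap) auto
    also have "\<dots> = (\<Oplus>\<^bsub>S\<^esub>s\<in>{..<m'}. h (\<Oplus>j\<in>{..<m}. c i j \<otimes> c' j s) \<otimes>\<^bsub>S\<^esub> d' s)"
    proof (intro S.finsum_cong')
      fix s assume s: "s \<in> {..<m'}"
      have "h (\<Oplus>j\<in>{..<m}. c i j \<otimes> c' j s) = (\<Oplus>\<^bsub>S\<^esub>j\<in>{..<m}. h (c i j \<otimes> c' j s))"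
        using m m' that s by (subst hom_finsum) (auto simp: o_def)
      also have "\<dots> = (\<Oplus>\<^bsub>S\<^esub>j\<in>{..<m}. h (c i j) \<otimes>\<^bsub>S\<^esub> h (c' j s))"
        using m m' that s by (intro S.finsum_cong') auto
      finally show "(\<Oplus>\<^bsub>S\<^esub>j\<in>{..<m}. h (c i j) \<otimes>\<^bsub>S\<^esub> h (c' j s)) \<otimes>\<^bsub>S\<^esub> d' s =
          h (\<Oplus>j\<in>{..<m}. c i j \<otimes> c' j s) \<otimes>\<^bsub>S\<^esub> d' s" by simp
    qed (use m m' that in \<open>auto intro!: S.m_closed R.finsum_closed\<close>)
    finally show ?thesis .
  qed
  then show ?thesis
    unfolding factorization_def using m m' by (auto intro!: R.finsum_closed)
qed

text \<open>Rows that kill \<open>c\<close> also kill the matrix product of \<open>c\<close> and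
  \<open>c'\<close>, so refining a factorization keeps the relations already achieved.\<close>

lemma relations_comp:
  assumes 1: "factorization n b m c d" and 2: "factorization m d m' c' d'"
    and a: "\<And>k i. k \<in> K \<Longrightarrow> i < n \<Longrightarrow> a k i \<in> carrier R"
    and r: "relations K a n m c"
  shows "relations K a n m' (\<lambda>i s. \<Oplus>j\<in>{..<m}. c i j \<otimes> c' j s)"
  unfolding relations_def
proof (intro ballI allI impI)
  note m = factorizationD[OF 1] and m' = factorizationD[OF 2]
  fix k s assume k: "k \<in> K" "s < m'"
  have "(\<Oplus>i\<in>{..<n}. a k i \<otimes> (\<Oplus>j\<in>{..<m}. c i j \<otimes> c' j s)) =
      (\<Oplus>j\<in>{..<m}. (\<Oplus>i\<in>{..<n}. a k i \<otimes> c i j) \<otimes> c' j s)"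
    using k a m m' by (intro R.finsum_assoc_swap) auto
  also have "\<dots> = \<zero>"
    using r[unfolded relations_def] k m'(1) by (intro R.add.finprod_one_eqI) auto
  finally show "(\<Oplus>i\<in>{..<n}. a k i \<otimes> (\<Oplus>j\<in>{..<m}. c i j \<otimes> c' j s)) = \<zero>" .
qed

lemma flat_relation:
  assumes "\<And>i. i < n \<Longrightarrow> a i \<in> carrier R" "\<And>i. i < n \<Longrightarrow> b i \<in> carrier S"
    and "(\<Oplus>\<^bsub>S\<^esub>i\<in>{..<n}. h (a i) \<otimes>\<^bsub>S\<^esub> b i) = \<zero>\<^bsub>S\<^esub>"
  shows "\<exists>m c d. factorization n b m c d \<and> relations {()} (\<lambda>_. a) n m c"
proof -
  have "a \<in> {..<n} \<rightarrow> carrier R \<and> b \<in> {..<n} \<rightarrow> carrier S \<and>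
    (\<Oplus>\<^bsub>S\<^esub>i\<in>{..<n}. h (a i) \<otimes>\<^bsub>S\<^esub> b i) = \<zero>\<^bsub>S\<^esub>"
    using assms by blast
  from flat[unfolded flat_hom_def, rule_format, OF this] show ?thesis
    apply (elim exE conjE)
    subgoal for m c d
      by (rule exI[of _ m], rule exI[of _ c], rule exI[of _ d])
        (auto simp: factorization_def relations_def)
    done
qed

text \<open>The relations are lifted one at a time. Once \<open>b\<close> factors through
  \<open>d\<close>, the next row \<open>a k0\<close> becomes a relation on \<open>d\<close>, with
  coefficients the product of the row with \<open>c\<close>; lifting it refines the factorization
  without disturbing the earlier rows.\<close>

lemma flat_relations:
  assumes "finite K" and "\<And>k i. k \<in> K \<Longrightarrow> i < n \<Longrightarrow> a k i \<in> carrier R"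
    and b: "\<And>i. i < n \<Longrightarrow> b i \<in> carrier S"
    and "\<And>k. k \<in> K \<Longrightarrow> (\<Oplus>\<^bsub>S\<^esub>i\<in>{..<n}. h (a k i) \<otimes>\<^bsub>S\<^esub> b i) = \<zero>\<^bsub>S\<^esub>"
  shows "\<exists>m c d. factorization n b m c d \<and> relations K a n m c"
  using assms(1,2,4)
proof (induction K)
  \<comment> \<open>Without any row there is still a factorization to produce; the relation with
    zero coefficients supplies one.\<close>
  case empty
  have "(\<Oplus>\<^bsub>S\<^esub>i\<in>{..<n}. h \<zero> \<otimes>\<^bsub>S\<^esub> b i) = \<zero>\<^bsub>S\<^esub>"
    using b by (auto intro: S.add.finprod_one_eqI)
  then have "\<exists>m c d. factorization n b m c d"
    using flat_relation[of n "\<lambda>_. \<zero>" b] b by blast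
  then show ?case by (simp add: relations_def)
next
  case (insert k0 K)
  have "\<exists>m c d. factorization n b m c d \<and> relations K a n m c"
    using insert.prems by (intro insert.IH) blast+
  then obtain m c d where 1: "factorization n b m c d" and r: "relations K a n m c"
    by blast
  note m = factorizationD[OF 1]
  have ak: "a k0 i \<in> carrier R" if "i < n" for i using insert.prems(1) that by blast
  let ?e = "\<lambda>j. \<Oplus>i\<in>{..<n}. a k0 i \<otimes> c i j"
  have e: "?e j \<in> carrier R" if "j < m" for j
    using m ak that by (auto intro!: R.finsum_closed)
  have "\<zero>\<^bsub>S\<^esub> = (\<Oplus>\<^bsub>S\<^esub>i\<in>{..<n}. h (a k0 i) \<otimes>\<^bsub>S\<^esub> b i)"
    using insert.prems by simp
  also have "\<dots> = (\<Oplus>\<^bsub>S\<^esub>i\<in>{..<n}. h (a k0 i) \<otimes>\<^bsub>S\<^esub> (\<Oplus>\<^bsub>S\<^esub>j\<in>{..<m}. h (c i j) \<otimes>\<^bsub>S\<^esub> d j))"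
    using m ak b by (intro S.finsum_cong') (auto intro!: S.finsum_closed)
  also have "\<dots> = (\<Oplus>\<^bsub>S\<^esub>j\<in>{..<m}. (\<Oplus>\<^bsub>S\<^esub>i\<in>{..<n}. h (a k0 i) \<otimes>\<^bsub>S\<^esub> h (c i j)) \<otimes>\<^bsub>S\<^esub> d j)"
    using m ak by (intro S.finsum_assoc_swap) auto
  also have "\<dots> = (\<Oplus>\<^bsub>S\<^esub>j\<in>{..<m}. h (?e j) \<otimes>\<^bsub>S\<^esub> d j)"
  proof (intro S.finsum_cong')
    fix j assume j: "j \<in> {..<m}"
    have "h (?e j) = (\<Oplus>\<^bsub>S\<^esub>i\<in>{..<n}. h (a k0 i \<otimes> c i j))"
      using m ak j by (subst hom_finsum) (auto simp: o_def)
    also have "\<dots> = (\<Oplus>\<^bsub>S\<^esub>i\<in>{..<n}. h (a k0 i) \<otimes>\<^bsub>S\<^esub> h (c i j))"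
      using m ak j by (intro S.finsum_cong') auto
    finally show "(\<Oplus>\<^bsub>S\<^esub>i\<in>{..<n}. h (a k0 i) \<otimes>\<^bsub>S\<^esub> h (c i j)) \<otimes>\<^bsub>S\<^esub> d j = h (?e j) \<otimes>\<^bsub>S\<^esub> d j"
      by simp
  qed (use m e in auto)
  finally have "(\<Oplus>\<^bsub>S\<^esub>j\<in>{..<m}. h (?e j) \<otimes>\<^bsub>S\<^esub> d j) = \<zero>\<^bsub>S\<^esub>" by simp
  from flat_relation[OF e m(2) this] obtain m' c' d' where 2: "factorization m d m' c' d'"
    and r': "relations {()} (\<lambda>_. ?e) m m' c'" by blast
  note m' = factorizationD[OF 2]
  let ?c = "\<lambda>i s. \<Oplus>j\<in>{..<m}. c i j \<otimes> c' j s"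
  have "relations K a n m' ?c"
    using insert.prems(1) by (intro relations_comp[OF 1 2 _ r]) blast
  moreover have "(\<Oplus>i\<in>{..<n}. a k0 i \<otimes> ?c i s) = \<zero>" if "s < m'" for s
  proof -
    have "(\<Oplus>i\<in>{..<n}. a k0 i \<otimes> ?c i s) = (\<Oplus>j\<in>{..<m}. ?e j \<otimes> c' j s)"
      using m m' that ak by (intro R.finsum_assoc_swap) auto
    also have "\<dots> = \<zero>" using r' that by (simp add: relations_def)
    finally show ?thesis .
  qed
  ultimately have "relations (insert k0 K) a n m' ?c"
    by (auto simp: relations_def)
  with factorization_comp[OF 1 2] show ?case by blast
qed

end

section \<open>Pushouts of algebras\<close>

text \<open>The guard skips factors outside the carrier. The folded operation therefore commutes for
  every \<open>h\<close>, and the product lies in the carrier for arbitrary multisets, so that all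
  pairs of the underlying types can serve as polynomial variables.\<close>

definition mset_prod :: "('a, 'm) monoid_scheme \<Rightarrow> ('s \<Rightarrow> 'a) \<Rightarrow> 's multiset \<Rightarrow> 'a" where
  "mset_prod G h M =
     fold_mset (\<lambda>z a. if h z \<in> carrier G \<and> a \<in> carrier G then h z \<otimes>\<^bsub>G\<^esub> a else a) \<one>\<^bsub>G\<^esub> M"

context comm_monoid
begin

lemma mset_prod_commute:
  "comp_fun_commute (\<lambda>z a. if h z \<in> carrier G \<and> a \<in> carrier G then h z \<otimes> a else a)"
  by standard (auto simp: fun_eq_iff m_lcomm)

lemma mset_prod_empty [simp]: "mset_prod G h {#} = \<one>"
  by (simp add: mset_prod_def)

lemma mset_prod_add_mset_aux:
  "mset_prod G h (add_mset z M) =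
     (if h z \<in> carrier G \<and> mset_prod G h M \<in> carrier G then h z \<otimes> mset_prod G h M else mset_prod G h M)"
  unfolding mset_prod_def by (rule comp_fun_commute.fold_mset_add_mset[OF mset_prod_commute])

lemma mset_prod_closed [simp]: "mset_prod G h M \<in> carrier G"
  by (induction M) (auto simp: mset_prod_add_mset_aux)

lemma mset_prod_add_mset:
  "h z \<in> carrier G \<Longrightarrow> mset_prod G h (add_mset z M) = h z \<otimes> mset_prod G h M"
  by (simp add: mset_prod_add_mset_aux)

lemma mset_prod_union: "mset_prod G h (M + N) = mset_prod G h M \<otimes> mset_prod G h N"
  by (induction M) (auto simp: mset_prod_add_mset_aux m_assoc)

end

locale algebra_pair =
  F: ring_hom_cring A B f + F': ring_hom_cring A B' f'
  for A :: "'a ring" and B :: "'b ring" and B' :: "'c ring" and f f'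
begin

text \<open>
  The pushout \<open>B \<otimes>\<^sub>A B'\<close> is built as a quotient of the polynomial ring over \<open>\<int>\<close> in the pairs \<open>(b, b')\<close>, which stand
  for \<open>b \<otimes> b'\<close>; a multiset of pairs is a monomial. An entry \<open>(v, s, c)\<close> is the term \<open>v \<cdot> s\<close> together with an expansion
  \<open>left s = (\<Sum>j. c\<^sub>j d\<^sub>j)\<close>. Collecting the factors of \<open>d\<^sub>j\<close> gives \<open>weight j\<close>, so a polynomial represents zero
  when all weights vanish for some \<open>d\<close>.
\<close>

definition left :: "('b \<times> 'c) multiset \<Rightarrow> 'b" where "left s = mset_prod B fst s"
definition right :: "('b \<times> 'c) multiset \<Rightarrow> 'c" where "right s = mset_prod B' snd s"

lemma left_simps [simp]: "left {#} = \<one>\<^bsub>B\<^esub>" "left s \<in> carrier B"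
  "left (s + t) = left s \<otimes>\<^bsub>B\<^esub> left t" "fst z \<in> carrier B \<Longrightarrow> left {#z#} = fst z"
  by (simp_all add: left_def F.S.mset_prod_union F.S.mset_prod_add_mset)

lemma right_simps [simp]: "right {#} = \<one>\<^bsub>B'\<^esub>" "right s \<in> carrier B'"
  "right (s + t) = right s \<otimes>\<^bsub>B'\<^esub> right t" "snd z \<in> carrier B' \<Longrightarrow> right {#z#} = snd z"
  by (simp_all add: right_def F'.S.mset_prod_union F'.S.mset_prod_add_mset)

type_synonym ('x, 'y, 'z) entry = "int \<times> ('y \<times> 'z) multiset \<times> (nat \<Rightarrow> 'x)"

definition entries :: "nat \<Rightarrow> (nat \<Rightarrow> 'b) \<Rightarrow> ('a, 'b, 'c) entry list \<Rightarrow> bool" where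
  "entries m d xs \<longleftrightarrow> (\<forall>j. d j \<in> carrier B) \<and>
     (\<forall>(v, s, c)\<in>set xs. (\<forall>j. c j \<in> carrier A) \<and>
        left s = (\<Oplus>\<^bsub>B\<^esub>j\<in>{..<m}. f (c j) \<otimes>\<^bsub>B\<^esub> d j))"

definition total :: "('a, 'b, 'c) entry list \<Rightarrow> ('b \<times> 'c) multiset \<Rightarrow>\<^sub>0 int" where
  "total xs = (\<Sum>(v, s, c)\<leftarrow>xs. Poly_Mapping.single s v)"

primrec weight :: "nat \<Rightarrow> ('a, 'b, 'c) entry list \<Rightarrow> 'c" where
  "weight j [] = \<zero>\<^bsub>B'\<^esub>"
| "weight j (x # xs) = (case x of (v, s, c) \<Rightarrow> [v] \<cdot>\<^bsub>B'\<^esub> (f' (c j) \<otimes>\<^bsub>B'\<^esub> right s)) \<oplus>\<^bsub>B'\<^esub> weight j xs"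

definition null :: "(('b \<times> 'c) multiset \<Rightarrow>\<^sub>0 int) set" where
  "null = {p. \<exists>m d xs. entries m d xs \<and> total xs = p \<and> (\<forall>j<m. weight j xs = \<zero>\<^bsub>B'\<^esub>)}"

lemma nullI: "entries m d xs \<Longrightarrow> total xs = p \<Longrightarrow> (\<And>j. j < m \<Longrightarrow> weight j xs = \<zero>\<^bsub>B'\<^esub>) \<Longrightarrow> p \<in> null"
  unfolding null_def by blast

lemma entries_Nil [simp]: "entries m d [] \<longleftrightarrow> (\<forall>j. d j \<in> carrier B)"
  by (simp add: entries_def)

lemma entries_Cons:
  "entries m d ((v, s, c) # xs) \<longleftrightarrow> (\<forall>j. c j \<in> carrier A) \<and>
     left s = (\<Oplus>\<^bsub>B\<^esub>j\<in>{..<m}. f (c j) \<otimes>\<^bsub>B\<^esub> d j) \<and> entries m d xs"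
  by (auto simp: entries_def)

lemma entries_append: "entries m d (xs @ ys) \<longleftrightarrow> entries m d xs \<and> entries m d ys"
  unfolding entries_def set_append ball_Un by blast

lemma total_simps [simp]:
  "total [] = 0" "total ((v, s, c) # xs) = Poly_Mapping.single s v + total xs"
  "total (xs @ ys) = total xs + total ys"
  by (simp_all add: total_def)

lemma weight_closed [simp]: "entries m d xs \<Longrightarrow> weight j xs \<in> carrier B'"
  by (induction xs) (auto simp: entries_Cons)

lemma weight_append:
  "entries m d xs \<Longrightarrow> entries m d ys \<Longrightarrow> weight j (xs @ ys) = weight j xs \<oplus>\<^bsub>B'\<^esub> weight j ys"
  by (induction xs) (auto simp: entries_Cons F'.S.a_assoc)

lemma weight_map:
  assumes "entries m d xs" "\<And>c. g c j = c j'"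
  shows "weight j (map (\<lambda>(v, s, c). (v, s, g c)) xs) = weight j' xs"
  using assms(1) by (induction xs) (auto simp: entries_Cons assms(2))

lemma weight_map_zero:
  assumes "entries m d xs" "\<And>c. g c j = \<zero>\<^bsub>A\<^esub>"
  shows "weight j (map (\<lambda>(v, s, c). (v, s, g c)) xs) = \<zero>\<^bsub>B'\<^esub>"
  using assms(1) by (induction xs) (auto simp: entries_Cons assms(2))

lemma total_map: "total (map (\<lambda>(v, s, c). (v, s, g c)) xs) = total xs"
  by (induction xs) auto

text \<open>Two entry lists over columns \<open>d\<close> and \<open>d'\<close> are moved to the
  concatenated columns: the first list gets zero coefficients on the new columns, the second
  (\<open>shift_high\<close>) on the old ones. Hence every weight of the joint list is a weight of
  one of the two.\<close>

definition shift_low :: "nat \<Rightarrow> ('a, 'b, 'c) entry list \<Rightarrow> ('a, 'b, 'c) entry list" where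
  "shift_low m = map (\<lambda>(v, s, c). (v, s, (\<lambda>j. if j < m then c j else \<zero>\<^bsub>A\<^esub>)))"

definition shift_high :: "nat \<Rightarrow> ('a, 'b, 'c) entry list \<Rightarrow> ('a, 'b, 'c) entry list" where
  "shift_high m = map (\<lambda>(v, s, c). (v, s, (\<lambda>j. if j < m then \<zero>\<^bsub>A\<^esub> else c (j - m))))"

lemma entries_shift:
  assumes "entries m d xs" "entries m' d' ys"
  defines "D \<equiv> \<lambda>j. if j < m then d j else d' (j - m)"
  shows "entries (m + m') D (shift_low m xs @ shift_high m ys)"
proof -
  have d: "d j \<in> carrier B" "d' j \<in> carrier B" for j using assms by (auto simp: entries_def)
  have "(\<Oplus>\<^bsub>B\<^esub>j\<in>{..<m+m'}. f (if j < m then c j else \<zero>\<^bsub>A\<^esub>) \<otimes>\<^bsub>B\<^esub> D j) =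
      (\<Oplus>\<^bsub>B\<^esub>j\<in>{..<m}. f (c j) \<otimes>\<^bsub>B\<^esub> d j)" if c: "\<And>j. c j \<in> carrier A" for c
  proof -
    have "(\<Oplus>\<^bsub>B\<^esub>j\<in>{..<m+m'}. f (if j < m then c j else \<zero>\<^bsub>A\<^esub>) \<otimes>\<^bsub>B\<^esub> D j) =
      (\<Oplus>\<^bsub>B\<^esub>j\<in>{..<m}. f (if j < m then c j else \<zero>\<^bsub>A\<^esub>) \<otimes>\<^bsub>B\<^esub> D j) \<oplus>\<^bsub>B\<^esub> (\<Oplus>\<^bsub>B\<^esub>j\<in>{..<m'}. \<zero>\<^bsub>B\<^esub>)"
      using c d by (subst F.S.finsum_lessThan_add) (auto simp: D_def intro!: arg_cong2[where f = "(\<oplus>\<^bsub>B\<^esub>)"] F.S.finsum_cong')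
    also have "(\<Oplus>\<^bsub>B\<^esub>j\<in>{..<m}. f (if j < m then c j else \<zero>\<^bsub>A\<^esub>) \<otimes>\<^bsub>B\<^esub> D j) = (\<Oplus>\<^bsub>B\<^esub>j\<in>{..<m}. f (c j) \<otimes>\<^bsub>B\<^esub> d j)"
      using c d by (intro F.S.finsum_cong') (auto simp: D_def)
    finally show ?thesis using c d by (simp add: F.S.finsum_closed)
  qed
  moreover have "(\<Oplus>\<^bsub>B\<^esub>j\<in>{..<m+m'}. f (if j < m then \<zero>\<^bsub>A\<^esub> else c (j - m)) \<otimes>\<^bsub>B\<^esub> D j) =
      (\<Oplus>\<^bsub>B\<^esub>j\<in>{..<m'}. f (c j) \<otimes>\<^bsub>B\<^esub> d' j)" if c: "\<And>j. c j \<in> carrier A" for c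
  proof -
    have "(\<Oplus>\<^bsub>B\<^esub>j\<in>{..<m}. f (if j < m then \<zero>\<^bsub>A\<^esub> else c (j - m)) \<otimes>\<^bsub>B\<^esub> D j) = \<zero>\<^bsub>B\<^esub>"
      using d by (intro F.S.add.finprod_one_eqI) (auto simp: D_def)
    moreover have "(\<Oplus>\<^bsub>B\<^esub>j\<in>{..<m'}. f (if m + j < m then \<zero>\<^bsub>A\<^esub> else c (m + j - m)) \<otimes>\<^bsub>B\<^esub> D (m + j)) =
        (\<Oplus>\<^bsub>B\<^esub>j\<in>{..<m'}. f (c j) \<otimes>\<^bsub>B\<^esub> d' j)"
      by (simp add: D_def)
    moreover have "(\<Oplus>\<^bsub>B\<^esub>j\<in>{..<m'}. f (c j) \<otimes>\<^bsub>B\<^esub> d' j) \<in> carrier B"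
      using c d by (auto intro!: F.S.finsum_closed)
    ultimately show ?thesis
      using c d by (subst F.S.finsum_lessThan_add) (auto simp: D_def)
  qed
  ultimately show ?thesis
    using assms(1,2) d
    by (auto simp: entries_def shift_low_def shift_high_def D_def split: if_splits)
qed

lemma weight_shift:
  assumes "entries m d xs" "entries m' d' ys"
  shows "weight j (shift_low m xs @ shift_high m ys) = (if j < m then weight j xs else weight (j - m) ys)"
proof -
  note e = entries_shift[OF assms, unfolded entries_append]
  have "weight j (shift_low m xs @ shift_high m ys) = weight j (shift_low m xs) \<oplus>\<^bsub>B'\<^esub> weight j (shift_high m ys)"
    using weight_append e by blast
  then show ?thesis
    using weight_map[of m d xs "\<lambda>c j. if j < m then c j else \<zero>\<^bsub>A\<^esub>" j j]
      weight_map_zero[of m d xs "\<lambda>c j. if j < m then c j else \<zero>\<^bsub>A\<^esub>" j]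
      weight_map[of m' d' ys "\<lambda>c j. if j < m then \<zero>\<^bsub>A\<^esub> else c (j - m)" j "j - m"]
      weight_map_zero[of m' d' ys "\<lambda>c j. if j < m then \<zero>\<^bsub>A\<^esub> else c (j - m)" j] assms
    by (auto simp: shift_low_def shift_high_def)
qed

lemma null_add:
  assumes "p \<in> null" "q \<in> null" shows "p + q \<in> null"
proof -
  from assms obtain m d xs m' d' ys where 1: "entries m d xs" "total xs = p" "\<forall>j<m. weight j xs = \<zero>\<^bsub>B'\<^esub>"
    and 2: "entries m' d' ys" "total ys = q" "\<forall>j<m'. weight j ys = \<zero>\<^bsub>B'\<^esub>"
    unfolding null_def by blast
  show ?thesis
  proof (rule nullI[OF entries_shift[OF 1(1) 2(1)]])
    show "total (shift_low m xs @ shift_high m ys) = p + q"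
      by (simp add: shift_low_def shift_high_def total_map 1 2)
  qed (use 1 2 in \<open>auto simp: weight_shift[OF 1(1) 2(1)]\<close>)
qed

text \<open>The monomial \<open>t\<close> is absorbed on both sides: its left part multiplies the
  columns \<open>d\<close>, and its right part, together with the integer \<open>u\<close>,
  multiplies every weight.\<close>

lemma null_single_mult:
  assumes "p \<in> null" shows "Poly_Mapping.single t u * p \<in> null"
proof -
  from assms obtain m d xs where 1: "entries m d xs" "total xs = p" "\<forall>j<m. weight j xs = \<zero>\<^bsub>B'\<^esub>"
    unfolding null_def by blast
  let ?g = "map (\<lambda>(v, s, c). (u * v, t + s, c))"
  have d: "d j \<in> carrier B" for j using 1 by (auto simp: entries_def)
  have "entries m (\<lambda>j. left t \<otimes>\<^bsub>B\<^esub> d j) (?g xs)"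
    using 1(1)
  proof (induction xs)
    case (Cons x xs)
    obtain v s c where x: "x = (v, s, c)" by (cases x)
    have c: "c j \<in> carrier A" for j using Cons.prems by (simp add: x entries_Cons)
    have "left (t + s) = left t \<otimes>\<^bsub>B\<^esub> (\<Oplus>\<^bsub>B\<^esub>j\<in>{..<m}. f (c j) \<otimes>\<^bsub>B\<^esub> d j)"
      using Cons.prems by (simp add: x entries_Cons)
    also have "\<dots> = (\<Oplus>\<^bsub>B\<^esub>j\<in>{..<m}. f (c j) \<otimes>\<^bsub>B\<^esub> (left t \<otimes>\<^bsub>B\<^esub> d j))"
      using c d by (subst F.S.finsum_rdistr) (auto intro!: F.S.finsum_cong' simp: F.S.m_lcomm)
    finally show ?case using Cons c by (auto simp: x entries_Cons)
  qed (use d in auto)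
  moreover have "total (?g xs) = Poly_Mapping.single t u * total xs"
    by (induction xs) (auto simp: algebra_simps mult_single)
  moreover have "weight j (?g xs) = [u] \<cdot>\<^bsub>B'\<^esub> (right t \<otimes>\<^bsub>B'\<^esub> weight j xs)" for j
    using 1(1)
  proof (induction xs)
    case (Cons x xs)
    obtain v s c where x: "x = (v, s, c)" by (cases x)
    have c: "c j \<in> carrier A" for j using Cons.prems by (simp add: x entries_Cons)
    have e: "entries m d xs" using Cons.prems by (simp add: x entries_Cons)
    have "[(u * v)] \<cdot>\<^bsub>B'\<^esub> (f' (c j) \<otimes>\<^bsub>B'\<^esub> right (t + s)) =
        [u] \<cdot>\<^bsub>B'\<^esub> (right t \<otimes>\<^bsub>B'\<^esub> ([v] \<cdot>\<^bsub>B'\<^esub> (f' (c j) \<otimes>\<^bsub>B'\<^esub> right s)))"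
      using c by (simp add: F'.S.add_pow_rdistr_int F'.S.m_lcomm mult.commute[of u v] F'.S.add.int_pow_pow)
    then show ?case using Cons c e
      by (auto simp: x F'.S.r_distr F'.S.add.int_pow_distrib)
  qed simp
  ultimately show ?thesis
    using 1 by (intro nullI) auto
qed

lemma null_zero: "0 \<in> null"
  by (rule nullI[of 0 "\<lambda>_. \<zero>\<^bsub>B\<^esub>" "[]"]) auto

lemma null_uminus: "p \<in> null \<Longrightarrow> - p \<in> null"
  using null_single_mult[of p 0 "-1"] by (simp add: single_uminus)

text \<open>Integer polynomials form the free abelian group on the monomials, so monomial
  multipliers and differences suffice.\<close>

lemma null_mult:
  assumes "p \<in> null" shows "q * p \<in> null"
  using subset_UNIV[of "Poly_Mapping.keys q"]
proof (induction q rule: frag_induction)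
  case (diff a b)
  then show ?case
    using null_add[OF _ null_uminus, of "a * p" "b * p"] by (simp add: left_diff_distrib)
qed (auto simp: null_zero null_single_mult[OF assms])

end

section \<open>The integer polynomial ring and its cardinality\<close>

definition mset_poly_ring :: "('s multiset \<Rightarrow>\<^sub>0 int) ring" where
  "mset_poly_ring = \<lparr>carrier = UNIV, monoid.mult = (*), one = 1, ring.zero = 0, ring.add = (+)\<rparr>"

lemma mset_poly_ring_simps [simp]:
  "carrier mset_poly_ring = UNIV" "p \<otimes>\<^bsub>mset_poly_ring\<^esub> q = p * q" "\<one>\<^bsub>mset_poly_ring\<^esub> = 1"
  "\<zero>\<^bsub>mset_poly_ring\<^esub> = 0" "p \<oplus>\<^bsub>mset_poly_ring\<^esub> q = p + q"
  by (simp_all add: mset_poly_ring_def)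

lemma cring_mset_poly_ring: "cring (mset_poly_ring :: ('s multiset \<Rightarrow>\<^sub>0 int) ring)"
proof (rule cringI)
  show "abelian_group (mset_poly_ring :: ('s multiset \<Rightarrow>\<^sub>0 int) ring)"
  proof (rule abelian_groupI)
    show "\<exists>y\<in>carrier mset_poly_ring. y \<oplus>\<^bsub>mset_poly_ring\<^esub> x = \<zero>\<^bsub>mset_poly_ring\<^esub>"
      for x :: "'s multiset \<Rightarrow>\<^sub>0 int" by (rule bexI[of _ "- x"]) auto
  qed (auto simp: add.assoc add.commute)
  show "Group.comm_monoid (mset_poly_ring :: ('s multiset \<Rightarrow>\<^sub>0 int) ring)"
    by (rule comm_monoidI) (auto simp: mult.assoc mult.commute)
qed (auto simp: distrib_right)

lemma mset_poly_ring_uminus [simp]: "\<ominus>\<^bsub>mset_poly_ring\<^esub> q = - q"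
proof -
  interpret cring mset_poly_ring by (rule cring_mset_poly_ring)
  show ?thesis by (rule sum_zero_eq_neg[symmetric]) auto
qed

lemma mset_poly_ring_minus [simp]: "p \<ominus>\<^bsub>mset_poly_ring\<^esub> q = p - q"
  by (simp add: a_minus_def)

text \<open>Forming pairs, lists and finitely supported integer functions does not raise an infinite
  cardinality. So the polynomials that describe the pushout can be coded in \<open>'u\<close>, which
  places the pushout on the site.\<close>

lemma ex_inj_mset_poly:
  "\<exists>\<phi> :: (('u::infinite \<times> 'u) multiset \<Rightarrow>\<^sub>0 int) \<Rightarrow> 'u. inj \<phi>"
proof -
  have inf: "infinite (UNIV :: 'u set)" by (rule infinite_UNIV)
  have 1: "(UNIV :: ('u \<times> 'u) set) \<lesssim> (UNIV :: 'u set)"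
    using card_of_Times_same_infinite[OF inf] unfolding UNIV_Times_UNIV
    by (simp add: eqpoll_iff_card_of_ordIso[symmetric] eqpoll_imp_lepoll)
  have "infinite (UNIV :: ('u \<times> 'u) set)" using inf by (simp add: finite_prod)
  from card_of_lists_infinite[OF this] have 2: "(UNIV :: ('u \<times> 'u) list set) \<lesssim> (UNIV :: ('u \<times> 'u) set)"
    by (simp add: eqpoll_iff_card_of_ordIso[symmetric] eqpoll_imp_lepoll)
  \<comment> \<open>Choosing an ordering for each multiset injects multisets into lists.\<close>
  have "inj (inv_into UNIV mset :: ('u \<times> 'u) multiset \<Rightarrow> _)"
    by (rule inj_on_inv_into) (metis ex_mset subsetI rangeI)
  then have 3: "(UNIV :: ('u \<times> 'u) multiset set) \<lesssim> (UNIV :: ('u \<times> 'u) list set)"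
    unfolding lepoll_def by blast
  have "infinite (UNIV :: ('u \<times> 'u) multiset set)"
  proof
    assume "finite (UNIV :: ('u \<times> 'u) multiset set)"
    moreover have "inj (\<lambda>x :: 'u. {#(x, x)#})" by (auto simp: inj_def)
    ultimately show False using inf finite_imageD finite_subset[OF subset_UNIV] by blast
  qed
  from eqpoll_free_Abelian_group_infinite[OF this]
  have 4: "(UNIV :: (('u \<times> 'u) multiset \<Rightarrow>\<^sub>0 int) set) \<lesssim> (UNIV :: ('u \<times> 'u) multiset set)"
    by (simp add: free_Abelian_group_def eqpoll_imp_lepoll)
  show ?thesis
    using lepoll_trans[OF 4 lepoll_trans[OF 3 lepoll_trans[OF 2 1]]] by (auto simp: lepoll_def)
qed

section \<open>The ideal of null polynomials and the two coordinate maps\<close>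

context algebra_pair
begin

text \<open>Both left parts are multiples of the same \<open>d\<close>, so a single weight decides.
  Apart from additivity, all the relations imposed on the variables are binomials of this
  kind.\<close>

lemma null_one_column:
  assumes s: "c \<in> carrier A" "left s = f c \<otimes>\<^bsub>B\<^esub> d" and t: "c' \<in> carrier A" "left t = f c' \<otimes>\<^bsub>B\<^esub> d"
    and d: "d \<in> carrier B" and eq: "f' c \<otimes>\<^bsub>B'\<^esub> right s = f' c' \<otimes>\<^bsub>B'\<^esub> right t"
  shows "Poly_Mapping.single s 1 - Poly_Mapping.single t 1 \<in> null"
  using assms
  by (intro nullI[of 1 "\<lambda>_. d" "[(1, s, \<lambda>_. c), (-1, t, \<lambda>_. c')]"])
    (auto simp: entries_Cons lessThan_Suc single_uminus F'.S.r_neg F'.S.add.int_pow_neg)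

text \<open>The variable that stands for b tensor 1; \<open>rvar b'\<close> below stands for 1
  tensor b'.\<close>

definition lvar :: "'b \<Rightarrow> ('b \<times> 'c) multiset \<Rightarrow>\<^sub>0 int" where
  "lvar b = Poly_Mapping.single {#(b, \<one>\<^bsub>B'\<^esub>)#} 1"

definition rvar :: "'c \<Rightarrow> ('b \<times> 'c) multiset \<Rightarrow>\<^sub>0 int" where
  "rvar b' = Poly_Mapping.single {#(\<one>\<^bsub>B\<^esub>, b')#} 1"

lemma null_lvar_mult:
  "x \<in> carrier B \<Longrightarrow> y \<in> carrier B \<Longrightarrow> lvar (x \<otimes>\<^bsub>B\<^esub> y) - lvar x * lvar y \<in> null"
  unfolding lvar_def mult_single
  using null_one_column[of "\<one>\<^bsub>A\<^esub>" "{#(x \<otimes>\<^bsub>B\<^esub> y, \<one>\<^bsub>B'\<^esub>)#}" "x \<otimes>\<^bsub>B\<^esub> y" "\<one>\<^bsub>A\<^esub>"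
      "{#(x, \<one>\<^bsub>B'\<^esub>)#} + {#(y, \<one>\<^bsub>B'\<^esub>)#}"] by (simp del: union_mset_add_mset_left union_mset_add_mset_right)

lemma null_rvar_mult:
  "x \<in> carrier B' \<Longrightarrow> y \<in> carrier B' \<Longrightarrow> rvar (x \<otimes>\<^bsub>B'\<^esub> y) - rvar x * rvar y \<in> null"
  unfolding rvar_def mult_single
  using null_one_column[of "\<one>\<^bsub>A\<^esub>" "{#(\<one>\<^bsub>B\<^esub>, x \<otimes>\<^bsub>B'\<^esub> y)#}" "\<one>\<^bsub>B\<^esub>" "\<one>\<^bsub>A\<^esub>"
      "{#(\<one>\<^bsub>B\<^esub>, x)#} + {#(\<one>\<^bsub>B\<^esub>, y)#}"] by (simp del: union_mset_add_mset_left union_mset_add_mset_right)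

lemma null_var_one: "lvar \<one>\<^bsub>B\<^esub> - 1 \<in> null" "rvar \<one>\<^bsub>B'\<^esub> - 1 \<in> null"
  unfolding lvar_def rvar_def
  using null_one_column[of "\<one>\<^bsub>A\<^esub>" "{#(\<one>\<^bsub>B\<^esub>, \<one>\<^bsub>B'\<^esub>)#}" "\<one>\<^bsub>B\<^esub>" "\<one>\<^bsub>A\<^esub>" "{#}"]
  by (simp_all flip: zero_multiset_def)

lemma null_compatible: "a \<in> carrier A \<Longrightarrow> lvar (f a) - rvar (f' a) \<in> null"
  unfolding lvar_def rvar_def by (rule null_one_column[of a _ "\<one>\<^bsub>B\<^esub>" "\<one>\<^bsub>A\<^esub>"]) auto

lemma null_rvar_add:
  assumes "x \<in> carrier B'" "y \<in> carrier B'"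
  shows "rvar (x \<oplus>\<^bsub>B'\<^esub> y) - (rvar x + rvar y) \<in> null"
proof (rule nullI)
  show "entries 1 (\<lambda>_. \<one>\<^bsub>B\<^esub>) [(1, {#(\<one>\<^bsub>B\<^esub>, x \<oplus>\<^bsub>B'\<^esub> y)#}, \<lambda>_. \<one>\<^bsub>A\<^esub>), (-1, {#(\<one>\<^bsub>B\<^esub>, x)#}, \<lambda>_. \<one>\<^bsub>A\<^esub>),
      (-1, {#(\<one>\<^bsub>B\<^esub>, y)#}, \<lambda>_. \<one>\<^bsub>A\<^esub>)]"
    by (auto simp: entries_Cons lessThan_Suc)
qed (use assms in \<open>auto simp: rvar_def single_uminus F'.S.add.int_pow_neg F'.S.minus_add F'.S.r_neg1
    F'.S.r_neg F'.S.l_neg F'.S.a_assoc F'.S.a_lcomm\<close>)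

text \<open>Expansions concern the left part, so additivity on the left takes the two columns x and
  y: the sum has coefficients (1, 1), the summands (1, 0) and (0, 1), and each of the two weights is
  1 - 1.\<close>

lemma null_lvar_add:
  assumes "x \<in> carrier B" "y \<in> carrier B"
  shows "lvar (x \<oplus>\<^bsub>B\<^esub> y) - (lvar x + lvar y) \<in> null"
proof (rule nullI)
  let ?c = "\<lambda>u v j. if j = (0::nat) then u else v"
  show "entries 2 (?c x y) [(1, {#(x \<oplus>\<^bsub>B\<^esub> y, \<one>\<^bsub>B'\<^esub>)#}, \<lambda>_. \<one>\<^bsub>A\<^esub>),
      (-1, {#(x, \<one>\<^bsub>B'\<^esub>)#}, ?c \<one>\<^bsub>A\<^esub> \<zero>\<^bsub>A\<^esub>), (-1, {#(y, \<one>\<^bsub>B'\<^esub>)#}, ?c \<zero>\<^bsub>A\<^esub> \<one>\<^bsub>A\<^esub>)]"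
    using assms by (auto simp: entries_Cons numeral_2_eq_2 lessThan_Suc F.S.a_comm)
qed (use assms in \<open>auto simp: lvar_def single_uminus F'.S.add.int_pow_neg F'.S.r_neg\<close>)

lemma ideal_null: "ideal null mset_poly_ring"
proof (rule idealI)
  show "ring (mset_poly_ring :: (('b \<times> 'c) multiset \<Rightarrow>\<^sub>0 int) ring)"
    using cring_mset_poly_ring by (rule cring.axioms)
  have "inv\<^bsub>add_monoid mset_poly_ring\<^esub> p = - p" for p :: "('b \<times> 'c) multiset \<Rightarrow>\<^sub>0 int"
    using mset_poly_ring_uminus[of p] by (simp add: a_inv_def)
  then show "subgroup null (add_monoid mset_poly_ring)"
    by unfold_locales (auto simp: null_add null_zero null_uminus)
next
  fix a x :: "('b \<times> 'c) multiset \<Rightarrow>\<^sub>0 int" assume "a \<in> null"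
  from null_mult[OF this, of x]
  show "x \<otimes>\<^bsub>mset_poly_ring\<^esub> a \<in> null" "a \<otimes>\<^bsub>mset_poly_ring\<^esub> x \<in> null"
    by (simp_all add: mult.commute)
qed

definition pushout :: "(('b \<times> 'c) multiset \<Rightarrow>\<^sub>0 int) \<Rightarrow> (('b \<times> 'c) multiset \<Rightarrow>\<^sub>0 int) set" where
  "pushout p = null +>\<^bsub>mset_poly_ring\<^esub> p"

lemma pushout_eq_iff: "pushout p = pushout q \<longleftrightarrow> p - q \<in> null"
proof -
  interpret cring "mset_poly_ring :: (('b \<times> 'c) multiset \<Rightarrow>\<^sub>0 int) ring" by (rule cring_mset_poly_ring)
  show ?thesis
    using quotient_eq_iff_same_a_r_cos[OF ideal_null, of p q] by (simp add: pushout_def)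
qed

lemma pushout_ring_hom: "pushout \<in> ring_hom mset_poly_ring (mset_poly_ring Quot null)"
  using ideal.rcos_ring_hom[OF ideal_null] by (simp add: pushout_def[abs_def])

lemma pushout_lvar: "(\<lambda>b. pushout (lvar b)) \<in> ring_hom B (mset_poly_ring Quot null)"
proof (rule ring_hom_memI)
  note h = ring_hom_mult[OF pushout_ring_hom] ring_hom_add[OF pushout_ring_hom] ring_hom_one[OF pushout_ring_hom]
  fix x y assume xy: "x \<in> carrier B" "y \<in> carrier B"
  show "pushout (lvar (x \<otimes>\<^bsub>B\<^esub> y)) = pushout (lvar x) \<otimes>\<^bsub>mset_poly_ring Quot null\<^esub> pushout (lvar y)"
    using null_lvar_mult[OF xy] h(1)[of "lvar x" "lvar y"] by (simp flip: pushout_eq_iff)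
  show "pushout (lvar (x \<oplus>\<^bsub>B\<^esub> y)) = pushout (lvar x) \<oplus>\<^bsub>mset_poly_ring Quot null\<^esub> pushout (lvar y)"
    using null_lvar_add[OF xy] h(2)[of "lvar x" "lvar y"] by (simp flip: pushout_eq_iff)
next
  show "pushout (lvar \<one>\<^bsub>B\<^esub>) = \<one>\<^bsub>mset_poly_ring Quot null\<^esub>"
    using null_var_one(1) ring_hom_one[OF pushout_ring_hom] by (simp flip: pushout_eq_iff)
qed (use ring_hom_closed[OF pushout_ring_hom] in auto)

lemma pushout_rvar: "(\<lambda>b. pushout (rvar b)) \<in> ring_hom B' (mset_poly_ring Quot null)"
proof (rule ring_hom_memI)
  note h = ring_hom_mult[OF pushout_ring_hom] ring_hom_add[OF pushout_ring_hom] ring_hom_one[OF pushout_ring_hom]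
  fix x y assume xy: "x \<in> carrier B'" "y \<in> carrier B'"
  show "pushout (rvar (x \<otimes>\<^bsub>B'\<^esub> y)) = pushout (rvar x) \<otimes>\<^bsub>mset_poly_ring Quot null\<^esub> pushout (rvar y)"
    using null_rvar_mult[OF xy] h(1)[of "rvar x" "rvar y"] by (simp flip: pushout_eq_iff)
  show "pushout (rvar (x \<oplus>\<^bsub>B'\<^esub> y)) = pushout (rvar x) \<oplus>\<^bsub>mset_poly_ring Quot null\<^esub> pushout (rvar y)"
    using null_rvar_add[OF xy] h(2)[of "rvar x" "rvar y"] by (simp flip: pushout_eq_iff)
next
  show "pushout (rvar \<one>\<^bsub>B'\<^esub>) = \<one>\<^bsub>mset_poly_ring Quot null\<^esub>"
    using null_var_one(2) ring_hom_one[OF pushout_ring_hom] by (simp flip: pushout_eq_iff)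
qed (use ring_hom_closed[OF pushout_ring_hom] in auto)

end

lemma cring_image_ring: "cring R \<Longrightarrow> inj_on \<psi> (carrier R) \<Longrightarrow> cring (image_ring \<psi> R)"
  using cring.ring_iso_imp_img_cring[OF _ inj_imp_image_ring_iso[of \<psi> R]]
  by (simp add: image_ring_def image_group_def monoid.defs)

lemma image_ring_hom: "inj_on \<psi> (carrier R) \<Longrightarrow> \<psi> \<in> ring_hom R (image_ring \<psi> R)"
  using inj_imp_image_ring_iso[of \<psi> R] by (simp add: ring_iso_def)

text \<open>Cosets of \<open>null\<close> are sets of polynomials; each is named by the image under
  \<open>\<phi>\<close> of a chosen representative, and the ring structure is carried over along
  this injection. The last clause is the purpose: equality of the two images is traced back to
  membership in \<open>null\<close>, which is a statement on finite data over A.\<close>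

lemma (in algebra_pair) ex_pushout:
  fixes \<phi> :: "(('b \<times> 'c) multiset \<Rightarrow>\<^sub>0 int) \<Rightarrow> 'v"
  assumes "inj \<phi>"
  shows "\<exists>(C :: 'v ring) g g'. cring C \<and> g \<in> ring_hom B C \<and> g' \<in> ring_hom B' C \<and>
    (\<forall>a\<in>carrier A. g (f a) = g' (f' a)) \<and> (\<forall>b b'. g b = g' b' \<longrightarrow> lvar b - rvar b' \<in> null)"
proof -
  let ?Q = "mset_poly_ring Quot null" and ?\<psi> = "\<lambda>X. \<phi> (SOME p. X = pushout p)"
  have some: "X = pushout (SOME p. X = pushout p)" if "X \<in> carrier ?Q" for X
    using that unfolding FactRing_def A_RCOSETS_def' pushout_def
    by (intro someI_ex[of "\<lambda>p. X = null +>\<^bsub>mset_poly_ring\<^esub> p"]) auto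
  have inj: "inj_on ?\<psi> (carrier ?Q)"
    by (rule inj_onI) (metis some injD[OF assms])
  have Q: "cring ?Q" by (rule ideal.quotient_is_cring[OF ideal_null cring_mset_poly_ring])
  have car: "pushout p \<in> carrier ?Q" for p using ring_hom_closed[OF pushout_ring_hom, of p] by simp
  show ?thesis
  proof (intro exI conjI)
    show "cring (image_ring ?\<psi> ?Q)" by (rule cring_image_ring[OF Q inj])
    show "?\<psi> \<circ> (\<lambda>b. pushout (lvar b)) \<in> ring_hom B (image_ring ?\<psi> ?Q)" 
      using ring_hom_trans[OF pushout_lvar image_ring_hom[OF inj]] .
    show "?\<psi> \<circ> (\<lambda>b. pushout (rvar b)) \<in> ring_hom B' (image_ring ?\<psi> ?Q)"
      using ring_hom_trans[OF pushout_rvar image_ring_hom[OF inj]] .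
    show "\<forall>a\<in>carrier A. (?\<psi> \<circ> (\<lambda>b. pushout (lvar b))) (f a) = (?\<psi> \<circ> (\<lambda>b. pushout (rvar b))) (f' a)"
    proof
      fix a assume "a \<in> carrier A"
      then have "pushout (lvar (f a)) = pushout (rvar (f' a))"
        by (simp add: pushout_eq_iff null_compatible)
      then show "(?\<psi> \<circ> (\<lambda>b. pushout (lvar b))) (f a) = (?\<psi> \<circ> (\<lambda>b. pushout (rvar b))) (f' a)"
        by (simp only: o_apply)
    qed
    show "\<forall>b b'. (?\<psi> \<circ> (\<lambda>b. pushout (lvar b))) b = (?\<psi> \<circ> (\<lambda>b. pushout (rvar b))) b' \<longrightarrow>
        lvar b - rvar b' \<in> null"
      unfolding o_apply pushout_eq_iff[symmetric] using inj_onD[OF inj _ car car] by blast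
  qed
qed

lemma single_eq_frag_cmul: "Poly_Mapping.single s v = frag_cmul v (frag_of s)"
  by (rule poly_mapping_eqI) (simp add: lookup_single when_def)

section \<open>Flatness applied to null polynomials\<close>

locale flat_algebra_pair = algebra_pair A B B' f f' + flat_ring_hom A B f
  for A :: "'a ring" and B :: "'b ring" and B' :: "'c ring" and f f'
begin

lemma entries_subset:
  assumes "entries m d xs" "set ys \<subseteq> set xs" shows "entries m d ys"
proof -
  have d: "\<forall>j. d j \<in> carrier B"
    using assms(1) unfolding entries_def by (rule conjunct1)
  have all: "\<forall>(v, s, c)\<in>set xs. (\<forall>j. c j \<in> carrier A) \<and> left s = (\<Oplus>\<^bsub>B\<^esub>j\<in>{..<m}. f (c j) \<otimes>\<^bsub>B\<^esub> d j)"
    using assms(1) unfolding entries_def by (rule conjunct2)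
  show ?thesis
    unfolding entries_def by (intro conjI d ballI bspec[OF all] subsetD[OF assms(2)])
qed

text \<open>Expansions are wanted for the two monomials of the difference over the same columns.
  Entries with coefficient 0 and the extra columns b and 1 provide them: the total stays the same,
  and the added weights vanish.\<close>

lemma null_diffE:
  assumes b: "b \<in> carrier B" and "lvar b - rvar b' \<in> null"
  obtains m d xs c c' where "entries m d xs" "total xs = lvar b - rvar b'"
    "\<And>j. j < m \<Longrightarrow> weight j xs = \<zero>\<^bsub>B'\<^esub>"
    "(0, {#(b, \<one>\<^bsub>B'\<^esub>)#}, c) \<in> set xs" "(0, {#(\<one>\<^bsub>B\<^esub>, b')#}, c') \<in> set xs"
proof -
  let ?c = "\<lambda>u v j. if j = (0::nat) then u else v"
  let ?ys = "[(0, {#(b, \<one>\<^bsub>B'\<^esub>)#}, ?c \<one>\<^bsub>A\<^esub> \<zero>\<^bsub>A\<^esub>), (0, {#(\<one>\<^bsub>B\<^esub>, b')#}, ?c \<zero>\<^bsub>A\<^esub> \<one>\<^bsub>A\<^esub>)]"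
  obtain m d xs where x: "entries m d xs" "total xs = lvar b - rvar b'" "\<forall>j<m. weight j xs = \<zero>\<^bsub>B'\<^esub>"
    using assms unfolding null_def by blast
  have y: "entries 2 (?c b \<one>\<^bsub>B\<^esub>) ?ys"
    using b by (auto simp: entries_Cons numeral_2_eq_2 lessThan_Suc F.S.a_comm)
  have tot: "total (shift_low m xs @ shift_high m ?ys) = lvar b - rvar b'"
    using x(2) by (simp add: shift_low_def shift_high_def total_map)
  have wt: "weight j (shift_low m xs @ shift_high m ?ys) = \<zero>\<^bsub>B'\<^esub>" if "j < m + 2" for j
    using x(3) unfolding weight_shift[OF x(1) y] by (auto simp: add_pow_def)
  have mem: "(0, {#(b, \<one>\<^bsub>B'\<^esub>)#}, \<lambda>j. if j < m then \<zero>\<^bsub>A\<^esub> else ?c \<one>\<^bsub>A\<^esub> \<zero>\<^bsub>A\<^esub> (j - m)) \<in> set (shift_low m xs @ shift_high m ?ys)"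
    "(0, {#(\<one>\<^bsub>B\<^esub>, b')#}, \<lambda>j. if j < m then \<zero>\<^bsub>A\<^esub> else ?c \<zero>\<^bsub>A\<^esub> \<one>\<^bsub>A\<^esub> (j - m)) \<in> set (shift_low m xs @ shift_high m ?ys)"
    by (simp_all add: shift_high_def)
  show ?thesis
    by (rule that[OF entries_shift[OF x(1) y] tot wt mem])
qed

text \<open>\<open>E\<close> kills the difference of any two expansions of one monomial, so what
  remains of an expansion after multiplication by \<open>E\<close> depends on the monomial
  alone.\<close>

lemma combination_unique:
  assumes zs: "entries m d zs" and E: "factorization m d M E e"
    and rel: "relations {(x, y). x \<in> set zs \<and> y \<in> set zs \<and> fst (snd x) = fst (snd y)}
      (\<lambda>(x, y) l. snd (snd x) l \<ominus>\<^bsub>A\<^esub> snd (snd y) l) m M E"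
    and mem: "(v, s, c) \<in> set zs" "(v', s, c') \<in> set zs" and j: "j < M"
  shows "(\<Oplus>\<^bsub>A\<^esub>l\<in>{..<m}. c l \<otimes>\<^bsub>A\<^esub> E l j) = (\<Oplus>\<^bsub>A\<^esub>l\<in>{..<m}. c' l \<otimes>\<^bsub>A\<^esub> E l j)"
proof -
  have c: "c l \<in> carrier A" "c' l \<in> carrier A" for l
    using zs mem by (auto simp: entries_def)
  note E = factorizationD[OF E]
  have "(\<Oplus>\<^bsub>A\<^esub>l\<in>{..<m}. c l \<otimes>\<^bsub>A\<^esub> E l j) =
      (\<Oplus>\<^bsub>A\<^esub>l\<in>{..<m}. (c l \<ominus>\<^bsub>A\<^esub> c' l) \<otimes>\<^bsub>A\<^esub> E l j \<oplus>\<^bsub>A\<^esub> c' l \<otimes>\<^bsub>A\<^esub> E l j)"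
  proof (rule F.R.finsum_cong')
    fix l assume l: "l \<in> {..<m}"
    have "(c l \<ominus>\<^bsub>A\<^esub> c' l) \<otimes>\<^bsub>A\<^esub> E l j \<oplus>\<^bsub>A\<^esub> c' l \<otimes>\<^bsub>A\<^esub> E l j = ((c l \<ominus>\<^bsub>A\<^esub> c' l) \<oplus>\<^bsub>A\<^esub> c' l) \<otimes>\<^bsub>A\<^esub> E l j"
      using c E l j by (intro F.R.l_distr[symmetric]) auto
    also have "(c l \<ominus>\<^bsub>A\<^esub> c' l) \<oplus>\<^bsub>A\<^esub> c' l = c l"
      using c[of l] by (simp add: F.R.minus_eq F.R.a_assoc F.R.l_neg)
    finally show "c l \<otimes>\<^bsub>A\<^esub> E l j = (c l \<ominus>\<^bsub>A\<^esub> c' l) \<otimes>\<^bsub>A\<^esub> E l j \<oplus>\<^bsub>A\<^esub> c' l \<otimes>\<^bsub>A\<^esub> E l j" by simp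
  qed (use c E j in auto)
  also have "\<dots> = (\<Oplus>\<^bsub>A\<^esub>l\<in>{..<m}. (c l \<ominus>\<^bsub>A\<^esub> c' l) \<otimes>\<^bsub>A\<^esub> E l j) \<oplus>\<^bsub>A\<^esub> (\<Oplus>\<^bsub>A\<^esub>l\<in>{..<m}. c' l \<otimes>\<^bsub>A\<^esub> E l j)"
    using c E j by (intro F.R.finsum_addf) auto
  also have "(\<Oplus>\<^bsub>A\<^esub>l\<in>{..<m}. (c l \<ominus>\<^bsub>A\<^esub> c' l) \<otimes>\<^bsub>A\<^esub> E l j) = \<zero>\<^bsub>A\<^esub>"
    using bspec[OF rel[unfolded relations_def], of "((v, s, c), (v', s, c'))"] mem j by simp
  finally show ?thesis
    using c E j by (simp add: F.R.finsum_closed)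
qed

text \<open>A monomial may carry several expansions over the columns \<open>d\<close>. Flatness
  refines \<open>d\<close> to \<open>e\<close> so that they agree, and then each new column j
  defines an additive map on polynomials, sending a monomial s to \<open>f' (\<gamma> j s)\<close>
  times \<open>right s\<close>. This map sends the total of the list to a combination of the
  weights, hence to 0. Its value at \<open>lvar b - rvar b'\<close> is the required equation for
  column j.\<close>

lemma null_detect:
  assumes b: "b \<in> carrier B" and b': "b' \<in> carrier B'" and "lvar b - rvar b' \<in> null"
  shows "\<exists>m c d. factorization 2 (\<lambda>i. if i = 0 then \<one>\<^bsub>B\<^esub> else b) m c d \<and>
    (\<forall>j<m. f' (c 0 j) \<otimes>\<^bsub>B'\<^esub> b' = f' (c 1 j))"
proof -
  obtain m d zs c1 c2 where zs: "entries m d zs" and tot: "total zs = lvar b - rvar b'"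
    and wt: "\<And>j. j < m \<Longrightarrow> weight j zs = \<zero>\<^bsub>B'\<^esub>"
    and mem: "(0, {#(b, \<one>\<^bsub>B'\<^esub>)#}, c1) \<in> set zs" "(0, {#(\<one>\<^bsub>B\<^esub>, b')#}, c2) \<in> set zs"
    using null_diffE[OF b assms(3)] by metis
  \<comment> \<open>Pairs of entries with the same monomial. The row attached to such a pair is the
    difference of the two expansions, which is a relation among the columns because both expand the
    same \<open>left s\<close>.\<close>
  define K where "K = {(x, y). x \<in> set zs \<and> y \<in> set zs \<and> fst (snd x) = fst (snd y)}"
  define a :: "('a, 'b, 'c) entry \<times> ('a, 'b, 'c) entry \<Rightarrow> nat \<Rightarrow> 'a" where
    "a = (\<lambda>(x, y) l. snd (snd x) l \<ominus>\<^bsub>A\<^esub> snd (snd y) l)"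
  have car: "c l \<in> carrier A" if "(v, s, c) \<in> set zs" for v s c l
    using zs that by (auto simp: entries_def)
  have d: "d l \<in> carrier B" for l using zs by (auto simp: entries_def)
  have lin: "left s = (\<Oplus>\<^bsub>B\<^esub>j\<in>{..<m}. f (c j) \<otimes>\<^bsub>B\<^esub> d j)" if "(v, s, c) \<in> set zs" for v s c
    using zs that by (auto simp: entries_def)
  have "\<exists>M E e. factorization m d M E e \<and> relations K a m M E"
  proof (rule flat_relations)
    show "finite K" by (rule finite_subset[of _ "set zs \<times> set zs"]) (auto simp: K_def)
    show "a k i \<in> carrier A" if "k \<in> K" for k i
      using that car by (cases k) (auto simp: a_def K_def)
    fix k assume "k \<in> K"
    then obtain v s c v' c' where k: "k = ((v, s, c), (v', s, c'))" and
      m: "(v, s, c) \<in> set zs" "(v', s, c') \<in> set zs" by (cases k) (auto simp: K_def)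
    have "(\<Oplus>\<^bsub>B\<^esub>l\<in>{..<m}. f (a k l) \<otimes>\<^bsub>B\<^esub> d l) =
        (\<Oplus>\<^bsub>B\<^esub>l\<in>{..<m}. f (c l) \<otimes>\<^bsub>B\<^esub> d l \<oplus>\<^bsub>B\<^esub> \<ominus>\<^bsub>B\<^esub> \<one>\<^bsub>B\<^esub> \<otimes>\<^bsub>B\<^esub> (f (c' l) \<otimes>\<^bsub>B\<^esub> d l))"
      using car[OF m(1)] car[OF m(2)] d
      by (intro F.S.finsum_cong')
        (auto simp: k a_def F.R.minus_eq F.S.l_distr F.S.l_minus)
    also have "\<dots> = left s \<oplus>\<^bsub>B\<^esub> \<ominus>\<^bsub>B\<^esub> \<one>\<^bsub>B\<^esub> \<otimes>\<^bsub>B\<^esub> left s"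
      using car[OF m(1)] car[OF m(2)] d lin[OF m(1)] lin[OF m(2)]
      by (subst F.S.finsum_addf) (auto simp: F.S.finsum_rdistr[symmetric])
    also have "\<dots> = \<zero>\<^bsub>B\<^esub>" by (simp add: F.S.l_minus F.S.r_neg)
    finally show "(\<Oplus>\<^bsub>B\<^esub>l\<in>{..<m}. f (a k l) \<otimes>\<^bsub>B\<^esub> d l) = \<zero>\<^bsub>B\<^esub>" .
  qed (use d in auto)
  then obtain M E e where E: "factorization m d M E e" and rel: "relations K a m M E" by blast
  note Ec = factorizationD[OF E]
  note uniq = combination_unique[OF zs E rel[unfolded K_def a_def]]
  \<comment> \<open>The common value of all expansions of s, after the refinement, at column j. The
    default 0 at monomials that do not occur keeps it in A, so that the additive map can be defined
    on all monomials.\<close>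
  define \<gamma> where "\<gamma> j s = (if \<exists>v c. (v, s, c) \<in> set zs then
      \<Oplus>\<^bsub>A\<^esub>l\<in>{..<m}. (SOME c. \<exists>v. (v, s, c) \<in> set zs) l \<otimes>\<^bsub>A\<^esub> E l j else \<zero>\<^bsub>A\<^esub>)" for j s
  have \<gamma>: "\<gamma> j s = (\<Oplus>\<^bsub>A\<^esub>l\<in>{..<m}. c l \<otimes>\<^bsub>A\<^esub> E l j)" if "(v, s, c) \<in> set zs" "j < M" for j v s c
  proof -
    have "\<exists>v'. (v', s, SOME c. \<exists>v. (v, s, c) \<in> set zs) \<in> set zs"
      by (rule someI[of "\<lambda>c. \<exists>v. (v, s, c) \<in> set zs"]) (use that in blast)
    then obtain v' where v': "(v', s, SOME c. \<exists>v. (v, s, c) \<in> set zs) \<in> set zs" by (elim exE)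
    have ex: "\<exists>v c. (v, s, c) \<in> set zs" using that(1) by blast
    show ?thesis unfolding \<gamma>_def if_P[OF ex] by (rule uniq[OF v' that])
  qed
  have \<gamma>c: "\<gamma> j s \<in> carrier A" if "j < M" for j s
  proof (cases "\<exists>v c. (v, s, c) \<in> set zs")
    case True
    then obtain v c where "(v, s, c) \<in> set zs" by blast
    then show ?thesis
      unfolding \<gamma>[OF \<open>(v, s, c) \<in> set zs\<close> that] using car[OF \<open>(v, s, c) \<in> set zs\<close>] Ec(1) that
      by (intro F.R.finsum_closed) auto
  qed (simp add: \<gamma>_def)
  have key: "f' (\<gamma> j {#(\<one>\<^bsub>B\<^esub>, b')#}) \<otimes>\<^bsub>B'\<^esub> b' = f' (\<gamma> j {#(b, \<one>\<^bsub>B'\<^esub>)#})" if j: "j < M" for j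
  proof -
    let ?F = "free_Abelian_group UNIV :: (('b \<times> 'c) multiset \<Rightarrow>\<^sub>0 int) monoid"
    have "(\<lambda>s. f' (\<gamma> j s) \<otimes>\<^bsub>B'\<^esub> right s) ` UNIV \<subseteq> carrier (add_monoid B')"
      using \<gamma>c[OF j] by auto
    then obtain h where h: "h \<in> hom ?F (add_monoid B')"
      and hs: "\<And>s. h (frag_of s) = f' (\<gamma> j s) \<otimes>\<^bsub>B'\<^esub> right s"
      by (rule comm_group.free_Abelian_group_universal[OF F'.S.a_comm_group]) (use that in blast)
    have ha: "h (p + q) = h p \<oplus>\<^bsub>B'\<^esub> h q" for p q
      using hom_mult[OF h, of p q] by simp
    have hsv: "h (Poly_Mapping.single s v) = [v] \<cdot>\<^bsub>B'\<^esub> (f' (\<gamma> j s) \<otimes>\<^bsub>B'\<^esub> right s)" for s v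
      using hom_int_pow[OF h, of "frag_of s" v] F'.S.a_group hs[of s]
      by (subst single_eq_frag_cmul) (simp add: add_pow_def)
    have h0: "h 0 = \<zero>\<^bsub>B'\<^esub>" using hom_one[OF h] F'.S.a_group by simp
    \<comment> \<open>Summing over entries agrees with summing over columns. It is stated for
      sublists so that the induction can shorten the list while \<open>\<gamma>\<close> stays tied
      to \<open>zs\<close>.\<close>
    have lin_h: "h (total ys) = (\<Oplus>\<^bsub>B'\<^esub>l\<in>{..<m}. f' (E l j) \<otimes>\<^bsub>B'\<^esub> weight l ys)"
      if "set ys \<subseteq> set zs" for ys
      using that
    proof (induction ys)
      case (Cons x ys)
      obtain v s c where x: "x = (v, s, c)" by (cases x)
      have m: "(v, s, c) \<in> set zs" using Cons.prems by (auto simp: x)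
      have ey: "entries m d ys"
        by (rule entries_subset[OF zs]) (use Cons.prems in auto)
      define u where "u = [v] \<cdot>\<^bsub>B'\<^esub> \<one>\<^bsub>B'\<^esub>"
      have u: "u \<in> carrier B'" "[v] \<cdot>\<^bsub>B'\<^esub> y = u \<otimes>\<^bsub>B'\<^esub> y" if "y \<in> carrier B'" for y
        using F'.S.add_pow_ldistr_int[of "\<one>\<^bsub>B'\<^esub>" y v] that by (auto simp: u_def)
      note u1 = u(1)[OF F'.S.one_closed]
      have "(\<Oplus>\<^bsub>B'\<^esub>l\<in>{..<m}. f' (E l j) \<otimes>\<^bsub>B'\<^esub> weight l (x # ys)) =
        (\<Oplus>\<^bsub>B'\<^esub>l\<in>{..<m}. f' (c l \<otimes>\<^bsub>A\<^esub> E l j) \<otimes>\<^bsub>B'\<^esub> (u \<otimes>\<^bsub>B'\<^esub> right s) \<oplus>\<^bsub>B'\<^esub> f' (E l j) \<otimes>\<^bsub>B'\<^esub> weight l ys)"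
        using car[OF m] Ec j ey u1
        by (intro F'.S.finsum_cong') (auto simp: x u F'.S.r_distr F'.S.m_ac)
      also have "\<dots> = (\<Oplus>\<^bsub>B'\<^esub>l\<in>{..<m}. f' (c l \<otimes>\<^bsub>A\<^esub> E l j) \<otimes>\<^bsub>B'\<^esub> (u \<otimes>\<^bsub>B'\<^esub> right s)) \<oplus>\<^bsub>B'\<^esub>
          (\<Oplus>\<^bsub>B'\<^esub>l\<in>{..<m}. f' (E l j) \<otimes>\<^bsub>B'\<^esub> weight l ys)"
        using car[OF m] Ec j ey u1 by (intro F'.S.finsum_addf) auto
      also have "(\<Oplus>\<^bsub>B'\<^esub>l\<in>{..<m}. f' (c l \<otimes>\<^bsub>A\<^esub> E l j) \<otimes>\<^bsub>B'\<^esub> (u \<otimes>\<^bsub>B'\<^esub> right s)) =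
          (\<Oplus>\<^bsub>B'\<^esub>l\<in>{..<m}. f' (c l \<otimes>\<^bsub>A\<^esub> E l j)) \<otimes>\<^bsub>B'\<^esub> (u \<otimes>\<^bsub>B'\<^esub> right s)"
        using car[OF m] Ec j u1 by (intro F'.S.finsum_ldistr[symmetric]) auto
      also have "(\<Oplus>\<^bsub>B'\<^esub>l\<in>{..<m}. f' (c l \<otimes>\<^bsub>A\<^esub> E l j)) = f' (\<gamma> j s)"
        using car[OF m] Ec j unfolding \<gamma>[OF m j] by (subst F'.hom_finsum) (auto simp: o_def)
      also have "f' (\<gamma> j s) \<otimes>\<^bsub>B'\<^esub> (u \<otimes>\<^bsub>B'\<^esub> right s) = h (Poly_Mapping.single s v)"
        using u \<gamma>c[OF j] u1 by (simp add: hsv F'.S.m_lcomm)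
      finally show ?case using Cons by (simp add: x ha)
    qed (use h0 Ec j in \<open>auto intro!: F'.S.add.finprod_one_eqI[symmetric]\<close>)
    have "h (lvar b - rvar b') = \<zero>\<^bsub>B'\<^esub>"
      using lin_h[OF subset_refl] wt Ec j unfolding tot
      by (auto intro!: F'.S.add.finprod_one_eqI)
    moreover have "h (lvar b) = h (lvar b - rvar b') \<oplus>\<^bsub>B'\<^esub> h (rvar b')"
      by (simp flip: ha)
    moreover have "h (rvar b') = f' (\<gamma> j {#(\<one>\<^bsub>B\<^esub>, b')#}) \<otimes>\<^bsub>B'\<^esub> b'"
      "h (lvar b) = f' (\<gamma> j {#(b, \<one>\<^bsub>B'\<^esub>)#})"
      using \<gamma>c[OF j] b b' by (simp_all add: lvar_def rvar_def hsv)
    ultimately show ?thesis using \<gamma>c[OF j] b' by simp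
  qed
  \<comment> \<open>Row 0 expands the left part 1 of the monomial \<open>(1, b')\<close>, row 1 the
    left part b of the monomial \<open>(b, 1)\<close>.\<close>
  let ?c = "\<lambda>i::nat. if i = 0 then c2 else c1"
  have "factorization 2 (\<lambda>i. if i = 0 then \<one>\<^bsub>B\<^esub> else b) m ?c d"
    using lin[OF mem(1)] lin[OF mem(2)] car[OF mem(1)] car[OF mem(2)] d b b'
    by (auto simp: factorization_def less_2_cases_iff)
  note fact = factorization_comp[OF this E]
  define C where "C = (\<lambda>i s. \<Oplus>\<^bsub>A\<^esub>l\<in>{..<m}. ?c i l \<otimes>\<^bsub>A\<^esub> E l s)"
  have C: "C 0 j = \<gamma> j {#(\<one>\<^bsub>B\<^esub>, b')#}" "C 1 j = \<gamma> j {#(b, \<one>\<^bsub>B'\<^esub>)#}" if "j < M" for j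
    unfolding C_def \<gamma>[OF mem(1) that] \<gamma>[OF mem(2) that] by simp_all
  have 1: "\<forall>j<M. f' (C 0 j) \<otimes>\<^bsub>B'\<^esub> b' = f' (C 1 j)"
    by (intro allI impI) (simp only: C key)
  have 2: "factorization 2 (\<lambda>i. if i = 0 then \<one>\<^bsub>B\<^esub> else b) M C e"
    unfolding C_def by (rule fact)
  show ?thesis
    by (rule exI[of _ M], rule exI[of _ C], rule exI[of _ e], rule conjI[OF 2 1])
qed

end

section \<open>Ideals, chains and prime ideals\<close>

lemma (in ideal) finsum_mem:
  fixes m :: nat
  assumes "\<And>j. j < m \<Longrightarrow> x j \<in> I" shows "(\<Oplus>j\<in>{..<m}. x j) \<in> I"
  using assms
proof (induction m)
  case (Suc m)
  then have "x \<in> {..<Suc m} \<rightarrow> carrier R" using a_Hcarr by auto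
  from finsum_lessThan_Suc[OF this] Suc show ?case by simp
qed simp

lemma (in ring) ideal_Union_chain:
  assumes "C \<noteq> {}" and C: "\<And>J. J \<in> C \<Longrightarrow> ideal J R"
    and chain: "\<And>J J'. J \<in> C \<Longrightarrow> J' \<in> C \<Longrightarrow> J \<subseteq> J' \<or> J' \<subseteq> J"
  shows "ideal (\<Union>C) R"
proof (rule idealI[OF ring_axioms])
  have sg: "additive_subgroup J R" if "J \<in> C" for J using C[OF that] by (rule ideal.axioms)
  show "subgroup (\<Union>C) (add_monoid R)"
  proof (rule add.subgroupI)
    show "\<Union>C \<subseteq> carrier R" using additive_subgroup.a_subset[OF sg] by blast
    obtain J where "J \<in> C" using assms(1) by blast
    then show "\<Union>C \<noteq> {}" using additive_subgroup.zero_closed[OF sg] by blast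
    fix a assume "a \<in> \<Union>C"
    then obtain J where J: "J \<in> C" "a \<in> J" by blast
    then show "\<ominus> a \<in> \<Union>C" using additive_subgroup.a_inv_closed[OF sg[OF J(1)] J(2)] by blast
    fix b assume "b \<in> \<Union>C"
    then obtain J' where J': "J' \<in> C" "b \<in> J'" by blast
    have "\<exists>K\<in>C. a \<in> K \<and> b \<in> K" using chain[OF J(1) J'(1)] J J' by blast
    then obtain K where K: "K \<in> C" "a \<in> K" "b \<in> K" by blast
    then show "a \<oplus> b \<in> \<Union>C" using additive_subgroup.a_closed[OF sg[OF K(1)] K(2,3)] by blast
  qed
next
  fix a x assume "a \<in> \<Union>C" and x: "x \<in> carrier R"
  then obtain J where J: "J \<in> C" "a \<in> J" by blast
  show "x \<otimes> a \<in> \<Union>C" using ideal.I_l_closed[OF C[OF J(1)] J(2) x] J(1) by blast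
  show "a \<otimes> x \<in> \<Union>C" using ideal.I_r_closed[OF C[OF J(1)] J(2) x] J(1) by blast
qed

text \<open>Zorn's lemma for the ideals that contain I and avoid 1: a maximal member is a maximal
  ideal of the ring, hence prime.\<close>

lemma (in cring) ex_primeideal:
  assumes "ideal I R" "\<one> \<notin> I"
  shows "\<exists>P. primeideal P R \<and> I \<subseteq> P"
proof -
  define F where "F = {J. ideal J R \<and> I \<subseteq> J \<and> \<one> \<notin> J}"
  have "\<exists>M\<in>F. \<forall>X\<in>F. M \<subseteq> X \<longrightarrow> X = M"
  proof (rule subset_Zorn_nonempty)
    show "F \<noteq> {}" using assms by (auto simp: F_def)
    fix C assume C: "C \<noteq> {}" "subset.chain F C"
    then have "\<And>J. J \<in> C \<Longrightarrow> ideal J R" "\<And>J J'. J \<in> C \<Longrightarrow> J' \<in> C \<Longrightarrow> J \<subseteq> J' \<or> J' \<subseteq> J"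
      by (auto simp: subset_chain_def F_def)
    then have "ideal (\<Union>C) R" using C(1) by (intro ideal_Union_chain)
    moreover have "I \<subseteq> J \<and> \<one> \<notin> J" if "J \<in> C" for J
      using C(2) that by (auto simp: subset_chain_def F_def)
    then have "I \<subseteq> \<Union>C" "\<one> \<notin> \<Union>C" using C(1) by blast+
    ultimately show "\<Union>C \<in> F" by (simp add: F_def)
  qed
  then obtain M where M: "ideal M R" "I \<subseteq> M" "\<one> \<notin> M"
    and max: "\<And>X. X \<in> F \<Longrightarrow> M \<subseteq> X \<Longrightarrow> X = M" by (auto simp: F_def)
  have "maximalideal M R"
  proof (rule maximalidealI[OF M(1)])
    show "carrier R \<noteq> M" using M(3) by auto
    fix J assume J: "ideal J R" "M \<subseteq> J" "J \<subseteq> carrier R"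
    show "J = M \<or> J = carrier R"
      using max[of J] J M(2) ideal.one_imp_carrier[OF J(1)] by (auto simp: F_def)
  qed
  then show ?thesis using maximalideal_prime M(2) by blast
qed

section \<open>Common refinements of factorizations\<close>

context flat_ring_hom
begin

text \<open>Comparing the two expansions of \<open>b\<close> gives relations on the stacked column
  of \<open>d\<close> and \<open>d'\<close>, with rows formed from \<open>c\<close> and the negative
  of \<open>c'\<close>. Lifting these relations expresses both columns through one \<open>e\<close>
  and makes the two matrix products equal.\<close>

lemma factorization_merge:
  assumes 1: "factorization n b m c d" and 2: "factorization n b m' c' d'"
  shows "\<exists>M E E' e. factorization m d M E e \<and> factorization m' d' M E' e \<and>
    (\<forall>i<n. \<forall>s<M. (\<Oplus>l\<in>{..<m}. c i l \<otimes> E l s) = (\<Oplus>l\<in>{..<m'}. c' i l \<otimes> E' l s))"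
proof -
  note f1 = factorizationD[OF 1] and f2 = factorizationD[OF 2]
  define D where "D j = (if j < m then d j else d' (j - m))" for j
  define a where "a k j = (if j < m then c k j else \<ominus> c' k (j - m))" for k j
  have D: "D j \<in> carrier S" if "j < m + m'" for j using f1(2) f2(2) that by (auto simp: D_def)
  have a: "a k j \<in> carrier R" if "k < n" "j < m + m'" for k j
    using f1(1) f2(1) that by (auto simp: a_def)
  have "\<exists>M E e. factorization (m + m') D M E e \<and> relations {..<n} a (m + m') M E"
  proof (rule flat_relations)
    fix k assume "k \<in> {..<n}"
    then have k: "k < n" by simp
    have "(\<Oplus>\<^bsub>S\<^esub>i\<in>{..<m + m'}. h (a k i) \<otimes>\<^bsub>S\<^esub> D i) =
      (\<Oplus>\<^bsub>S\<^esub>i\<in>{..<m}. h (a k i) \<otimes>\<^bsub>S\<^esub> D i) \<oplus>\<^bsub>S\<^esub> (\<Oplus>\<^bsub>S\<^esub>i\<in>{..<m'}. h (a k (m + i)) \<otimes>\<^bsub>S\<^esub> D (m + i))"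
      using a[OF k] D by (intro S.finsum_lessThan_add) auto
    also have "(\<Oplus>\<^bsub>S\<^esub>i\<in>{..<m}. h (a k i) \<otimes>\<^bsub>S\<^esub> D i) = b k"
      unfolding f1(3)[OF k] using f1(1)[OF k] f1(2) by (intro S.finsum_cong') (auto simp: a_def D_def)
    also have "(\<Oplus>\<^bsub>S\<^esub>i\<in>{..<m'}. h (a k (m + i)) \<otimes>\<^bsub>S\<^esub> D (m + i)) =
        (\<Oplus>\<^bsub>S\<^esub>i\<in>{..<m'}. \<ominus>\<^bsub>S\<^esub> \<one>\<^bsub>S\<^esub> \<otimes>\<^bsub>S\<^esub> (h (c' k i) \<otimes>\<^bsub>S\<^esub> d' i))"
      using f2(1)[OF k] f2(2) by (intro S.finsum_cong') (auto simp: a_def D_def S.l_minus)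
    also have "\<dots> = \<ominus>\<^bsub>S\<^esub> \<one>\<^bsub>S\<^esub> \<otimes>\<^bsub>S\<^esub> b k"
      unfolding f2(3)[OF k] using f2(1)[OF k] f2(2) by (intro S.finsum_rdistr[symmetric]) auto
    also have "b k \<oplus>\<^bsub>S\<^esub> \<dots> = \<zero>\<^bsub>S\<^esub>"
    proof -
      have "b k \<in> carrier S"
        unfolding f1(3)[OF k] using f1(1)[OF k] f1(2) by (intro S.finsum_closed) auto
      then show ?thesis by (simp add: S.l_minus S.r_neg)
    qed
    finally show "(\<Oplus>\<^bsub>S\<^esub>i\<in>{..<m + m'}. h (a k i) \<otimes>\<^bsub>S\<^esub> D i) = \<zero>\<^bsub>S\<^esub>" .
  qed (use a D in auto)
  then obtain M E e where E: "factorization (m + m') D M E e" and rel: "relations {..<n} a (m + m') M E"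
    by blast
  note Ec = factorizationD[OF E]
  define E' where "E' l s = E (m + l) s" for l s
  have 1: "factorization m d M E e"
    unfolding factorization_def
  proof (intro conjI allI impI)
    fix i assume "i < m"
    then show "d i = (\<Oplus>\<^bsub>S\<^esub>j\<in>{..<M}. h (E i j) \<otimes>\<^bsub>S\<^esub> e j)" using Ec(3)[of i] by (simp add: D_def)
  qed (use Ec in auto)
  have 2: "factorization m' d' M E' e"
    unfolding factorization_def E'_def
  proof (intro conjI allI impI)
    fix i assume "i < m'"
    then show "d' i = (\<Oplus>\<^bsub>S\<^esub>j\<in>{..<M}. h (E (m + i) j) \<otimes>\<^bsub>S\<^esub> e j)" using Ec(3)[of "m + i"] by (simp add: D_def)
  qed (use Ec in auto)
  have 3: "(\<Oplus>l\<in>{..<m}. c i l \<otimes> E l s) = (\<Oplus>l\<in>{..<m'}. c' i l \<otimes> E' l s)" if i: "i < n" and s: "s < M" for i s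
  proof -
    let ?x = "\<Oplus>l\<in>{..<m}. c i l \<otimes> E l s" and ?y = "\<Oplus>l\<in>{..<m'}. c' i l \<otimes> E' l s"
    have xy: "?x \<in> carrier R" "?y \<in> carrier R"
      using f1(1)[OF i] f2(1)[OF i] Ec(1) s by (auto simp: E'_def intro!: R.finsum_closed)
    have "\<zero> = (\<Oplus>l\<in>{..<m + m'}. a i l \<otimes> E l s)"
      using rel i s by (simp add: relations_def)
    also have "\<dots> = (\<Oplus>l\<in>{..<m}. a i l \<otimes> E l s) \<oplus> (\<Oplus>l\<in>{..<m'}. a i (m + l) \<otimes> E (m + l) s)"
      using a[OF i] Ec(1) s by (intro R.finsum_lessThan_add) auto
    also have "(\<Oplus>l\<in>{..<m}. a i l \<otimes> E l s) = ?x"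
      using f1(1)[OF i] Ec(1) s by (intro R.finsum_cong') (auto simp: a_def)
    also have "(\<Oplus>l\<in>{..<m'}. a i (m + l) \<otimes> E (m + l) s) = (\<Oplus>l\<in>{..<m'}. \<ominus> \<one> \<otimes> (c' i l \<otimes> E' l s))"
      using f2(1)[OF i] Ec(1) s by (intro R.finsum_cong') (auto simp: a_def E'_def R.l_minus)
    also have "\<dots> = \<ominus> \<one> \<otimes> ?y"
      using f2(1)[OF i] Ec(1) s by (intro R.finsum_rdistr[symmetric]) (auto simp: E'_def)
    finally have "?x \<oplus> \<ominus> ?y = \<zero>" using xy by (simp add: R.l_minus)
    then show ?thesis using xy R.minus_equality[of ?x "\<ominus> ?y"] R.sum_zero_eq_neg[of ?x "\<ominus> ?y"] by simp
  qed
  show ?thesis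
    by (rule exI[of _ M], rule exI[of _ E], rule exI[of _ E'], rule exI[of _ e])
      (intro conjI 1 2 allI impI 3)
qed

end

context algebra_pair
begin

text \<open>The equation between row 0 and row 1 is imposed on each column of the matrix and is
  linear over A, so it survives multiplication by \<open>E\<close>.\<close>

lemma relation_refine:
  fixes c E :: "nat \<Rightarrow> nat \<Rightarrow> 'a"
  assumes c: "\<And>i l. i < 2 \<Longrightarrow> l < m \<Longrightarrow> c i l \<in> carrier A" and E: "\<And>l. l < m \<Longrightarrow> E l s \<in> carrier A"
    and b': "b' \<in> carrier B'" and rel: "\<forall>l<m. f' (c 0 l) \<otimes>\<^bsub>B'\<^esub> b' = f' (c 1 l)"
  shows "f' (\<Oplus>\<^bsub>A\<^esub>l\<in>{..<m}. c 0 l \<otimes>\<^bsub>A\<^esub> E l s) \<otimes>\<^bsub>B'\<^esub> b' = f' (\<Oplus>\<^bsub>A\<^esub>l\<in>{..<m}. c 1 l \<otimes>\<^bsub>A\<^esub> E l s)"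
proof -
  have c: "c 0 l \<in> carrier A" "c 1 l \<in> carrier A" if "l < m" for l using c that by auto
  have "f' (\<Oplus>\<^bsub>A\<^esub>l\<in>{..<m}. c 0 l \<otimes>\<^bsub>A\<^esub> E l s) \<otimes>\<^bsub>B'\<^esub> b' = (\<Oplus>\<^bsub>B'\<^esub>l\<in>{..<m}. f' (c 0 l \<otimes>\<^bsub>A\<^esub> E l s)) \<otimes>\<^bsub>B'\<^esub> b'"
    using c E by (subst F'.hom_finsum) (auto simp: o_def)
  also have "\<dots> = (\<Oplus>\<^bsub>B'\<^esub>l\<in>{..<m}. f' (c 0 l \<otimes>\<^bsub>A\<^esub> E l s) \<otimes>\<^bsub>B'\<^esub> b')"
    using c E b' by (intro F'.S.finsum_ldistr) auto
  also have "\<dots> = (\<Oplus>\<^bsub>B'\<^esub>l\<in>{..<m}. f' (c 1 l \<otimes>\<^bsub>A\<^esub> E l s))"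
  proof (intro F'.S.finsum_cong')
    fix l assume l: "l \<in> {..<m}"
    have "f' (c 0 l \<otimes>\<^bsub>A\<^esub> E l s) \<otimes>\<^bsub>B'\<^esub> b' = (f' (c 0 l) \<otimes>\<^bsub>B'\<^esub> b') \<otimes>\<^bsub>B'\<^esub> f' (E l s)"
      using c E b' l by (simp add: F'.S.m_ac)
    then show "f' (c 0 l \<otimes>\<^bsub>A\<^esub> E l s) \<otimes>\<^bsub>B'\<^esub> b' = f' (c 1 l \<otimes>\<^bsub>A\<^esub> E l s)"
      using rel l c E by simp
  qed (use c E in auto)
  also have "\<dots> = f' (\<Oplus>\<^bsub>A\<^esub>l\<in>{..<m}. c 1 l \<otimes>\<^bsub>A\<^esub> E l s)"
    using c E by (subst F'.hom_finsum) (auto simp: o_def)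
  finally show ?thesis .
qed

end

section \<open>Descent along fppf coverings\<close>

lemma is_alg_homD:
  assumes "is_alg_hom k A B f"
  shows "is_alg k A" "is_alg k B" "ring_hom_cring (fst A) (fst B) f" "f \<in> ring_hom (fst A) (fst B)"
    "c \<in> carrier k \<Longrightarrow> f (snd A c) = snd B c" "cring (fst A)" "cring (fst B)"
  using assms
  by (auto simp: is_alg_hom_def is_alg_def intro!: ring_hom_cring.intro ring_hom_cring_axioms.intro)

lemma fppf_coveringD:
  assumes "fppf_covering k A U"
  shows "finite U" "(B, f) \<in> U \<Longrightarrow> is_alg_hom k A B f"
    "(B, f) \<in> U \<Longrightarrow> flat_ring_hom (fst A) (fst B) f"
    "primeideal P (fst A) \<Longrightarrow>
      \<exists>B f Q. (B, f) \<in> U \<and> primeideal Q (fst B) \<and> {x \<in> carrier (fst A). f x \<in> Q} = P"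
proof -
  show "finite U" using assms by (simp add: fppf_covering_def)
  show hom: "is_alg_hom k A B f" if "(B, f) \<in> U" for B f
    using assms that by (auto simp: fppf_covering_def)
  show "flat_ring_hom (fst A) (fst B) f" if "(B, f) \<in> U"
    using assms that is_alg_homD(3)[OF hom[OF that]]
    by (auto simp: fppf_covering_def flat_ring_hom_def flat_ring_hom_axioms_def)
  show "\<exists>B f Q. (B, f) \<in> U \<and> primeideal Q (fst B) \<and> {x \<in> carrier (fst A). f x \<in> Q} = P"
    if P: "primeideal P (fst A)"
  proof -
    have "\<forall>P. primeideal P (fst A) \<longrightarrow>
        (\<exists>(B, f)\<in>U. \<exists>Q. primeideal Q (fst B) \<and> {x \<in> carrier (fst A). f x \<in> Q} = P)"
      using assms unfolding fppf_covering_def by (elim conjE)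
    with P obtain z where z: "z \<in> U"
      "case z of (B, f) \<Rightarrow> \<exists>Q. primeideal Q (fst B) \<and> {x \<in> carrier (fst A). f x \<in> Q} = P" by blast
    obtain B f where "z = (B, f)" by (cases z)
    with z show ?thesis by (intro exI[of _ B] exI[of _ f]) auto
  qed
qed

text \<open>A proper I lies in a prime P, which is the preimage of a prime Q of some member B, the
  covering being surjective on spectra. In B the element 1 is a combination of images of I, so Q
  would contain 1.\<close>

lemma fppf_faithful:
  assumes A: "is_alg k A" and U: "fppf_covering k A U" and I: "ideal I (fst A)"
    and fac: "\<And>B f. (B, f) \<in> U \<Longrightarrow> \<exists>m c d.
      flat_ring_hom.factorization (fst A) (fst B) f (Suc 0) (\<lambda>_. \<one>\<^bsub>fst B\<^esub>) m c d \<and> (\<forall>j<m. c 0 j \<in> I)"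
  shows "I = carrier (fst A)"
proof (rule ccontr)
  assume "I \<noteq> carrier (fst A)"
  interpret A: cring "fst A" using A by (simp add: is_alg_def)
  have "\<one>\<^bsub>fst A\<^esub> \<notin> I" using \<open>I \<noteq> _\<close> ideal.one_imp_carrier[OF I] by blast
  then obtain P where P: "primeideal P (fst A)" "I \<subseteq> P" using A.ex_primeideal[OF I] by blast
  obtain B f Q where B: "(B, f) \<in> U" and Q: "primeideal Q (fst B)" and PQ: "{x \<in> carrier (fst A). f x \<in> Q} = P"
    using fppf_coveringD(4)[OF U P(1)] by blast
  interpret B: flat_ring_hom "fst A" "fst B" f by (rule fppf_coveringD(3)[OF U B])
  interpret Q: primeideal Q "fst B" by (rule Q)
  obtain m c d where "B.factorization (Suc 0) (\<lambda>_. \<one>\<^bsub>fst B\<^esub>) m c d" and c: "\<forall>j<m. c 0 j \<in> I"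
    using fac[OF B] by blast
  note fac = B.factorizationD[OF this(1)]
  have "\<one>\<^bsub>fst B\<^esub> = (\<Oplus>\<^bsub>fst B\<^esub>j\<in>{..<m}. f (c 0 j) \<otimes>\<^bsub>fst B\<^esub> d j)" by (rule fac(3)) simp
  moreover have "(\<Oplus>\<^bsub>fst B\<^esub>j\<in>{..<m}. f (c 0 j) \<otimes>\<^bsub>fst B\<^esub> d j) \<in> Q"
  proof (rule Q.finsum_mem)
    fix j assume j: "j < m"
    with c P(2) PQ have "f (c 0 j) \<in> Q" by blast
    then show "f (c 0 j) \<otimes>\<^bsub>fst B\<^esub> d j \<in> Q" using fac(2)[OF j] by (rule Q.I_r_closed)
  qed
  ultimately show False using Q.I_notcarr Q.one_imp_carrier by auto
qed

text \<open>\<open>fppf_faithful\<close> is applied to the annihilator of the difference x. Since x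
  becomes 0 in B, the one-term relation of x with 1 holds there, and flatness lifts it to an
  expansion of 1 whose coefficients are killed by x.\<close>

lemma fppf_separated:
  assumes A: "is_alg k A" and U: "fppf_covering k A U"
    and a: "a \<in> carrier (fst A)" "a' \<in> carrier (fst A)" and eq: "\<And>B f. (B, f) \<in> U \<Longrightarrow> f a = f a'"
  shows "a = a'"
proof -
  interpret A: cring "fst A" using A by (simp add: is_alg_def)
  define x where "x = a \<ominus>\<^bsub>fst A\<^esub> a'"
  have x: "x \<in> carrier (fst A)" using a by (simp add: x_def)
  let ?I = "{y \<in> carrier (fst A). x \<otimes>\<^bsub>fst A\<^esub> y = \<zero>\<^bsub>fst A\<^esub>}"
  have "ideal ?I (fst A)"
  proof (rule idealI[OF A.ring_axioms])
    show "subgroup ?I (add_monoid (fst A))"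
    proof (rule group.subgroupI[OF A.a_group])
      fix y assume "y \<in> ?I"
      then have "\<ominus>\<^bsub>fst A\<^esub> y \<in> ?I" using x by (simp add: A.r_minus)
      then show "inv\<^bsub>add_monoid (fst A)\<^esub> y \<in> ?I" by (simp add: a_inv_def)
    qed (use x in \<open>auto simp: A.r_distr\<close>)
    fix y z assume y: "y \<in> ?I" and z: "z \<in> carrier (fst A)"
    then have "x \<otimes>\<^bsub>fst A\<^esub> (y \<otimes>\<^bsub>fst A\<^esub> z) = \<zero>\<^bsub>fst A\<^esub>"
      using x by (simp flip: A.m_assoc)
    then show "y \<otimes>\<^bsub>fst A\<^esub> z \<in> ?I" "z \<otimes>\<^bsub>fst A\<^esub> y \<in> ?I" using y z by (auto simp: A.m_comm)
  qed
  then have "?I = carrier (fst A)"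
  proof (rule fppf_faithful[OF A U])
    fix B f assume B: "(B, f) \<in> U"
    interpret B: flat_ring_hom "fst A" "fst B" f by (rule fppf_coveringD(3)[OF U B])
    have "f x = \<zero>\<^bsub>fst B\<^esub>" using eq[OF B] a by (simp add: x_def B.S.minus_eq A.minus_eq B.S.r_neg)
    then have "\<exists>m c d. B.factorization (Suc 0) (\<lambda>_. \<one>\<^bsub>fst B\<^esub>) m c d \<and>
        B.relations {()} (\<lambda>_ _. x) (Suc 0) m c"
      using x by (intro B.flat_relation) (auto simp: lessThan_Suc)
    then obtain m c d where 1: "B.factorization (Suc 0) (\<lambda>_. \<one>\<^bsub>fst B\<^esub>) m c d"
      and 2: "B.relations {()} (\<lambda>_ _. x) (Suc 0) m c" by blast
    have "c 0 j \<in> ?I" if "j < m" for j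
    proof -
      have c: "c 0 j \<in> carrier (fst A)" using B.factorizationD(1)[OF 1 _ that] by simp
      have "(\<Oplus>\<^bsub>fst A\<^esub>i\<in>{0}. x \<otimes>\<^bsub>fst A\<^esub> c i j) = x \<otimes>\<^bsub>fst A\<^esub> c 0 j"
        using x c A.finsum_insert[of "{}" 0 "\<lambda>i. x \<otimes>\<^bsub>fst A\<^esub> c i j"] by simp
      with 2 that c show ?thesis by (simp add: B.relations_def lessThan_Suc)
    qed
    with 1 show "\<exists>m c d. B.factorization (Suc 0) (\<lambda>_. \<one>\<^bsub>fst B\<^esub>) m c d \<and> (\<forall>j<m. c 0 j \<in> ?I)"
      by blast
  qed
  then have "\<one>\<^bsub>fst A\<^esub> \<in> ?I" by simp
  then have "x = \<zero>\<^bsub>fst A\<^esub>" using x by simp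
  then show ?thesis using a unfolding x_def by (metis A.r_right_minus_eq)
qed

lemma (in flat_ring_hom) factorization_one:
  assumes "factorization 2 (\<lambda>i. if i = 0 then x else y) m c d"
  shows "factorization (Suc 0) (\<lambda>_. x) m c d"
  using factorizationD(1)[OF assms, of 0] factorizationD(2)[OF assms] factorizationD(3)[OF assms, of 0]
  by (simp add: factorization_def)

text \<open>Compatibility is evaluated on the pushout, transported into \<open>'u\<close>. The
  outcome says that b' behaves in B' like the fraction of \<open>c 1 j\<close> by
  \<open>c 0 j\<close>, with numerator and denominator from A, and that the denominators generate
  the unit ideal of B.\<close>

lemma fppf_pair_relation:
  fixes A :: "('k, 'u::infinite) alg"
  assumes B: "is_alg_hom k A B f" "flat_ring_hom (fst A) (fst B) f" and B': "is_alg_hom k A B' f'"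
    and b: "b \<in> carrier (fst B)" "b' \<in> carrier (fst B')"
    and comp: "\<And>C g g'. is_alg_hom k B C g \<Longrightarrow> is_alg_hom k B' C g' \<Longrightarrow>
      (\<And>x. x \<in> carrier (fst A) \<Longrightarrow> g (f x) = g' (f' x)) \<Longrightarrow> g b = g' b'"
  shows "\<exists>m c d. flat_ring_hom.factorization (fst A) (fst B) f 2 (\<lambda>i. if i = 0 then \<one>\<^bsub>fst B\<^esub> else b) m c d \<and>
    (\<forall>j<m. f' (c 0 j) \<otimes>\<^bsub>fst B'\<^esub> b' = f' (c 1 j))"
proof -
  interpret B: flat_ring_hom "fst A" "fst B" f by (rule B)
  interpret B': ring_hom_cring "fst A" "fst B'" f' by (rule is_alg_homD(3)[OF B'])
  interpret P: flat_algebra_pair "fst A" "fst B" "fst B'" f f' by unfold_locales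
  obtain \<phi> :: "(('u \<times> 'u) multiset \<Rightarrow>\<^sub>0 int) \<Rightarrow> 'u" where "inj \<phi>" using ex_inj_mset_poly by blast
  from P.ex_pushout[OF this] obtain C :: "'u ring" and g g' where C: "cring C" and
    g: "g \<in> ring_hom (fst B) C" "g' \<in> ring_hom (fst B') C" and gf: "\<forall>a\<in>carrier (fst A). g (f a) = g' (f' a)"
    and detect: "\<forall>b b'. g b = g' b' \<longrightarrow> P.lvar b - P.rvar b' \<in> P.null" by blast
  \<comment> \<open>The k-structure of C is taken through B; it is also the one through B', since
    the two maps agree on A.\<close>
  let ?C = "(C, g \<circ> snd B)"
  have snd: "snd A c \<in> carrier (fst A)" if "c \<in> carrier k" for c
    using is_alg_homD(1)[OF B(1)] that ring_hom_closed by (fastforce simp: is_alg_def)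
  have algC: "is_alg k ?C"
    using C g is_alg_homD(2)[OF B(1)] by (auto simp: is_alg_def intro: ring_hom_trans)
  have "is_alg_hom k B ?C g"
    using algC g is_alg_homD(2)[OF B(1)] by (simp add: is_alg_hom_def)
  moreover have "is_alg_hom k B' ?C g'"
    using algC g is_alg_homD(2)[OF B'] snd gf is_alg_homD(5)[OF B(1)] is_alg_homD(5)[OF B']
    by (simp add: is_alg_hom_def) metis
  ultimately have "g b = g' b'" using comp gf by blast
  then have "P.lvar b - P.rvar b' \<in> P.null" using detect by blast
  then show ?thesis by (rule P.null_detect[OF b])
qed

text \<open>Different members B' come with different denominators. Merging the factorizations over
  the fixed B, one member at a time, leads to denominators that serve all members of a finite
  set.\<close>

lemma fppf_common_relation:
  fixes A :: "('k, 'u::infinite) alg"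
  assumes U: "fppf_covering k A U" and B: "(B, f) \<in> U"
    and b: "\<And>B f. (B, f) \<in> U \<Longrightarrow> b (B, f) \<in> carrier (fst B)"
    and comp: "\<And>B f B' f' C g g'. (B, f) \<in> U \<Longrightarrow> (B', f') \<in> U \<Longrightarrow>
      is_alg_hom k B C g \<Longrightarrow> is_alg_hom k B' C g' \<Longrightarrow>
      (\<And>x. x \<in> carrier (fst A) \<Longrightarrow> g (f x) = g' (f' x)) \<Longrightarrow> g (b (B, f)) = g' (b (B', f'))"
    and J: "finite J" "J \<subseteq> U"
  shows "\<exists>m c d. flat_ring_hom.factorization (fst A) (fst B) f 2 (\<lambda>i. if i = 0 then \<one>\<^bsub>fst B\<^esub> else b (B, f)) m c d \<and>
    (\<forall>(B', f')\<in>J. \<forall>j<m. f' (c 0 j) \<otimes>\<^bsub>fst B'\<^esub> b (B', f') = f' (c 1 j))"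
  using J
proof (induction J)
  case empty
  show ?case
    using fppf_pair_relation[OF fppf_coveringD(2,3)[OF U B] fppf_coveringD(2)[OF U B] b[OF B] b[OF B]] comp[OF B B]
    by blast
next
  case (insert x J)
  interpret B: flat_ring_hom "fst A" "fst B" f by (rule fppf_coveringD(3)[OF U B])
  obtain B' f' where x: "x = (B', f')" by (cases x)
  have B': "(B', f') \<in> U" using insert.prems x by simp
  let ?b = "\<lambda>i::nat. if i = 0 then \<one>\<^bsub>fst B\<^esub> else b (B, f)"
  obtain m c d where 1: "B.factorization 2 ?b m c d"
    and r1: "\<forall>(B', f')\<in>J. \<forall>j<m. f' (c 0 j) \<otimes>\<^bsub>fst B'\<^esub> b (B', f') = f' (c 1 j)"
    using insert by blast
  have "\<exists>m c d. B.factorization 2 ?b m c d \<and>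
      (\<forall>j<m. f' (c 0 j) \<otimes>\<^bsub>fst B'\<^esub> b (B', f') = f' (c 1 j))"
    using fppf_pair_relation[OF fppf_coveringD(2,3)[OF U B] fppf_coveringD(2)[OF U B'] b[OF B] b[OF B']] comp[OF B B']
    by blast
  then obtain m' c' d' where 2: "B.factorization 2 ?b m' c' d'"
    and r2: "\<forall>j<m'. f' (c' 0 j) \<otimes>\<^bsub>fst B'\<^esub> b (B', f') = f' (c' 1 j)" by blast
  obtain M E E' e where E: "B.factorization m d M E e" "B.factorization m' d' M E' e" and
    eq: "\<forall>i<2. \<forall>s<M. (\<Oplus>\<^bsub>fst A\<^esub>l\<in>{..<m}. c i l \<otimes>\<^bsub>fst A\<^esub> E l s) =
      (\<Oplus>\<^bsub>fst A\<^esub>l\<in>{..<m'}. c' i l \<otimes>\<^bsub>fst A\<^esub> E' l s)"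
    using B.factorization_merge[OF 1 2] by blast
  define C where "C i s = (\<Oplus>\<^bsub>fst A\<^esub>l\<in>{..<m}. c i l \<otimes>\<^bsub>fst A\<^esub> E l s)" for i s
  have fac: "B.factorization 2 ?b M C e"
    using B.factorization_comp[OF 1 E(1)] unfolding C_def .
  have "\<forall>j<M. f'' (C 0 j) \<otimes>\<^bsub>fst B''\<^esub> b (B'', f'') = f'' (C 1 j)" if "(B'', f'') \<in> insert x J" for B'' f''
  proof (intro allI impI)
    fix j assume j: "j < M"
    have B'': "(B'', f'') \<in> U" using that insert.prems by blast
    interpret B'': ring_hom_cring "fst A" "fst B''" f'' by (rule is_alg_homD(3)[OF fppf_coveringD(2)[OF U B'']])
    interpret P: algebra_pair "fst A" "fst B" "fst B''" f f'' by unfold_locales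
    show "f'' (C 0 j) \<otimes>\<^bsub>fst B''\<^esub> b (B'', f'') = f'' (C 1 j)"
    proof (cases "(B'', f'') = x")
      case True
      \<comment> \<open>The merged matrix has two descriptions: the one through \<open>c'\<close>
        carries the equation for the new member, the one through \<open>c\<close> the equations for
        the earlier members.\<close>
      have C': "C i j = (\<Oplus>\<^bsub>fst A\<^esub>l\<in>{..<m'}. c' i l \<otimes>\<^bsub>fst A\<^esub> E' l j)" if "i < 2" for i
        using eq that j by (simp add: C_def)
      have r: "\<forall>l<m'. f'' (c' 0 l) \<otimes>\<^bsub>fst B''\<^esub> b (B'', f'') = f'' (c' 1 l)"
        using r2 True x by simp
      have C0: "C 0 j = (\<Oplus>\<^bsub>fst A\<^esub>l\<in>{..<m'}. c' 0 l \<otimes>\<^bsub>fst A\<^esub> E' l j)"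
        and C1: "C 1 j = (\<Oplus>\<^bsub>fst A\<^esub>l\<in>{..<m'}. c' 1 l \<otimes>\<^bsub>fst A\<^esub> E' l j)" by (intro C', simp)+
      show ?thesis
        unfolding C0 C1
        by (intro P.relation_refine B.factorizationD(1)[OF 2] B.factorizationD(1)[OF E(2) _ j] b[OF B''] r)
    next
      case False
      then have "\<forall>l<m. f'' (c 0 l) \<otimes>\<^bsub>fst B''\<^esub> b (B'', f'') = f'' (c 1 l)"
        using r1 that by blast
      then show ?thesis
        unfolding C_def
        by (intro P.relation_refine B.factorizationD(1)[OF 1] B.factorizationD(1)[OF E(1) _ j] b[OF B''])
    qed
  qed
  then have "\<forall>(B', f')\<in>insert x J. \<forall>j<M. f' (C 0 j) \<otimes>\<^bsub>fst B'\<^esub> b (B', f') = f' (C 1 j)" by blast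
  with fac show ?case by blast
qed

text \<open>
  The ideal of those \<open>a\<close> for which the family \<open>a b\<close> comes from \<open>A\<close> generates the unit ideal in every
  member of the covering, hence is the unit ideal.
\<close>

theorem fppf_glue:
  fixes A :: "('k, 'u::infinite) alg"
  assumes A: "is_alg k A" and U: "fppf_covering k A U"
    and b: "\<And>B f. (B, f) \<in> U \<Longrightarrow> b (B, f) \<in> carrier (fst B)"
    and comp: "\<And>B f B' f' C g g'. (B, f) \<in> U \<Longrightarrow> (B', f') \<in> U \<Longrightarrow>
      is_alg_hom k B C g \<Longrightarrow> is_alg_hom k B' C g' \<Longrightarrow>
      (\<And>x. x \<in> carrier (fst A) \<Longrightarrow> g (f x) = g' (f' x)) \<Longrightarrow> g (b (B, f)) = g' (b (B', f'))"
  shows "\<exists>a\<in>carrier (fst A). \<forall>(B, f)\<in>U. f a = b (B, f)"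
proof -
  interpret A: cring "fst A" using A by (simp add: is_alg_def)
  let ?I = "{a \<in> carrier (fst A). \<exists>c\<in>carrier (fst A). \<forall>(B, f)\<in>U. f a \<otimes>\<^bsub>fst B\<^esub> b (B, f) = f c}"
  have ring_hom: "ring_hom_cring (fst A) (fst B) f" if "(B, f) \<in> U" for B f
    by (rule is_alg_homD(3)[OF fppf_coveringD(2)[OF U that]])
  have "ideal ?I (fst A)"
  proof (rule idealI[OF A.ring_axioms])
    show "subgroup ?I (add_monoid (fst A))"
    proof (rule group.subgroupI[OF A.a_group])
      have "\<zero>\<^bsub>fst A\<^esub> \<in> ?I"
      proof (intro CollectI conjI bexI[of _ "\<zero>\<^bsub>fst A\<^esub>"] ballI, simp_all, clarify)
        fix B f assume B: "(B, f) \<in> U"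
        interpret B: ring_hom_cring "fst A" "fst B" f by (rule ring_hom[OF B])
        show "f \<zero>\<^bsub>fst A\<^esub> \<otimes>\<^bsub>fst B\<^esub> b (B, f) = f \<zero>\<^bsub>fst A\<^esub>" using b[OF B] by simp
      qed
      then show "?I \<noteq> {}" by blast
      fix y assume "y \<in> ?I"
      then obtain c where y: "y \<in> carrier (fst A)" "c \<in> carrier (fst A)"
        "\<And>B f. (B, f) \<in> U \<Longrightarrow> f y \<otimes>\<^bsub>fst B\<^esub> b (B, f) = f c" by blast
      have "f (\<ominus>\<^bsub>fst A\<^esub> y) \<otimes>\<^bsub>fst B\<^esub> b (B, f) = f (\<ominus>\<^bsub>fst A\<^esub> c)" if B: "(B, f) \<in> U" for B f
      proof -
        interpret B: ring_hom_cring "fst A" "fst B" f by (rule ring_hom[OF B])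
        show ?thesis using y(3)[OF B] y(1,2) b[OF B] by (simp add: B.S.l_minus)
      qed
      then have "\<ominus>\<^bsub>fst A\<^esub> y \<in> ?I" using y(1,2) by (intro CollectI conjI bexI[of _ "\<ominus>\<^bsub>fst A\<^esub> c"]) auto
      then show "inv\<^bsub>add_monoid (fst A)\<^esub> y \<in> ?I" by (simp add: a_inv_def)
      fix y' assume "y' \<in> ?I"
      then obtain c' where y': "y' \<in> carrier (fst A)" "c' \<in> carrier (fst A)"
        "\<And>B f. (B, f) \<in> U \<Longrightarrow> f y' \<otimes>\<^bsub>fst B\<^esub> b (B, f) = f c'" by blast
      have "f (y \<oplus>\<^bsub>fst A\<^esub> y') \<otimes>\<^bsub>fst B\<^esub> b (B, f) = f (c \<oplus>\<^bsub>fst A\<^esub> c')" if B: "(B, f) \<in> U" for B f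
      proof -
        interpret B: ring_hom_cring "fst A" "fst B" f by (rule ring_hom[OF B])
        show ?thesis using y(3)[OF B] y'(3)[OF B] y(1,2) y'(1,2) b[OF B] by (simp add: B.S.l_distr)
      qed
      then have "y \<oplus>\<^bsub>fst A\<^esub> y' \<in> ?I" using y(1,2) y'(1,2)
        by (intro CollectI conjI bexI[of _ "c \<oplus>\<^bsub>fst A\<^esub> c'"]) auto
      then show "y \<otimes>\<^bsub>add_monoid (fst A)\<^esub> y' \<in> ?I" by simp
    qed auto
    fix y z assume "y \<in> ?I" and z: "z \<in> carrier (fst A)"
    then obtain c where y: "y \<in> carrier (fst A)" "c \<in> carrier (fst A)"
      "\<And>B f. (B, f) \<in> U \<Longrightarrow> f y \<otimes>\<^bsub>fst B\<^esub> b (B, f) = f c" by blast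
    have "f (z \<otimes>\<^bsub>fst A\<^esub> y) \<otimes>\<^bsub>fst B\<^esub> b (B, f) = f (z \<otimes>\<^bsub>fst A\<^esub> c)" if B: "(B, f) \<in> U" for B f
    proof -
      interpret B: ring_hom_cring "fst A" "fst B" f by (rule ring_hom[OF B])
      show ?thesis using y(3)[OF B] y(1,2) z b[OF B] by (simp add: B.S.m_assoc)
    qed
    then have "z \<otimes>\<^bsub>fst A\<^esub> y \<in> ?I" using y(1,2) z by (intro CollectI conjI bexI[of _ "z \<otimes>\<^bsub>fst A\<^esub> c"]) auto
    then show "z \<otimes>\<^bsub>fst A\<^esub> y \<in> ?I" "y \<otimes>\<^bsub>fst A\<^esub> z \<in> ?I" using A.m_comm[of y z] y(1) z by simp_all
  qed
  then have "?I = carrier (fst A)"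
  proof (rule fppf_faithful[OF A U])
    fix B f assume B: "(B, f) \<in> U"
    interpret B: flat_ring_hom "fst A" "fst B" f by (rule fppf_coveringD(3)[OF U B])
    have "\<exists>m c d. B.factorization 2 (\<lambda>i. if i = 0 then \<one>\<^bsub>fst B\<^esub> else b (B, f)) m c d \<and>
      (\<forall>(B', f')\<in>U. \<forall>j<m. f' (c 0 j) \<otimes>\<^bsub>fst B'\<^esub> b (B', f') = f' (c 1 j))"
      by (rule fppf_common_relation[where b = b, OF U B]) (fact b comp fppf_coveringD(1)[OF U] subset_refl)+
    then obtain m c d where 1: "B.factorization 2 (\<lambda>i. if i = 0 then \<one>\<^bsub>fst B\<^esub> else b (B, f)) m c d"
      and 2: "\<forall>(B', f')\<in>U. \<forall>j<m. f' (c 0 j) \<otimes>\<^bsub>fst B'\<^esub> b (B', f') = f' (c 1 j)" by blast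
    \<comment> \<open>Multiplying the family by \<open>c 0 j\<close> gives the image of
      \<open>c 1 j\<close> in every member, so \<open>c 1 j\<close> is the witness for the
      ideal.\<close>
    have "c 0 j \<in> ?I" if "j < m" for j
      using B.factorizationD(1)[OF 1 _ that] 2 that
      by (intro CollectI conjI bexI[of _ "c 1 j"]) auto
    with B.factorization_one[OF 1]
    show "\<exists>m c d. B.factorization (Suc 0) (\<lambda>_. \<one>\<^bsub>fst B\<^esub>) m c d \<and> (\<forall>j<m. c 0 j \<in> ?I)" by blast
  qed
  then have "\<one>\<^bsub>fst A\<^esub> \<in> ?I" by simp
  then obtain c where c: "c \<in> carrier (fst A)"
    "\<And>B f. (B, f) \<in> U \<Longrightarrow> f \<one>\<^bsub>fst A\<^esub> \<otimes>\<^bsub>fst B\<^esub> b (B, f) = f c" by blast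
  have "f c = b (B, f)" if B: "(B, f) \<in> U" for B f
  proof -
    interpret B: ring_hom_cring "fst A" "fst B" f by (rule ring_hom[OF B])
    show ?thesis using c(2)[OF B] b[OF B] by simp
  qed
  with c(1) show ?thesis by blast
qed

section \<open>The identity covering\<close>

lemma flat_hom_id:
  assumes "cring R" shows "flat_hom R R id"
proof -
  interpret cring R by (rule assms)
  show ?thesis
    unfolding flat_hom_def
  proof (intro allI impI, elim conjE)
    fix n :: nat and a b
    assume a: "a \<in> {..<n} \<rightarrow> carrier R" and b: "b \<in> {..<n} \<rightarrow> carrier R"
      and eq: "(\<Oplus>\<^bsub>R\<^esub>i\<in>{..<n}. id (a i) \<otimes>\<^bsub>R\<^esub> b i) = \<zero>\<^bsub>R\<^esub>"
    have "b i = (\<Oplus>\<^bsub>R\<^esub>j\<in>{..<1::nat}. id (b i) \<otimes>\<^bsub>R\<^esub> \<one>\<^bsub>R\<^esub>)" if "i < n" for i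
      using b that by (auto simp: lessThan_Suc Pi_iff)
    then show "\<exists>(m::nat) c d. (\<forall>i<n. \<forall>j<m. c i j \<in> carrier R) \<and> d \<in> {..<m} \<rightarrow> carrier R \<and>
        (\<forall>i<n. b i = (\<Oplus>\<^bsub>R\<^esub>j\<in>{..<m}. id (c i j) \<otimes>\<^bsub>R\<^esub> d j)) \<and>
        (\<forall>j<m. (\<Oplus>\<^bsub>R\<^esub>i\<in>{..<n}. a i \<otimes>\<^bsub>R\<^esub> c i j) = \<zero>\<^bsub>R\<^esub>)"
      using b eq by (intro exI[of _ 1] exI[of _ "\<lambda>i _. b i"] exI[of _ "\<lambda>_. \<one>\<^bsub>R\<^esub>"]) auto
  qed
qed

lemma finitely_presented_hom_id: "finitely_presented_hom R R id"
  unfolding finitely_presented_hom_def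
proof (rule exI[of _ 0], rule exI[of _ "\<lambda>_. undefined"], rule exI[of _ "{}"], intro conjI allI impI ballI)
  show "\<exists>e. poly_expr_over R 0 e \<and> poly_expr_value R id (\<lambda>_. undefined) e = x"
    if "x \<in> carrier R" for x using that by (intro exI[of _ "Coef x"]) auto
qed auto

lemma is_alg_hom_id: "is_alg k A \<Longrightarrow> is_alg_hom k A A id"
  by (auto simp: is_alg_hom_def ring_hom_def)

text \<open>With this covering, conditions that are posed locally can be verified directly: all
  tori, lattices and quotients constructed below are already split over the base.\<close>

lemma fppf_covering_id:
  assumes "is_alg k A" shows "fppf_covering k A {(A, id)}"
  unfolding fppf_covering_def
proof (intro conjI allI impI)
  fix P assume "primeideal P (fst A)"
  then show "\<exists>(B, f)\<in>{(A, id)}. \<exists>Q. primeideal Q (fst B) \<and> {x \<in> carrier (fst A). f x \<in> Q} = P"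
    using additive_subgroup.a_subset[OF ideal.axioms(1)[OF primeideal.axioms(1)]] by fastforce
qed (use assms in \<open>auto simp: is_alg_hom_id finitely_presented_hom_id is_alg_def intro: flat_hom_id\<close>)

context ring_hom_cring
begin

lemma hom_Units: "x \<in> Units R \<Longrightarrow> h x \<in> Units S"
  unfolding Units_def using hom_mult[symmetric] by (auto simp del: hom_mult) (metis hom_closed hom_one)

lemma hom_units_inv: "x \<in> Units R \<Longrightarrow> h (inv x) = inv\<^bsub>S\<^esub> h x"
  using hom_mult[of x "inv x", symmetric]
  by (intro S.comm_inv_char[symmetric]) (simp_all add: R.Units_closed del: hom_mult)

end

text \<open>The inverses form a compatible family too. The two glued elements multiply to 1 because
  their images do so on the covering.\<close>

lemma fppf_glue_Units:
  fixes A :: "('k, 'u::infinite) alg"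
  assumes A: "is_alg k A" and U: "fppf_covering k A U"
    and b: "\<And>B f. (B, f) \<in> U \<Longrightarrow> b (B, f) \<in> Units (fst B)"
    and comp: "\<And>B f B' f' C g g'. (B, f) \<in> U \<Longrightarrow> (B', f') \<in> U \<Longrightarrow>
      is_alg_hom k B C g \<Longrightarrow> is_alg_hom k B' C g' \<Longrightarrow>
      (\<And>x. x \<in> carrier (fst A) \<Longrightarrow> g (f x) = g' (f' x)) \<Longrightarrow> g (b (B, f)) = g' (b (B', f'))"
  shows "\<exists>a\<in>Units (fst A). \<forall>(B, f)\<in>U. f a = b (B, f)"
proof -
  interpret A: cring "fst A" using A by (simp add: is_alg_def)
  let ?b' = "\<lambda>(B, f). inv\<^bsub>fst B\<^esub> b (B, f)"
  have cB: "cring (fst B)" if "(B, f) \<in> U" for B f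
    using fppf_coveringD(2)[OF U that] is_alg_homD(7) by blast
  have mB: "Group.monoid (fst B)" if "(B, f) \<in> U" for B f
    using cB[OF that] by (simp add: cring_def ring_def)
  have bc: "b (B, f) \<in> carrier (fst B)" if "(B, f) \<in> U" for B f
    by (rule monoid.Units_closed[OF mB[OF that] b[OF that]])
  have "\<exists>a\<in>carrier (fst A). \<forall>(B, f)\<in>U. f a = b (B, f)"
    by (rule fppf_glue[where b = b, OF A U]) (fact bc comp)+
  then obtain a where a: "a \<in> carrier (fst A)" "\<And>B f. (B, f) \<in> U \<Longrightarrow> f a = b (B, f)" by blast
  have "\<exists>a\<in>carrier (fst A). \<forall>(B, f)\<in>U. f a = ?b' (B, f)"
  proof (rule fppf_glue[OF A U])
    show "?b' (B, f) \<in> carrier (fst B)" if "(B, f) \<in> U" for B f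
      using b[OF that] mB[OF that] monoid.Units_inv_closed by fastforce
    fix B f B' f' C g g'
    assume B: "(B, f) \<in> U" "(B', f') \<in> U" and g: "is_alg_hom k B C g" "is_alg_hom k B' C g'"
      and eq: "\<And>x. x \<in> carrier (fst A) \<Longrightarrow> g (f x) = g' (f' x)"
    have "g (inv\<^bsub>fst B\<^esub> b (B, f)) = inv\<^bsub>fst C\<^esub> g (b (B, f))"
      by (rule ring_hom_cring.hom_units_inv[OF is_alg_homD(3)[OF g(1)] b[OF B(1)]])
    also have "\<dots> = inv\<^bsub>fst C\<^esub> g' (b (B', f'))" using comp[OF B g eq] by simp
    also have "\<dots> = g' (inv\<^bsub>fst B'\<^esub> b (B', f'))"
      by (rule ring_hom_cring.hom_units_inv[OF is_alg_homD(3)[OF g(2)] b[OF B(2)], symmetric])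
    finally show "g (?b' (B, f)) = g' (?b' (B', f'))" by simp
  qed
  then have "\<exists>a\<in>carrier (fst A). \<forall>(B, f)\<in>U. f a = inv\<^bsub>fst B\<^esub> b (B, f)" by (simp only: split_conv)
  then obtain a' where a': "a' \<in> carrier (fst A)" "\<And>B f. (B, f) \<in> U \<Longrightarrow> f a' = inv\<^bsub>fst B\<^esub> b (B, f)" by blast
  have "a \<otimes>\<^bsub>fst A\<^esub> a' = \<one>\<^bsub>fst A\<^esub>"
  proof (rule fppf_separated[OF A U])
    fix B f assume B: "(B, f) \<in> U"
    interpret ring_hom_cring "fst A" "fst B" f by (rule is_alg_homD(3)[OF fppf_coveringD(2)[OF U B]])
    show "f (a \<otimes>\<^bsub>fst A\<^esub> a') = f \<one>\<^bsub>fst A\<^esub>"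
      using a(1) a'(1) monoid.Units_r_inv[OF mB[OF B] b[OF B]] by (simp add: a(2)[OF B] a'(2)[OF B])
  qed (use a a' in auto)
  then have "a \<in> Units (fst A)" using a a' by (auto simp: Units_def A.m_comm)
  with a(2) show ?thesis by blast
qed

section \<open>The torus\<close>

lemma comm_group_units_times:
  assumes "cring R" shows "comm_group (units_of R \<times>\<times> units_of R)"
proof -
  interpret cring R by (rule assms)
  interpret u: comm_group "units_of R" by (rule units_comm_group)
  show ?thesis
    using u.m_comm by (intro group.group_comm_groupI DirProd_group) (auto simp: u.is_group)
qed

lemma restr_Gm_hom:
  assumes "is_alg_hom k A B f"
  shows "map_prod f f \<in> hom (units_of (fst A) \<times>\<times> units_of (fst A)) (units_of (fst B) \<times>\<times> units_of (fst B))"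
proof -
  interpret ring_hom_cring "fst A" "fst B" f by (rule is_alg_homD(3)[OF assms])
  show ?thesis by (auto simp: hom_def units_of_def hom_Units R.Units_closed)
qed

lemma group_presheafD:
  assumes "group_presheaf k F"
  shows "is_alg k A \<Longrightarrow> comm_group (sections F A)"
    "is_alg_hom k A B f \<Longrightarrow> restr F A B f \<in> hom (sections F A) (sections F B)"
  using assms unfolding group_presheaf_def by (elim conjE, simp only: simp_thms)+

lemma fppf_sheafI:
  fixes F :: "('k, 'u, 's) group_functor"
  assumes "group_presheaf k F"
    and "\<And>A U s. is_alg k A \<Longrightarrow> fppf_covering k A U \<Longrightarrow>
      (\<And>B f. (B, f) \<in> U \<Longrightarrow> s (B, f) \<in> carrier (sections F B)) \<Longrightarrow>
      (\<And>B f B' f' C g g'. (B, f) \<in> U \<Longrightarrow> (B', f') \<in> U \<Longrightarrow> is_alg_hom k B C g \<Longrightarrow> is_alg_hom k B' C g' \<Longrightarrow>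
        (\<And>x. x \<in> carrier (fst A) \<Longrightarrow> g (f x) = g' (f' x)) \<Longrightarrow>
        restr F B C g (s (B, f)) = restr F B' C g' (s (B', f'))) \<Longrightarrow>
      \<exists>!t. t \<in> carrier (sections F A) \<and> (\<forall>(B, f)\<in>U. restr F A B f t = s (B, f))"
  shows "fppf_sheaf k F"
  unfolding fppf_sheaf_def
proof (intro conjI allI impI assms(1); elim conjE)
  fix A :: "('k, 'u) alg" and U s
  assume A: "is_alg k A" and U: "fppf_covering k A U"
    and s: "\<forall>(B, f)\<in>U. s (B, f) \<in> carrier (sections F B)"
    and comp: "\<forall>(B, f)\<in>U. \<forall>(B', f')\<in>U. \<forall>C g g'.
           is_alg_hom k B C g \<and> is_alg_hom k B' C g' \<and>
           (\<forall>x\<in>carrier (fst A). g (f x) = g' (f' x)) \<longrightarrow>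
           restr F B C g (s (B, f)) = restr F B' C g' (s (B', f'))"
  show "\<exists>!t. t \<in> carrier (sections F A) \<and> (\<forall>(B, f)\<in>U. restr F A B f t = s (B, f))"
  proof (rule assms(2)[OF A U])
    show "s (B, f) \<in> carrier (sections F B)" if "(B, f) \<in> U" for B f using s that by blast
    fix B f B' f' C g g'
    assume B: "(B, f) \<in> U" and B': "(B', f') \<in> U" and "is_alg_hom k B C g" "is_alg_hom k B' C g'"
      "\<And>x. x \<in> carrier (fst A) \<Longrightarrow> g (f x) = g' (f' x)"
    with bspec[OF bspec[OF comp B, unfolded split_conv] B', unfolded split_conv]
    show "restr F B C g (s (B, f)) = restr F B' C g' (s (B', f'))" by blast
  qed
qed

lemma fppf_sheaf_Gm: "fppf_sheaf k (Gm_times_Gm :: ('k, 'u::infinite, 'u \<times> 'u) group_functor)"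
proof (rule fppf_sheafI)
  let ?F = "Gm_times_Gm :: ('k, 'u, 'u \<times> 'u) group_functor"
  show "group_presheaf k ?F"
    unfolding group_presheaf_def
  proof (intro conjI allI impI; (elim conjE)?)
    show "comm_group (sections ?F A)" if "is_alg k A" for A
      using that by (auto simp: Gm_times_Gm_def is_alg_def comm_group_units_times)
    show "restr ?F A B f \<in> hom (sections ?F A) (sections ?F B)" if "is_alg_hom k A B f" for A B f
      using restr_Gm_hom[OF that] by (simp add: Gm_times_Gm_def)
    show "\<forall>s\<in>carrier (sections ?F A). restr ?F A B f s = restr ?F A B g s"
      if "\<forall>x\<in>carrier (fst A). f x = g x" for A B f g
      using that by (auto simp: Gm_times_Gm_def units_of_def Units_def)
  qed (auto simp: Gm_times_Gm_def)
  fix A :: "('k, 'u) alg" and U s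
  assume A: "is_alg k A" and U: "fppf_covering k A U"
    and s: "\<And>B f. (B, f) \<in> U \<Longrightarrow> s (B, f) \<in> carrier (sections ?F B)"
    and comp: "\<And>B f B' f' C g g'. (B, f) \<in> U \<Longrightarrow> (B', f') \<in> U \<Longrightarrow> is_alg_hom k B C g \<Longrightarrow>
      is_alg_hom k B' C g' \<Longrightarrow> (\<And>x. x \<in> carrier (fst A) \<Longrightarrow> g (f x) = g' (f' x)) \<Longrightarrow>
      restr ?F B C g (s (B, f)) = restr ?F B' C g' (s (B', f'))"
  interpret A: cring "fst A" using A by (simp add: is_alg_def)
  have comp': "g (fst (s (B, f))) = g' (fst (s (B', f')))" "g (snd (s (B, f))) = g' (snd (s (B', f')))"
    if "(B, f) \<in> U" "(B', f') \<in> U" "is_alg_hom k B C g" "is_alg_hom k B' C g'"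
      "\<And>x. x \<in> carrier (fst A) \<Longrightarrow> g (f x) = g' (f' x)" for B f B' f' C g g'
  proof -
    have "map_prod g g (s (B, f)) = map_prod g' g' (s (B', f'))"
      using comp[OF that] by (simp add: Gm_times_Gm_def)
    then show "g (fst (s (B, f))) = g' (fst (s (B', f')))" "g (snd (s (B, f))) = g' (snd (s (B', f')))"
      by (simp_all add: map_prod_def split_beta)
  qed
  have sU: "fst (s (B, f)) \<in> Units (fst B)" "snd (s (B, f)) \<in> Units (fst B)" if "(B, f) \<in> U" for B f
    using s[OF that] by (auto simp: Gm_times_Gm_def units_of_def)
  have "\<exists>a\<in>Units (fst A). \<forall>(B, f)\<in>U. f a = fst (s (B, f))"
    by (rule fppf_glue_Units[where b = "\<lambda>x. fst (s x)", OF A U]) (fact sU comp')+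
  then obtain a1 where a1: "a1 \<in> Units (fst A)" "\<And>B f. (B, f) \<in> U \<Longrightarrow> f a1 = fst (s (B, f))" by blast
  have "\<exists>a\<in>Units (fst A). \<forall>(B, f)\<in>U. f a = snd (s (B, f))"
    by (rule fppf_glue_Units[where b = "\<lambda>x. snd (s x)", OF A U]) (fact sU comp')+
  then obtain a2 where a2: "a2 \<in> Units (fst A)" "\<And>B f. (B, f) \<in> U \<Longrightarrow> f a2 = snd (s (B, f))" by blast
  show "\<exists>!t. t \<in> carrier (sections ?F A) \<and> (\<forall>(B, f)\<in>U. restr ?F A B f t = s (B, f))"
  proof (rule ex1I[of _ "(a1, a2)"])
    show "(a1, a2) \<in> carrier (sections ?F A) \<and> (\<forall>(B, f)\<in>U. restr ?F A B f (a1, a2) = s (B, f))"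
    proof (intro conjI ballI, unfold split_paired_all split_conv)
      show "(a1, a2) \<in> carrier (sections ?F A)"
        using a1(1) a2(1) by (simp add: Gm_times_Gm_def units_of_def)
      fix R h f assume "((R, h), f) \<in> U"
      with a1(2) a2(2) show "restr ?F A (R, h) f (a1, a2) = s ((R, h), f)"
        by (simp add: Gm_times_Gm_def prod_eq_iff)
    qed
    fix t assume t: "t \<in> carrier (sections ?F A) \<and> (\<forall>(B, f)\<in>U. restr ?F A B f t = s (B, f))"
    obtain t1 t2 where tt: "t = (t1, t2)" by (cases t)
    have eq: "f t1 = fst (s (B, f)) \<and> f t2 = snd (s (B, f))" if "(B, f) \<in> U" for B f
    proof -
      have "map_prod f f t = s (B, f)"
        using bspec[OF conjunct2[OF t] that] by (simp add: Gm_times_Gm_def)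
      then show ?thesis by (simp add: tt flip: \<open>map_prod f f t = s (B, f)\<close>)
    qed
    have "t1 \<in> carrier (fst A)" "t2 \<in> carrier (fst A)"
      using conjunct1[OF t] by (auto simp: tt Gm_times_Gm_def units_of_def)
    moreover have "a1 \<in> carrier (fst A)" "a2 \<in> carrier (fst A)" using a1(1) a2(1) by auto
    moreover have "f t1 = f a1" "f t2 = f a2" if "(B, f) \<in> U" for B f
      by (simp_all only: eq[OF that] a1(2)[OF that] a2(2)[OF that])
    ultimately have "t1 = a1" "t2 = a2"
      by (rule_tac [!] fppf_separated[OF A U])
    then show "t = (a1, a2)" by (simp add: tt)
  qed
qed

lemma isomorphic_over_Gm_power:
  fixes A :: "('k, 'u) alg" shows "isomorphic_over k A Gm_times_Gm (Gm_power 2)"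
  unfolding isomorphic_over_def
proof (intro exI conjI allI impI ballI; (elim conjE)?)
  let ?m = "\<lambda>C h (x, y). \<lambda>i\<in>{..<2::nat}. if i = 0 then x else y :: 'u"
  fix C :: "('k, 'u) alg" and h assume C: "is_alg_hom k A C h"
  show "?m C h \<in> iso (sections Gm_times_Gm C) (sections (Gm_power 2) C)"
    unfolding iso_def bij_betw_def
  proof (intro CollectI conjI)
    show "?m C h \<in> hom (sections Gm_times_Gm C) (sections (Gm_power 2) C)"
    proof (rule homI)
      fix x y assume "x \<in> carrier (sections Gm_times_Gm C)" "y \<in> carrier (sections Gm_times_Gm C)"
      then show "?m C h x \<in> carrier (sections (Gm_power 2) C)"
        by (auto simp: Gm_times_Gm_def Gm_power_def split: if_splits)
      show "?m C h (x \<otimes>\<^bsub>sections Gm_times_Gm C\<^esub> y) = ?m C h x \<otimes>\<^bsub>sections (Gm_power 2) C\<^esub> ?m C h y"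
        by (cases x; cases y) (auto simp: Gm_times_Gm_def Gm_power_def fun_eq_iff)
    qed
    show "inj_on (?m C h) (carrier (sections Gm_times_Gm C))"
      by (auto simp: inj_on_def fun_eq_iff restrict_def split: if_splits dest: spec[of _ 0] spec[of _ 1])
    show "?m C h ` carrier (sections Gm_times_Gm C) = carrier (sections (Gm_power 2) C)"
    proof (intro equalityI subsetI)
      fix x assume x: "x \<in> carrier (sections (Gm_power 2 :: ('k, 'u, _) group_functor) C)"
      have "x = ?m C h (x 0, x 1)"
        using x by (auto simp: Gm_power_def fun_eq_iff restrict_def PiE_def extensional_def less_2_cases_iff)
      moreover have "(x 0, x 1) \<in> carrier (sections Gm_times_Gm C)"
        using x by (auto simp: Gm_power_def Gm_times_Gm_def PiE_def Pi_def)
      ultimately show "x \<in> ?m C h ` carrier (sections Gm_times_Gm C)" by blast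
    qed (auto simp: Gm_times_Gm_def Gm_power_def split: if_splits)
  qed
next
  fix C D :: "('k, 'u) alg" and h g and s :: "'u \<times> 'u"
  show "(case restr Gm_times_Gm C D g s of (x, y) \<Rightarrow> \<lambda>i\<in>{..<2::nat}. if i = 0 then x else y) =
      restr (Gm_power 2) C D g (case s of (x, y) \<Rightarrow> \<lambda>i\<in>{..<2::nat}. if i = 0 then x else y)"
    by (auto simp: Gm_times_Gm_def Gm_power_def fun_eq_iff restrict_def split: prod.splits)
qed

lemma torus_Gm: "torus k (Gm_times_Gm :: ('k, 'u::infinite, 'u \<times> 'u) group_functor)"
  unfolding torus_def using fppf_sheaf_Gm fppf_covering_id isomorphic_over_Gm_power by fast

text \<open>In \<open>extension_of_by\<close> the quotient has its sections in \<open>'u\<close>, so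
  a zero sheaf is required on a one-point set in any type and not only on
  \<open>unit\<close>.\<close>

definition trivial_sheaf :: "'s \<Rightarrow> ('k, 'u, 's) group_functor" where
  "trivial_sheaf z = \<lparr>sections = (\<lambda>A. singleton_group z), restr = (\<lambda>A B f s. s)\<rparr>"

lemma zero_sheaf_eq_trivial: "zero_sheaf = trivial_sheaf ()"
  by (simp add: zero_sheaf_def trivial_sheaf_def)

lemma fppf_sheaf_trivial: "fppf_sheaf k (trivial_sheaf z)"
  unfolding fppf_sheaf_def group_presheaf_def
  by (auto simp: trivial_sheaf_def hom_def singleton_group_def intro!: comm_groupI)

text \<open>The extension 0 \<rightarrow> F \<rightarrow> F \<rightarrow> 0 \<rightarrow> 0. It is
  the exact sequence of a diagram with zero abelian part, and it also exhibits a finite flat Y and a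
  torus X as extensions of the permitted kind.\<close>

lemma short_exact_id_trivial:
  fixes F :: "('k, 'u, 's) group_functor"
  assumes F: "fppf_sheaf k F"
  shows "short_exact k F (\<lambda>A x. x) F (\<lambda>A x. z) (trivial_sheaf z)"
  unfolding short_exact_def
proof (intro conjI allI impI ballI)
  fix A :: "('k, 'u) alg" and h assume A: "is_alg k A" and h: "h \<in> carrier (sections (trivial_sheaf z) A)"
  have "comm_group (sections F A)" 
    using F[unfolded fppf_sheaf_def] A by (intro group_presheafD(1)[of k F]) (rule conjunct1)
  then interpret comm_group "sections F A" .
  have "h = z" using h by (simp add: trivial_sheaf_def singleton_group_def)
  then show "\<exists>U. fppf_covering k A U \<and>
      (\<forall>(B, f)\<in>U. restr (trivial_sheaf z) A B f h \<in> (\<lambda>x. z) ` carrier (sections F B))"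
    by (intro exI[of _ "{(A, id)}"]) (auto simp: trivial_sheaf_def fppf_covering_id[OF A] intro: imageI[OF one_closed])
next
  show "fppf_sheaf k (trivial_sheaf z :: ('k, 'u, _) group_functor)" by (rule fppf_sheaf_trivial)
qed (use F in \<open>auto simp: sheaf_hom_def trivial_sheaf_def singleton_group_def hom_def kernel_def\<close>)

section \<open>Constant group schemes\<close>

locale constant_section_group = R: cring R + G: comm_group G
  for R :: "'u ring" and G :: "'g monoid"
begin

abbreviation S where "S \<equiv> constant_sections G R"

definition support :: "('g \<Rightarrow> 'u) \<Rightarrow> 'g set" where "support e = {g. e g \<noteq> \<zero>\<^bsub>R\<^esub>}"

text \<open>
  \<open>t\<close> lies in the part of \<open>Spec R\<close> on which the section \<open>e\<close> has the constant value \<open>p\<close>.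
\<close>

definition has_value :: "('g \<Rightarrow> 'u) \<Rightarrow> 'u \<Rightarrow> 'g \<Rightarrow> bool" where
  "has_value e t p \<longleftrightarrow> p \<in> carrier G \<and> e p \<otimes>\<^bsub>R\<^esub> t = t"

text \<open>A set whose elements together see all of Spec R: an identity in R holds as soon as it
  holds after multiplication by each of them. Multiplication by such elements takes the place of
  passing to the pieces of a decomposition.\<close>

definition detecting :: "'u set \<Rightarrow> bool" where
  "detecting X \<longleftrightarrow> X \<subseteq> carrier R \<and>
     (\<forall>x\<in>carrier R. (\<forall>t\<in>X. x \<otimes>\<^bsub>R\<^esub> t = \<zero>\<^bsub>R\<^esub>) \<longrightarrow> x = \<zero>\<^bsub>R\<^esub>)"

text \<open>The element of R that equals \<open>u g\<close> on the piece where \<open>e\<close> has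
  the value g. Convolution of sections, the inclusion into the torus and the maps out of a
  representing algebra are all of this form.\<close>

definition evaluate :: "('g \<Rightarrow> 'u) \<Rightarrow> ('g \<Rightarrow> 'u) \<Rightarrow> 'u" where
  "evaluate e u = (\<Oplus>\<^bsub>R\<^esub>g\<in>support e. e g \<otimes>\<^bsub>R\<^esub> u g)"

lemma in_S_iff:
  "e \<in> carrier S \<longleftrightarrow> (\<forall>g. e g \<in> carrier R) \<and> (\<forall>g. g \<notin> carrier G \<longrightarrow> e g = \<zero>\<^bsub>R\<^esub>) \<and>
     finite (support e) \<and> (\<forall>g h. g \<noteq> h \<longrightarrow> e g \<otimes>\<^bsub>R\<^esub> e h = \<zero>\<^bsub>R\<^esub>) \<and> (\<Oplus>\<^bsub>R\<^esub>g\<in>support e. e g) = \<one>\<^bsub>R\<^esub>"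
  by (simp add: constant_sections_def support_def)

lemma S_closed [simp]: "e \<in> carrier S \<Longrightarrow> e g \<in> carrier R"
  and S_outside: "e \<in> carrier S \<Longrightarrow> g \<notin> carrier G \<Longrightarrow> e g = \<zero>\<^bsub>R\<^esub>"
  and S_finite: "e \<in> carrier S \<Longrightarrow> finite (support e)"
  and S_orthogonal: "e \<in> carrier S \<Longrightarrow> g \<noteq> h \<Longrightarrow> e g \<otimes>\<^bsub>R\<^esub> e h = \<zero>\<^bsub>R\<^esub>"
  and S_sum: "e \<in> carrier S \<Longrightarrow> (\<Oplus>\<^bsub>R\<^esub>g\<in>support e. e g) = \<one>\<^bsub>R\<^esub>"
  by (simp_all add: in_S_iff)

lemma support_subset: "e \<in> carrier S \<Longrightarrow> support e \<subseteq> carrier G"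
  using S_outside by (auto simp: support_def)

lemma S_mult: "e \<otimes>\<^bsub>S\<^esub> e' = (\<lambda>g. if g \<in> carrier G then evaluate e (\<lambda>h. e' (inv\<^bsub>G\<^esub> h \<otimes>\<^bsub>G\<^esub> g)) else \<zero>\<^bsub>R\<^esub>)"
  unfolding constant_sections_def evaluate_def support_def monoid.simps ..

lemma S_one: "\<one>\<^bsub>S\<^esub> = (\<lambda>g. if g = \<one>\<^bsub>G\<^esub> then \<one>\<^bsub>R\<^esub> else \<zero>\<^bsub>R\<^esub>)"
  unfolding constant_sections_def monoid.simps ..

lemma finsum_single:
  assumes "finite F" "\<And>g. g \<in> F \<Longrightarrow> x g \<in> carrier R" "\<And>g. g \<in> F \<Longrightarrow> g \<noteq> p \<Longrightarrow> x g = \<zero>\<^bsub>R\<^esub>"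
    and "p \<notin> F \<Longrightarrow> y = \<zero>\<^bsub>R\<^esub>" "p \<in> F \<Longrightarrow> x p = y"
  shows "(\<Oplus>\<^bsub>R\<^esub>g\<in>F. x g) = y"
proof (cases "p \<in> F")
  case True
  have "(\<Oplus>\<^bsub>R\<^esub>g\<in>insert p (F - {p}). x g) = x p \<oplus>\<^bsub>R\<^esub> (\<Oplus>\<^bsub>R\<^esub>g\<in>F - {p}. x g)"
    using assms True by (intro R.finsum_insert) auto
  also have "(\<Oplus>\<^bsub>R\<^esub>g\<in>F - {p}. x g) = \<zero>\<^bsub>R\<^esub>"
    using assms by (intro R.add.finprod_one_eqI) auto
  finally show ?thesis using True assms(2)[OF True] assms(5)[OF True] by (simp add: insert_absorb)
next
  case False
  have "(\<Oplus>\<^bsub>R\<^esub>g\<in>F. x g) = \<zero>\<^bsub>R\<^esub>"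
    using False assms(3) by (intro R.add.finprod_one_eqI) metis
  then show ?thesis using False assms(4) by simp
qed

lemma evaluate_closed [simp]:
  assumes "e \<in> carrier S" "\<And>g. g \<in> carrier G \<Longrightarrow> u g \<in> carrier R"
  shows "evaluate e u \<in> carrier R"
  unfolding evaluate_def using assms support_subset[OF assms(1)] by (intro R.finsum_closed) auto

lemma has_value_zero:
  assumes e: "e \<in> carrier S" and v: "has_value e t p" and "g \<noteq> p" and t: "t \<in> carrier R"
  shows "e g \<otimes>\<^bsub>R\<^esub> t = \<zero>\<^bsub>R\<^esub>"
proof -
  have "e g \<otimes>\<^bsub>R\<^esub> (e p \<otimes>\<^bsub>R\<^esub> t) = \<zero>\<^bsub>R\<^esub>"
    using S_orthogonal[OF e \<open>g \<noteq> p\<close>] e t by (simp flip: R.m_assoc)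
  then show ?thesis using v by (simp add: has_value_def)
qed

text \<open>On a piece where \<open>e\<close> has the value p, orthogonality leaves only the term
  with index p.\<close>

lemma evaluate_at:
  assumes e: "e \<in> carrier S" and v: "has_value e t p" and t: "t \<in> carrier R"
    and u: "\<And>g. g \<in> carrier G \<Longrightarrow> u g \<in> carrier R"
  shows "evaluate e u \<otimes>\<^bsub>R\<^esub> t = u p \<otimes>\<^bsub>R\<^esub> t"
proof -
  have sub: "g \<in> carrier G" if "g \<in> support e" for g using support_subset[OF e] that by blast
  have p: "p \<in> carrier G" "e p \<otimes>\<^bsub>R\<^esub> t = t" using v by (auto simp: has_value_def)
  have "evaluate e u \<otimes>\<^bsub>R\<^esub> t = (\<Oplus>\<^bsub>R\<^esub>g\<in>support e. e g \<otimes>\<^bsub>R\<^esub> u g \<otimes>\<^bsub>R\<^esub> t)"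
    unfolding evaluate_def using e t u sub S_finite by (intro R.finsum_ldistr) auto
  also have "\<dots> = u p \<otimes>\<^bsub>R\<^esub> t"
  proof (rule finsum_single[of _ _ p])
    fix g assume g: "g \<in> support e"
    have eq: "e g \<otimes>\<^bsub>R\<^esub> u g \<otimes>\<^bsub>R\<^esub> t = u g \<otimes>\<^bsub>R\<^esub> (e g \<otimes>\<^bsub>R\<^esub> t)"
      using e t u[OF sub[OF g]] by (simp add: R.m_ac)
    show "e g \<otimes>\<^bsub>R\<^esub> u g \<otimes>\<^bsub>R\<^esub> t \<in> carrier R" using e t u[OF sub[OF g]] by simp
    show "e g \<otimes>\<^bsub>R\<^esub> u g \<otimes>\<^bsub>R\<^esub> t = \<zero>\<^bsub>R\<^esub>" if "g \<noteq> p"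
      unfolding eq using has_value_zero[OF e v that t] u[OF sub[OF g]] by simp
  next
    show "e p \<otimes>\<^bsub>R\<^esub> u p \<otimes>\<^bsub>R\<^esub> t = u p \<otimes>\<^bsub>R\<^esub> t"
      using e t u[OF p(1)] p(2) by (simp add: R.m_assoc R.m_lcomm[of "e p"])
    assume "p \<notin> support e"
    then have "t = \<zero>\<^bsub>R\<^esub>" using p(2) t by (simp add: support_def)
    then show "u p \<otimes>\<^bsub>R\<^esub> t = \<zero>\<^bsub>R\<^esub>" using u[OF p(1)] by simp
  qed (use S_finite[OF e] in auto)
  finally show ?thesis .
qed

lemma detecting_eq:
  assumes "detecting X" "x \<in> carrier R" "y \<in> carrier R" "\<And>t. t \<in> X \<Longrightarrow> x \<otimes>\<^bsub>R\<^esub> t = y \<otimes>\<^bsub>R\<^esub> t"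
  shows "x = y"
proof -
  have "x \<ominus>\<^bsub>R\<^esub> y = \<zero>\<^bsub>R\<^esub>"
  proof -
    have "(x \<ominus>\<^bsub>R\<^esub> y) \<otimes>\<^bsub>R\<^esub> t = \<zero>\<^bsub>R\<^esub>" if "t \<in> X" for t
    proof -
      have t: "t \<in> carrier R" using that assms(1) by (auto simp: detecting_def)
      then have "(x \<ominus>\<^bsub>R\<^esub> y) \<otimes>\<^bsub>R\<^esub> t = x \<otimes>\<^bsub>R\<^esub> t \<ominus>\<^bsub>R\<^esub> y \<otimes>\<^bsub>R\<^esub> t"
        using assms(2,3) by (simp add: R.minus_eq R.l_distr R.l_minus)
      then show ?thesis using assms(4)[OF that] t assms(3) by (simp add: R.minus_eq R.r_neg)
    qed
    then show ?thesis using assms(1,2,3) by (simp add: detecting_def)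
  qed
  then show ?thesis using assms(2,3) by (metis R.r_right_minus_eq)
qed

text \<open>An element killed by all parts of a partition of unity is killed by their sum 1.\<close>

lemma detecting_section:
  assumes e: "e \<in> carrier S" shows "detecting (e ` carrier G)"
  unfolding detecting_def
proof (intro conjI ballI impI)
  fix x assume x: "x \<in> carrier R" and z: "\<forall>t\<in>e ` carrier G. x \<otimes>\<^bsub>R\<^esub> t = \<zero>\<^bsub>R\<^esub>"
  have "x = x \<otimes>\<^bsub>R\<^esub> (\<Oplus>\<^bsub>R\<^esub>g\<in>support e. e g)" using S_sum[OF e] x by simp
  also have "\<dots> = (\<Oplus>\<^bsub>R\<^esub>g\<in>support e. x \<otimes>\<^bsub>R\<^esub> e g)"
    using S_finite[OF e] e x by (intro R.finsum_rdistr) auto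
  also have "\<dots> = \<zero>\<^bsub>R\<^esub>" using z support_subset[OF e] by (intro R.add.finprod_one_eqI) auto
  finally show "x = \<zero>\<^bsub>R\<^esub>" .
qed (use e in auto)

lemma detecting_mult:
  assumes X: "detecting X" and Y: "detecting Y"
  shows "detecting {x \<otimes>\<^bsub>R\<^esub> y | x y. x \<in> X \<and> y \<in> Y}"
proof -
  have XY: "X \<subseteq> carrier R" "Y \<subseteq> carrier R" using X Y by (auto simp: detecting_def)
  have "z = \<zero>\<^bsub>R\<^esub>" if z: "z \<in> carrier R" "\<forall>t\<in>{x \<otimes>\<^bsub>R\<^esub> y | x y. x \<in> X \<and> y \<in> Y}. z \<otimes>\<^bsub>R\<^esub> t = \<zero>\<^bsub>R\<^esub>" for z
  proof -
    have "z \<otimes>\<^bsub>R\<^esub> x = \<zero>\<^bsub>R\<^esub>" if x: "x \<in> X" for x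
    proof -
      have "z \<otimes>\<^bsub>R\<^esub> x \<otimes>\<^bsub>R\<^esub> y = \<zero>\<^bsub>R\<^esub>" if "y \<in> Y" for y
      proof -
        have "x \<otimes>\<^bsub>R\<^esub> y \<in> {x \<otimes>\<^bsub>R\<^esub> y | x y. x \<in> X \<and> y \<in> Y}" using x that by blast
        with z(2) have "z \<otimes>\<^bsub>R\<^esub> (x \<otimes>\<^bsub>R\<^esub> y) = \<zero>\<^bsub>R\<^esub>" by (rule bspec)
        moreover have "x \<in> carrier R" "y \<in> carrier R" using x that XY by auto
        ultimately show ?thesis using z(1) by (simp add: R.m_assoc)
      qed
      then show ?thesis using Y z(1) x XY by (auto simp: detecting_def)
    qed
    then show ?thesis using X z(1) by (simp add: detecting_def)
  qed
  then show ?thesis using XY by (auto simp: detecting_def)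
qed

text \<open>This is the idempotency of \<open>e g\<close>: multiply the partition of unity by
  \<open>e g\<close> and drop the orthogonal terms.\<close>

lemma has_value_self: "e \<in> carrier S \<Longrightarrow> g \<in> carrier G \<Longrightarrow> has_value e (e g) g"
proof -
  assume e: "e \<in> carrier S" and g: "g \<in> carrier G"
  have "e g = (\<Oplus>\<^bsub>R\<^esub>h\<in>support e. e h) \<otimes>\<^bsub>R\<^esub> e g" using S_sum[OF e] e by simp
  also have "\<dots> = (\<Oplus>\<^bsub>R\<^esub>h\<in>support e. e h \<otimes>\<^bsub>R\<^esub> e g)"
    using S_finite[OF e] e by (intro R.finsum_ldistr) auto
  also have "\<dots> = e g \<otimes>\<^bsub>R\<^esub> e g"
    using S_finite[OF e] e S_orthogonal[OF e] by (intro finsum_single[of _ _ g]) (auto simp: support_def)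
  finally show "has_value e (e g) g" using g by (simp add: has_value_def)
qed

lemma has_value_mult1:
  "has_value e t p \<Longrightarrow> e \<in> carrier S \<Longrightarrow> t \<in> carrier R \<Longrightarrow> s \<in> carrier R \<Longrightarrow> has_value e (t \<otimes>\<^bsub>R\<^esub> s) p"
  by (simp add: has_value_def flip: R.m_assoc)

lemma has_value_mult2:
  "has_value e t p \<Longrightarrow> e \<in> carrier S \<Longrightarrow> t \<in> carrier R \<Longrightarrow> s \<in> carrier R \<Longrightarrow> has_value e (s \<otimes>\<^bsub>R\<^esub> t) p"
  using has_value_mult1[of e t p s] by (simp add: R.m_comm)

text \<open>Orthogonality and sum 1 are identities in R, so they may be tested on a detecting set,
  where \<open>w\<close> reduces to the indicator of one group element.\<close>

lemma S_memI:
  assumes X: "detecting X" and w: "\<And>g. w g \<in> carrier R" "\<And>g. g \<notin> carrier G \<Longrightarrow> w g = \<zero>\<^bsub>R\<^esub>"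
    and fin: "finite (support w)"
    and val: "\<And>t. t \<in> X \<Longrightarrow> \<exists>p\<in>carrier G. \<forall>g. w g \<otimes>\<^bsub>R\<^esub> t = (if g = p then t else \<zero>\<^bsub>R\<^esub>)"
  shows "w \<in> carrier S"
  unfolding in_S_iff
proof (intro conjI allI impI w fin)
  have Xc: "t \<in> carrier R" if "t \<in> X" for t using X that by (auto simp: detecting_def)
  fix g h :: 'g assume gh: "g \<noteq> h"
  show "w g \<otimes>\<^bsub>R\<^esub> w h = \<zero>\<^bsub>R\<^esub>"
  proof (rule detecting_eq[OF X])
    fix t assume t: "t \<in> X"
    obtain p where p: "\<forall>g. w g \<otimes>\<^bsub>R\<^esub> t = (if g = p then t else \<zero>\<^bsub>R\<^esub>)" using val[OF t] by blast
    have "w g \<otimes>\<^bsub>R\<^esub> w h \<otimes>\<^bsub>R\<^esub> t = w g \<otimes>\<^bsub>R\<^esub> (w h \<otimes>\<^bsub>R\<^esub> t)" using w Xc[OF t] by (simp add: R.m_assoc)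
    also have "\<dots> = \<zero>\<^bsub>R\<^esub>" using p gh w by auto
    finally show "w g \<otimes>\<^bsub>R\<^esub> w h \<otimes>\<^bsub>R\<^esub> t = \<zero>\<^bsub>R\<^esub> \<otimes>\<^bsub>R\<^esub> t" using Xc[OF t] by simp
  qed (use w in auto)
next
  have Xc: "t \<in> carrier R" if "t \<in> X" for t using X that by (auto simp: detecting_def)
  show "(\<Oplus>\<^bsub>R\<^esub>g\<in>support w. w g) = \<one>\<^bsub>R\<^esub>"
  proof (rule detecting_eq[OF X])
    fix t assume t: "t \<in> X"
    obtain p where p: "\<forall>g. w g \<otimes>\<^bsub>R\<^esub> t = (if g = p then t else \<zero>\<^bsub>R\<^esub>)" using val[OF t] by blast
    have "(\<Oplus>\<^bsub>R\<^esub>g\<in>support w. w g) \<otimes>\<^bsub>R\<^esub> t = (\<Oplus>\<^bsub>R\<^esub>g\<in>support w. w g \<otimes>\<^bsub>R\<^esub> t)"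
      using w Xc[OF t] fin by (intro R.finsum_ldistr) auto
    also have "\<dots> = t"
    proof (rule finsum_single[of _ _ p])
      assume "p \<notin> support w"
      then have "w p \<otimes>\<^bsub>R\<^esub> t = \<zero>\<^bsub>R\<^esub>" using Xc[OF t] by (simp add: support_def)
      then show "t = \<zero>\<^bsub>R\<^esub>" using p by simp
    qed (use p fin Xc[OF t] in auto)
    finally show "(\<Oplus>\<^bsub>R\<^esub>g\<in>support w. w g) \<otimes>\<^bsub>R\<^esub> t = \<one>\<^bsub>R\<^esub> \<otimes>\<^bsub>R\<^esub> t" using Xc[OF t] by simp
  qed (use w in \<open>auto intro!: R.finsum_closed\<close>)
qed

text \<open>A section is determined by its values on the pieces of any decomposition on which it is
  constant. This turns the group laws for sections into the group laws of G.\<close>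

lemma S_eqI:
  assumes X: "detecting X" and e: "e \<in> carrier S" "e' \<in> carrier S"
    and val: "\<And>t. t \<in> X \<Longrightarrow> \<exists>p. has_value e t p \<and> has_value e' t p"
  shows "e = e'"
proof
  fix g show "e g = e' g"
  proof (rule detecting_eq[OF X])
    fix t assume t: "t \<in> X"
    then have tc: "t \<in> carrier R" using X by (auto simp: detecting_def)
    obtain p where p: "has_value e t p" "has_value e' t p" using val[OF t] by blast
    show "e g \<otimes>\<^bsub>R\<^esub> t = e' g \<otimes>\<^bsub>R\<^esub> t"
      using has_value_zero[OF e(1) p(1) _ tc, of g] has_value_zero[OF e(2) p(2) _ tc, of g] p
      by (cases "g = p") (auto simp: has_value_def)
  qed (use e in auto)
qed

text \<open>Where both factors are constant, the convolution collapses to \<open>e'\<close> at the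
  quotient of g by p, which is the indicator of g being the product of p and q.\<close>

lemma mult_at:
  assumes e: "e \<in> carrier S" "e' \<in> carrier S" and v: "has_value e t p" "has_value e' t q"
    and t: "t \<in> carrier R"
  shows "(e \<otimes>\<^bsub>S\<^esub> e') g \<otimes>\<^bsub>R\<^esub> t = (if g = p \<otimes>\<^bsub>G\<^esub> q then t else \<zero>\<^bsub>R\<^esub>)"
proof (cases "g \<in> carrier G")
  case True
  have pq: "p \<in> carrier G" "q \<in> carrier G" using v by (auto simp: has_value_def)
  have "(e \<otimes>\<^bsub>S\<^esub> e') g \<otimes>\<^bsub>R\<^esub> t = e' (inv\<^bsub>G\<^esub> p \<otimes>\<^bsub>G\<^esub> g) \<otimes>\<^bsub>R\<^esub> t"
    using True evaluate_at[OF e(1) v(1) t, of "\<lambda>h. e' (inv\<^bsub>G\<^esub> h \<otimes>\<^bsub>G\<^esub> g)"] e by (simp add: S_mult)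
  also have "\<dots> = (if g = p \<otimes>\<^bsub>G\<^esub> q then t else \<zero>\<^bsub>R\<^esub>)"
  proof (cases "g = p \<otimes>\<^bsub>G\<^esub> q")
    case True
    then show ?thesis using v(2) pq by (simp add: has_value_def flip: G.m_assoc)
  next
    case False
    then have "inv\<^bsub>G\<^esub> p \<otimes>\<^bsub>G\<^esub> g \<noteq> q" using True pq by (metis G.inv_solve_left')
    then show ?thesis using has_value_zero[OF e(2) v(2) _ t] False by simp
  qed
  finally show ?thesis .
next
  case False
  moreover have "p \<otimes>\<^bsub>G\<^esub> q \<in> carrier G" using v by (auto simp: has_value_def)
  ultimately show ?thesis using t by (auto simp: S_mult)
qed

lemma has_value_mult:
  assumes "e \<in> carrier S" "e' \<in> carrier S" "has_value e t p" "has_value e' t q" "t \<in> carrier R"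
  shows "has_value (e \<otimes>\<^bsub>S\<^esub> e') t (p \<otimes>\<^bsub>G\<^esub> q)"
  using mult_at[OF assms] assms(3,4) by (auto simp: has_value_def)

text \<open>The pieces of the common refinement of two decompositions; both sections are constant on
  each of them.\<close>

definition common :: "('g \<Rightarrow> 'u) \<Rightarrow> ('g \<Rightarrow> 'u) \<Rightarrow> 'u set" where
  "common e e' = {x \<otimes>\<^bsub>R\<^esub> y | x y. x \<in> e ` carrier G \<and> y \<in> e' ` carrier G}"

lemma detecting_common: "e \<in> carrier S \<Longrightarrow> e' \<in> carrier S \<Longrightarrow> detecting (common e e')"
  unfolding common_def by (intro detecting_mult detecting_section)

lemma commonE:
  assumes "t \<in> common e e'" "e \<in> carrier S" "e' \<in> carrier S"
  obtains p q where "has_value e t p" "has_value e' t q" "t \<in> carrier R" "t = e p \<otimes>\<^bsub>R\<^esub> e' q"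
    "p \<in> carrier G" "q \<in> carrier G"
proof -
  obtain p q where pq: "p \<in> carrier G" "q \<in> carrier G" "t = e p \<otimes>\<^bsub>R\<^esub> e' q"
    using assms(1) by (auto simp: common_def)
  show ?thesis
    by (rule that[of p q])
      (use pq assms has_value_mult1[OF has_value_self] has_value_mult2[OF has_value_self] in auto)
qed

lemma S_mult_closed:
  assumes e: "e \<in> carrier S" "e' \<in> carrier S" shows "e \<otimes>\<^bsub>S\<^esub> e' \<in> carrier S"
proof (rule S_memI[OF detecting_common[OF e]])
  have car: "evaluate e (\<lambda>h. e' (inv\<^bsub>G\<^esub> h \<otimes>\<^bsub>G\<^esub> g)) \<in> carrier R" for g using e by simp
  then show "(e \<otimes>\<^bsub>S\<^esub> e') g \<in> carrier R" for g by (simp add: S_mult)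
  show "(e \<otimes>\<^bsub>S\<^esub> e') g = \<zero>\<^bsub>R\<^esub>" if "g \<notin> carrier G" for g using that by (simp add: S_mult)
  have "support (e \<otimes>\<^bsub>S\<^esub> e') \<subseteq> (\<lambda>(h, k). h \<otimes>\<^bsub>G\<^esub> k) ` (support e \<times> support e')"
  proof
    fix g assume g: "g \<in> support (e \<otimes>\<^bsub>S\<^esub> e')"
    then have gc: "g \<in> carrier G" by (auto simp: support_def S_mult split: if_splits)
    have "\<exists>h\<in>support e. e h \<otimes>\<^bsub>R\<^esub> e' (inv\<^bsub>G\<^esub> h \<otimes>\<^bsub>G\<^esub> g) \<noteq> \<zero>\<^bsub>R\<^esub>"
    proof (rule ccontr)
      assume "\<not> ?thesis"
      then have "evaluate e (\<lambda>h. e' (inv\<^bsub>G\<^esub> h \<otimes>\<^bsub>G\<^esub> g)) = \<zero>\<^bsub>R\<^esub>"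
        unfolding evaluate_def by (intro R.add.finprod_one_eqI) auto
      then show False using g gc by (simp add: support_def S_mult)
    qed
    then obtain h where h: "h \<in> support e" "e h \<otimes>\<^bsub>R\<^esub> e' (inv\<^bsub>G\<^esub> h \<otimes>\<^bsub>G\<^esub> g) \<noteq> \<zero>\<^bsub>R\<^esub>" by blast
    then have "inv\<^bsub>G\<^esub> h \<otimes>\<^bsub>G\<^esub> g \<in> support e'" using e by (auto simp: support_def)
    moreover have "h \<otimes>\<^bsub>G\<^esub> (inv\<^bsub>G\<^esub> h \<otimes>\<^bsub>G\<^esub> g) = g"
      using h support_subset[OF e(1)] gc by (auto simp flip: G.m_assoc)
    ultimately show "g \<in> (\<lambda>(h, k). h \<otimes>\<^bsub>G\<^esub> k) ` (support e \<times> support e')" using h(1) by force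
  qed
  then show "finite (support (e \<otimes>\<^bsub>S\<^esub> e'))"
    by (rule finite_subset) (use S_finite e in auto)
  fix t assume "t \<in> common e e'"
  then obtain p q where v: "has_value e t p" "has_value e' t q" "t \<in> carrier R" "p \<in> carrier G" "q \<in> carrier G"
    by (rule commonE) (use e in auto)
  then show "\<exists>p\<in>carrier G. \<forall>g. (e \<otimes>\<^bsub>S\<^esub> e') g \<otimes>\<^bsub>R\<^esub> t = (if g = p then t else \<zero>\<^bsub>R\<^esub>)"
    using mult_at[OF e v(1-3)] by (intro bexI[of _ "p \<otimes>\<^bsub>G\<^esub> q"]) auto
qed

lemma detecting_one: "detecting {\<one>\<^bsub>R\<^esub>}" by (simp add: detecting_def)

lemma S_one_closed: "\<one>\<^bsub>S\<^esub> \<in> carrier S"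
  by (rule S_memI[OF detecting_one])
    (auto simp: S_one support_def intro: finite_subset[of _ "{\<one>\<^bsub>G\<^esub>}"])

lemma has_value_one: "t \<in> carrier R \<Longrightarrow> has_value \<one>\<^bsub>S\<^esub> t \<one>\<^bsub>G\<^esub>"
  by (simp add: has_value_def S_one)

definition inverse_section :: "('g \<Rightarrow> 'u) \<Rightarrow> 'g \<Rightarrow> 'u" where
  "inverse_section e g = (if g \<in> carrier G then e (inv\<^bsub>G\<^esub> g) else \<zero>\<^bsub>R\<^esub>)"

lemma inverse_section_closed:
  assumes e: "e \<in> carrier S" shows "inverse_section e \<in> carrier S"
proof (rule S_memI[OF detecting_section[OF e]])
  have "support (inverse_section e) \<subseteq> (\<lambda>g. inv\<^bsub>G\<^esub> g) ` support e"
  proof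
    fix g assume "g \<in> support (inverse_section e)"
    then have "g \<in> carrier G" "inv\<^bsub>G\<^esub> g \<in> support e"
      by (auto simp: support_def inverse_section_def split: if_splits)
    then show "g \<in> (\<lambda>g. inv\<^bsub>G\<^esub> g) ` support e" by (intro image_eqI[of _ _ "inv\<^bsub>G\<^esub> g"]) simp_all
  qed
  then show "finite (support (inverse_section e))" by (rule finite_subset) (use S_finite[OF e] in auto)
  fix t assume "t \<in> e ` carrier G"
  then obtain p where p: "p \<in> carrier G" "t = e p" by blast
  have "inverse_section e g \<otimes>\<^bsub>R\<^esub> t = (if g = inv\<^bsub>G\<^esub> p then t else \<zero>\<^bsub>R\<^esub>)" for g
  proof (cases "g = inv\<^bsub>G\<^esub> p")
    case True
    then show ?thesis using has_value_self[OF e p(1)] p by (simp add: inverse_section_def has_value_def)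
  next
    case False
    show ?thesis
    proof (cases "g \<in> carrier G")
      case True
      then have "inv\<^bsub>G\<^esub> g \<noteq> p" using False by auto
      from S_orthogonal[OF e this] show ?thesis using False True p by (simp add: inverse_section_def)
    next
      case not: False
      have "t \<in> carrier R" using p(2) e by simp
      then show ?thesis using False not by (simp add: inverse_section_def)
    qed
  qed
  then show "\<exists>p\<in>carrier G. \<forall>g. inverse_section e g \<otimes>\<^bsub>R\<^esub> t = (if g = p then t else \<zero>\<^bsub>R\<^esub>)"
    using p by (intro bexI[of _ "inv\<^bsub>G\<^esub> p"]) auto
qed (use e in \<open>auto simp: inverse_section_def\<close>)

lemma has_value_inverse: "e \<in> carrier S \<Longrightarrow> has_value e t p \<Longrightarrow> has_value (inverse_section e) t (inv\<^bsub>G\<^esub> p)"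
  by (auto simp: has_value_def inverse_section_def)

lemma comm_group_S: "comm_group S"
proof (rule comm_groupI)
  fix x y assume xy: "x \<in> carrier S" "y \<in> carrier S"
  show "x \<otimes>\<^bsub>S\<^esub> y \<in> carrier S" by (rule S_mult_closed[OF xy])
  show "x \<otimes>\<^bsub>S\<^esub> y = y \<otimes>\<^bsub>S\<^esub> x"
  proof (rule S_eqI[OF detecting_common[OF xy]])
    fix t assume "t \<in> common x y"
    then obtain p q where v: "has_value x t p" "has_value y t q" "t \<in> carrier R" "p \<in> carrier G" "q \<in> carrier G"
      by (rule commonE) (use xy in auto)
    show "\<exists>p. has_value (x \<otimes>\<^bsub>S\<^esub> y) t p \<and> has_value (y \<otimes>\<^bsub>S\<^esub> x) t p"
      using has_value_mult[OF xy v(1,2,3)] has_value_mult[OF xy(2,1) v(2,1,3)] G.m_comm[OF v(4,5)] by auto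
  qed (use xy S_mult_closed in auto)
  fix z assume z: "z \<in> carrier S"
  show "x \<otimes>\<^bsub>S\<^esub> y \<otimes>\<^bsub>S\<^esub> z = x \<otimes>\<^bsub>S\<^esub> (y \<otimes>\<^bsub>S\<^esub> z)"
  proof (rule S_eqI[OF detecting_mult[OF detecting_common[OF xy] detecting_section[OF z]]])
    fix t assume "t \<in> {a \<otimes>\<^bsub>R\<^esub> b | a b. a \<in> common x y \<and> b \<in> z ` carrier G}"
    then obtain a r where a: "a \<in> common x y" "r \<in> carrier G" "t = a \<otimes>\<^bsub>R\<^esub> z r" by blast
    obtain p q where v: "has_value x a p" "has_value y a q" "a \<in> carrier R" "p \<in> carrier G" "q \<in> carrier G"
      using a(1) by (rule commonE) (use xy in auto)
    have t: "t \<in> carrier R" using a v z by simp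
    have vx: "has_value x t p" and vy: "has_value y t q"
      unfolding a(3) using v xy z by (auto intro: has_value_mult1)
    have vz: "has_value z t r"
      unfolding a(3) using z v a(2) by (intro has_value_mult2 has_value_self) auto
    have "has_value (x \<otimes>\<^bsub>S\<^esub> y \<otimes>\<^bsub>S\<^esub> z) t (p \<otimes>\<^bsub>G\<^esub> q \<otimes>\<^bsub>G\<^esub> r)"
      "has_value (x \<otimes>\<^bsub>S\<^esub> (y \<otimes>\<^bsub>S\<^esub> z)) t (p \<otimes>\<^bsub>G\<^esub> (q \<otimes>\<^bsub>G\<^esub> r))"
      using xy z vx vy vz t by (auto intro!: has_value_mult S_mult_closed)
    then show "\<exists>p. has_value (x \<otimes>\<^bsub>S\<^esub> y \<otimes>\<^bsub>S\<^esub> z) t p \<and> has_value (x \<otimes>\<^bsub>S\<^esub> (y \<otimes>\<^bsub>S\<^esub> z)) t p"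
      using v a(2) by (auto simp: G.m_assoc)
  qed (use xy z S_mult_closed in auto)
next
  fix x assume x: "x \<in> carrier S"
  have xt: "\<exists>p. has_value x t p \<and> t \<in> carrier R \<and> p \<in> carrier G" if t: "t \<in> x ` carrier G" for t
  proof -
    obtain g where g: "g \<in> carrier G" "t = x g" using t by auto
    then show ?thesis using has_value_self[OF x g(1)] S_closed[OF x] by (intro exI[of _ g]) simp
  qed
  show "\<one>\<^bsub>S\<^esub> \<otimes>\<^bsub>S\<^esub> x = x"
  proof (rule S_eqI[OF detecting_section[OF x]])
    fix t assume "t \<in> x ` carrier G"
    then obtain p where p: "has_value x t p" "t \<in> carrier R" "p \<in> carrier G" using xt[of t] by blast
    then show "\<exists>p. has_value (\<one>\<^bsub>S\<^esub> \<otimes>\<^bsub>S\<^esub> x) t p \<and> has_value x t p"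
      using has_value_mult[OF S_one_closed x has_value_one p(1)] by auto
  qed (use x S_mult_closed S_one_closed in auto)
  show "\<exists>y\<in>carrier S. y \<otimes>\<^bsub>S\<^esub> x = \<one>\<^bsub>S\<^esub>"
  proof (rule bexI[of _ "inverse_section x"])
    show "inverse_section x \<otimes>\<^bsub>S\<^esub> x = \<one>\<^bsub>S\<^esub>"
    proof (rule S_eqI[OF detecting_section[OF x]])
      fix t assume "t \<in> x ` carrier G"
      then obtain p where p: "has_value x t p" "t \<in> carrier R" "p \<in> carrier G" using xt[of t] by blast
      then show "\<exists>p. has_value (inverse_section x \<otimes>\<^bsub>S\<^esub> x) t p \<and> has_value \<one>\<^bsub>S\<^esub> t p"
        using has_value_mult[OF inverse_section_closed[OF x] x has_value_inverse[OF x p(1)] p(1,2)] has_value_one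
        by auto
    qed (use x S_mult_closed S_one_closed inverse_section_closed in auto)
  qed (rule inverse_section_closed[OF x])
qed (rule S_one_closed)

text \<open>On the common refinement of two sections the claim is the multiplicativity of u. The
  value at the inverse section shows that the result is a unit.\<close>

lemma evaluate_hom:
  assumes u: "\<And>g. g \<in> carrier G \<Longrightarrow> u g \<in> carrier R" "u \<one>\<^bsub>G\<^esub> = \<one>\<^bsub>R\<^esub>"
    and um: "\<And>g h. g \<in> carrier G \<Longrightarrow> h \<in> carrier G \<Longrightarrow> u (g \<otimes>\<^bsub>G\<^esub> h) = u g \<otimes>\<^bsub>R\<^esub> u h"
  shows "(\<lambda>e. evaluate e u) \<in> hom S (units_of R)"
proof (rule homI)
  have mult: "evaluate (e \<otimes>\<^bsub>S\<^esub> e') u = evaluate e u \<otimes>\<^bsub>R\<^esub> evaluate e' u"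
    if e: "e \<in> carrier S" "e' \<in> carrier S" for e e'
  proof (rule detecting_eq[OF detecting_common[OF e]])
    fix t assume "t \<in> common e e'"
    then obtain p q where v: "has_value e t p" "has_value e' t q" "t \<in> carrier R" "p \<in> carrier G" "q \<in> carrier G"
      by (rule commonE) (use e in auto)
    have "evaluate (e \<otimes>\<^bsub>S\<^esub> e') u \<otimes>\<^bsub>R\<^esub> t = u p \<otimes>\<^bsub>R\<^esub> (u q \<otimes>\<^bsub>R\<^esub> t)"
      using evaluate_at[OF S_mult_closed[OF e] has_value_mult[OF e v(1,2,3)] v(3) u(1)] um v u by (simp add: R.m_assoc)
    also have "u q \<otimes>\<^bsub>R\<^esub> t = evaluate e' u \<otimes>\<^bsub>R\<^esub> t"
      by (rule evaluate_at[OF e(2) v(2,3) u(1), symmetric])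
    also have "u p \<otimes>\<^bsub>R\<^esub> (evaluate e' u \<otimes>\<^bsub>R\<^esub> t) = evaluate e' u \<otimes>\<^bsub>R\<^esub> (u p \<otimes>\<^bsub>R\<^esub> t)"
      using e u v by (simp add: R.m_lcomm)
    also have "u p \<otimes>\<^bsub>R\<^esub> t = evaluate e u \<otimes>\<^bsub>R\<^esub> t"
      by (rule evaluate_at[OF e(1) v(1,3) u(1), symmetric])
    finally show "evaluate (e \<otimes>\<^bsub>S\<^esub> e') u \<otimes>\<^bsub>R\<^esub> t = evaluate e u \<otimes>\<^bsub>R\<^esub> evaluate e' u \<otimes>\<^bsub>R\<^esub> t"
      using e u v by (simp add: R.m_ac)
  qed (use e u S_mult_closed in auto)
  have one: "evaluate \<one>\<^bsub>S\<^esub> u = \<one>\<^bsub>R\<^esub>"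
    using evaluate_at[OF S_one_closed has_value_one R.one_closed u(1)] u S_one_closed by auto
  interpret S: comm_group S by (rule comm_group_S)
  fix e assume e: "e \<in> carrier S"
  have "evaluate e u \<otimes>\<^bsub>R\<^esub> evaluate (inv\<^bsub>S\<^esub> e) u = \<one>\<^bsub>R\<^esub>"
    using mult[OF e S.inv_closed[OF e]] one e by simp
  then show "evaluate e u \<in> carrier (units_of R)"
    using e u S.inv_closed[OF e] R.m_comm[of "evaluate e u"] unfolding units_of_def Units_def by force
  fix e' assume "e' \<in> carrier S"
  then show "evaluate (e \<otimes>\<^bsub>S\<^esub> e') u = evaluate e u \<otimes>\<^bsub>units_of R\<^esub> evaluate e' u"
    using mult e by (simp add: units_of_def)
qed

end

section \<open>Sections of a constant group under change of rings\<close>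

locale constant_section_map = R: constant_section_group R G + R': constant_section_group R' G + ring_hom_cring R R' f
  for R :: "'u ring" and R' :: "'v ring" and G :: "'g monoid" and f
begin

lemma restr_closed:
  assumes e: "e \<in> carrier R.S" shows "f \<circ> e \<in> carrier R'.S"
  unfolding R'.in_S_iff
proof (intro conjI allI impI)
  have sub: "R'.support (f \<circ> e) \<subseteq> R.support e" by (auto simp: R.support_def R'.support_def)
  note fin = R.S_finite[OF e]
  show "finite (R'.support (f \<circ> e))" by (rule finite_subset[OF sub fin])
  have "(\<Oplus>\<^bsub>R'\<^esub>g\<in>R'.support (f \<circ> e). (f \<circ> e) g) = (\<Oplus>\<^bsub>R'\<^esub>g\<in>R.support e. (f \<circ> e) g)"
    using e by (intro R'.R.add.finprod_mono_neutral_cong_left[OF fin sub]) (auto simp: R'.support_def)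
  also have "\<dots> = f (\<Oplus>\<^bsub>R\<^esub>g\<in>R.support e. e g)"
    using e by (subst hom_finsum) auto
  finally show "(\<Oplus>\<^bsub>R'\<^esub>g\<in>R'.support (f \<circ> e). (f \<circ> e) g) = \<one>\<^bsub>R'\<^esub>"
    using R.S_sum[OF e] by simp
  show "(f \<circ> e) g \<otimes>\<^bsub>R'\<^esub> (f \<circ> e) h = \<zero>\<^bsub>R'\<^esub>" if "g \<noteq> h" for g h
    using R.S_orthogonal[OF e that] e hom_mult[of "e g" "e h"] by simp
qed (use e R.S_outside[OF e] in auto)

lemma has_value_restr:
  "R.has_value e t p \<Longrightarrow> e \<in> carrier R.S \<Longrightarrow> t \<in> carrier R \<Longrightarrow> R'.has_value (f \<circ> e) (f t) p"
  by (simp add: R.has_value_def R'.has_value_def flip: hom_mult)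

text \<open>Each piece of the common refinement over R' is the image of a piece over R. There both
  sections have known values, and values are preserved by restriction.\<close>

lemma restr_mult:
  assumes e: "e \<in> carrier R.S" "e' \<in> carrier R.S"
  shows "f \<circ> (e \<otimes>\<^bsub>R.S\<^esub> e') = (f \<circ> e) \<otimes>\<^bsub>R'.S\<^esub> (f \<circ> e')"
proof (rule R'.S_eqI[OF R'.detecting_common])
  fix t assume t: "t \<in> R'.common (f \<circ> e) (f \<circ> e')"
  obtain p q where v: "R'.has_value (f \<circ> e) t p" "R'.has_value (f \<circ> e') t q" "t \<in> carrier R'"
    "t = (f \<circ> e) p \<otimes>\<^bsub>R'\<^esub> (f \<circ> e') q" "p \<in> carrier G" "q \<in> carrier G"
    using t restr_closed[OF e(1)] restr_closed[OF e(2)] by (rule R'.commonE)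
  let ?t = "e p \<otimes>\<^bsub>R\<^esub> e' q"
  have tt: "t = f ?t" using v(4) e by simp
  have 1: "R.has_value e ?t p" "R.has_value e' ?t q"
    using e v(5,6) by (auto intro: R.has_value_mult1 R.has_value_mult2 R.has_value_self)
  have "R'.has_value (f \<circ> (e \<otimes>\<^bsub>R.S\<^esub> e')) t (p \<otimes>\<^bsub>G\<^esub> q)"
    unfolding tt using e 1 by (intro has_value_restr R.has_value_mult R.S_mult_closed) auto
  moreover have "R'.has_value ((f \<circ> e) \<otimes>\<^bsub>R'.S\<^esub> (f \<circ> e')) t (p \<otimes>\<^bsub>G\<^esub> q)"
    using v e by (intro R'.has_value_mult restr_closed) auto
  ultimately show "\<exists>p. R'.has_value (f \<circ> (e \<otimes>\<^bsub>R.S\<^esub> e')) t p \<and> R'.has_value ((f \<circ> e) \<otimes>\<^bsub>R'.S\<^esub> (f \<circ> e')) t p"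
    by blast
qed (use e in \<open>auto intro!: restr_closed R.S_mult_closed R'.S_mult_closed\<close>)

lemma evaluate_restr:
  assumes e: "e \<in> carrier R.S" and u: "\<And>g. g \<in> carrier G \<Longrightarrow> u g \<in> carrier R"
    and u': "\<And>g. g \<in> carrier G \<Longrightarrow> u' g = f (u g)"
  shows "f (R.evaluate e u) = R'.evaluate (f \<circ> e) u'"
proof (rule R'.detecting_eq[OF R'.detecting_section[OF restr_closed[OF e]]])
  have u'c: "u' g \<in> carrier R'" if "g \<in> carrier G" for g using u u' that by simp
  show "f (R.evaluate e u) \<in> carrier R'" using e u by simp
  show "R'.evaluate (f \<circ> e) u' \<in> carrier R'" using restr_closed[OF e] u'c by simp
  fix t assume "t \<in> (f \<circ> e) ` carrier G"
  then obtain g where g: "g \<in> carrier G" "t = f (e g)" by auto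
  have v: "R.has_value e (e g) g" by (rule R.has_value_self[OF e g(1)])
  have "f (R.evaluate e u) \<otimes>\<^bsub>R'\<^esub> t = f (R.evaluate e u \<otimes>\<^bsub>R\<^esub> e g)" using e u g(2) by simp
  also have "\<dots> = f (u g) \<otimes>\<^bsub>R'\<^esub> t"
    using R.evaluate_at[OF e v _ u] e u[OF g(1)] g(2) by simp
  also have "\<dots> = R'.evaluate (f \<circ> e) u' \<otimes>\<^bsub>R'\<^esub> t"
    using R'.evaluate_at[OF restr_closed[OF e] has_value_restr[OF v e] _ u'c] e g u'[OF g(1)] by simp
  finally show "f (R.evaluate e u) \<otimes>\<^bsub>R'\<^esub> t = R'.evaluate (f \<circ> e) u' \<otimes>\<^bsub>R'\<^esub> t" .
qed

end

lemma constant_section_group_alg: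
  "is_alg k A \<Longrightarrow> comm_group G \<Longrightarrow> constant_section_group (fst A) G"
  by (simp add: is_alg_def constant_section_group_def)

lemma constant_section_map_alg:
  "is_alg_hom k A B f \<Longrightarrow> comm_group G \<Longrightarrow> constant_section_map (fst A) (fst B) G f"
  using is_alg_homD(1,2,3)[of k A B f] by (simp add: constant_section_map_def constant_section_group_alg)

lemma constant_sheaf_simps [simp]:
  "sections (constant_sheaf G) A = constant_sections G (fst A)" "restr (constant_sheaf G) A B f e = f \<circ> e"
  by (simp_all add: constant_sheaf_def)

lemma group_presheaf_constant:
  fixes G :: "'g monoid"
  assumes G: "comm_group G"
  shows "group_presheaf k (constant_sheaf G :: ('k, 'u, 'g \<Rightarrow> 'u) group_functor)"
  unfolding group_presheaf_def
proof (intro conjI allI impI ballI; (elim conjE)?)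
  let ?F = "constant_sheaf G :: ('k, 'u, 'g \<Rightarrow> 'u) group_functor"
  show "comm_group (sections ?F A)" if "is_alg k A" for A
    using constant_section_group.comm_group_S[OF constant_section_group_alg[OF that G]] by simp
  show "restr ?F A B f \<in> hom (sections ?F A) (sections ?F B)" if "is_alg_hom k A B f" for A B f
  proof -
    interpret constant_section_map "fst A" "fst B" G f by (rule constant_section_map_alg[OF that G])
    show ?thesis by (rule homI) (simp_all add: restr_closed restr_mult)
  qed
  show "restr ?F A B f s = restr ?F A B g s" if "is_alg_hom k A B f" "\<forall>x\<in>carrier (fst A). f x = g x"
    "s \<in> carrier (sections ?F A)" for A B f g s
  proof -
    interpret constant_section_group "fst A" G by (rule constant_section_group_alg[OF is_alg_homD(1)[OF that(1)] G])
    show ?thesis using that by (simp add: fun_eq_iff)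
  qed
qed (simp_all add: fun_eq_iff)

text \<open>Each coefficient of a compatible family glues by \<open>fppf_glue\<close>. The glued
  family is almost everywhere zero because the covering is finite: a coefficient that vanishes on
  all members vanishes, so the support lies in a finite union of finite supports. Orthogonality, sum
  1 and uniqueness descend by separatedness.\<close>

lemma fppf_sheaf_constant:
  fixes G :: "'g monoid"
  assumes G: "comm_group G"
  shows "fppf_sheaf k (constant_sheaf G :: ('k, 'u::infinite, 'g \<Rightarrow> 'u) group_functor)"
proof (rule fppf_sheafI[OF group_presheaf_constant[OF G]])
  let ?F = "constant_sheaf G :: ('k, 'u, 'g \<Rightarrow> 'u) group_functor"
  fix A :: "('k, 'u) alg" and U s
  assume A: "is_alg k A" and U: "fppf_covering k A U"
    and s: "\<And>B f. (B, f) \<in> U \<Longrightarrow> s (B, f) \<in> carrier (sections ?F B)"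
    and comp: "\<And>B f B' f' C g g'. (B, f) \<in> U \<Longrightarrow> (B', f') \<in> U \<Longrightarrow> is_alg_hom k B C g \<Longrightarrow>
      is_alg_hom k B' C g' \<Longrightarrow> (\<And>x. x \<in> carrier (fst A) \<Longrightarrow> g (f x) = g' (f' x)) \<Longrightarrow>
      restr ?F B C g (s (B, f)) = restr ?F B' C g' (s (B', f'))"
  interpret A: constant_section_group "fst A" G by (rule constant_section_group_alg[OF A G])
  have map: "constant_section_map (fst A) (fst B) G f" if "(B, f) \<in> U" for B f
    by (rule constant_section_map_alg[OF fppf_coveringD(2)[OF U that] G])
  have "\<exists>a\<in>carrier (fst A). \<forall>(B, f)\<in>U. f a = s (B, f) x" for x
  proof (rule fppf_glue[where b = "\<lambda>z. s z x", OF A U])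
    fix B f assume B: "(B, f) \<in> U"
    interpret constant_section_map "fst A" "fst B" G f by (rule map[OF B])
    show "s (B, f) x \<in> carrier (fst B)" using s[OF B] by simp
  next
    fix B f B' f' C g g'
    assume "(B, f) \<in> U" "(B', f') \<in> U" "is_alg_hom k B C g" "is_alg_hom k B' C g'"
      "\<And>x. x \<in> carrier (fst A) \<Longrightarrow> g (f x) = g' (f' x)"
    from comp[OF this] show "g (s (B, f) x) = g' (s (B', f') x)" by (simp add: fun_eq_iff)
  qed
  then have "\<forall>x. \<exists>a. a \<in> carrier (fst A) \<and> (\<forall>(B, f)\<in>U. f a = s (B, f) x)" unfolding Bex_def by (rule allI)
  from choice[OF this] obtain t where tt: "\<forall>x. t x \<in> carrier (fst A) \<and> (\<forall>(B, f)\<in>U. f (t x) = s (B, f) x)"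
    by (elim exE)
  have t: "\<And>x. t x \<in> carrier (fst A)" "\<And>x. \<forall>(B, f)\<in>U. f (t x) = s (B, f) x"
    using spec[OF tt] by (rule conjunct1, rule conjunct2)
  have ft: "f (t x) = s (B, f) x" if "(B, f) \<in> U" for B f x using t(2)[of x] that by blast
  have zero: "a = \<zero>\<^bsub>fst A\<^esub>" if a: "a \<in> carrier (fst A)" "\<And>B f. (B, f) \<in> U \<Longrightarrow> f a = \<zero>\<^bsub>fst B\<^esub>" for a
  proof (rule fppf_separated[OF A U a(1)])
    fix B f assume B: "(B, f) \<in> U"
    interpret constant_section_map "fst A" "fst B" G f by (rule map[OF B])
    show "f a = f \<zero>\<^bsub>fst A\<^esub>" using a(2)[OF B] by simp
  qed simp
  have tS: "t \<in> carrier A.S"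
    unfolding A.in_S_iff
  proof (intro conjI allI impI t(1))
    fix x assume x: "x \<notin> carrier G"
    show "t x = \<zero>\<^bsub>fst A\<^esub>"
    proof (rule zero[OF t(1)])
      fix B f assume B: "(B, f) \<in> U"
      interpret constant_section_map "fst A" "fst B" G f by (rule map[OF B])
      show "f (t x) = \<zero>\<^bsub>fst B\<^esub>" using R'.S_outside s[OF B] x by (simp add: ft[OF B])
    qed
  next
    have "A.support t \<subseteq> (\<Union>(B, f)\<in>U. {x. s (B, f) x \<noteq> \<zero>\<^bsub>fst B\<^esub>})"
    proof
      fix x assume x: "x \<in> A.support t"
      show "x \<in> (\<Union>(B, f)\<in>U. {x. s (B, f) x \<noteq> \<zero>\<^bsub>fst B\<^esub>})"
      proof (rule ccontr)
        assume "x \<notin> (\<Union>(B, f)\<in>U. {x. s (B, f) x \<noteq> \<zero>\<^bsub>fst B\<^esub>})"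
        then have ft0: "f (t x) = \<zero>\<^bsub>fst B\<^esub>" if "(B, f) \<in> U" for B f using that by (auto simp: ft[OF that])
        have "t x = \<zero>\<^bsub>fst A\<^esub>" by (rule zero[OF t(1)]) (rule ft0)
        with x show False by (simp add: A.support_def)
      qed
    qed
    moreover have "finite (\<Union>(B, f)\<in>U. {x. s (B, f) x \<noteq> \<zero>\<^bsub>fst B\<^esub>})"
    proof (rule finite_UN_I[OF fppf_coveringD(1)[OF U]])
      fix z assume z: "z \<in> U"
      obtain B f where zz: "z = (B, f)" by (cases z)
      with z have B: "(B, f) \<in> U" by simp
      interpret constant_section_map "fst A" "fst B" G f by (rule map[OF B])
      have "finite (R'.support (s (B, f)))" using R'.S_finite s[OF B] by simp
      then show "finite (case z of (B, f) \<Rightarrow> {x. s (B, f) x \<noteq> \<zero>\<^bsub>fst B\<^esub>})"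
        unfolding zz split_conv R'.support_def .
    qed
    ultimately show "finite (A.support t)" by (rule finite_subset)
    then have closed: "(\<Oplus>\<^bsub>fst A\<^esub>x\<in>A.support t. t x) \<in> carrier (fst A)" using t(1) by (intro A.R.finsum_closed) auto
    show "(\<Oplus>\<^bsub>fst A\<^esub>x\<in>A.support t. t x) = \<one>\<^bsub>fst A\<^esub>"
    proof (rule fppf_separated[OF A U closed A.R.one_closed])
      fix B f assume B: "(B, f) \<in> U"
      interpret constant_section_map "fst A" "fst B" G f by (rule map[OF B])
      have sB: "s (B, f) \<in> carrier R'.S" using s[OF B] by simp
      have sub: "R'.support (s (B, f)) \<subseteq> A.support t"
        by (auto simp: R'.support_def A.support_def simp flip: ft[OF B])
      have "f (\<Oplus>\<^bsub>fst A\<^esub>x\<in>A.support t. t x) = (\<Oplus>\<^bsub>fst B\<^esub>x\<in>A.support t. s (B, f) x)"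
        using t(1) by (subst hom_finsum) (auto simp: o_def ft[OF B])
      also have "\<dots> = (\<Oplus>\<^bsub>fst B\<^esub>x\<in>R'.support (s (B, f)). s (B, f) x)"
        using sB by (intro R'.R.add.finprod_mono_neutral_cong_left[OF \<open>finite (A.support t)\<close> sub, symmetric])
          (auto simp: R'.support_def)
      finally show "f (\<Oplus>\<^bsub>fst A\<^esub>x\<in>A.support t. t x) = f \<one>\<^bsub>fst A\<^esub>" using R'.S_sum[OF sB] by simp
    qed
  next
    fix x y :: 'g assume xy: "x \<noteq> y"
    show "t x \<otimes>\<^bsub>fst A\<^esub> t y = \<zero>\<^bsub>fst A\<^esub>"
    proof (rule zero)
      fix B f assume B: "(B, f) \<in> U"
      interpret constant_section_map "fst A" "fst B" G f by (rule map[OF B])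
      show "f (t x \<otimes>\<^bsub>fst A\<^esub> t y) = \<zero>\<^bsub>fst B\<^esub>"
        using R'.S_orthogonal[OF _ xy, of "s (B, f)"] s[OF B] t(1) by (simp add: ft[OF B])
    qed (use t(1) in simp)
  qed
  show "\<exists>!t. t \<in> carrier (sections ?F A) \<and> (\<forall>(B, f)\<in>U. restr ?F A B f t = s (B, f))"
  proof (rule ex1I[of _ t])
    show "t \<in> carrier (sections ?F A) \<and> (\<forall>(B, f)\<in>U. restr ?F A B f t = s (B, f))"
      using tS by (auto simp: fun_eq_iff ft)
    fix t' assume t': "t' \<in> carrier (sections ?F A) \<and> (\<forall>(B, f)\<in>U. restr ?F A B f t' = s (B, f))"
    show "t' = t"
    proof
      fix x show "t' x = t x"
      proof (rule fppf_separated[OF A U])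
        fix B f assume B: "(B, f) \<in> U"
        have "f \<circ> t' = s (B, f)" using bspec[OF conjunct2[OF t'] B] by simp
        then have "f (t' x) = s (B, f) x" by (metis o_apply)
        then show "f (t' x) = f (t x)" by (simp add: ft[OF B])
      qed (use t' t(1) in auto)
    qed
  qed
qed

section \<open>Isomorphic groups and their constant sheaves\<close>

definition relabel :: "('g, 'a) monoid_scheme \<Rightarrow> ('h \<Rightarrow> 'g) \<Rightarrow> 'h set \<Rightarrow> 'u ring \<Rightarrow> ('g \<Rightarrow> 'u) \<Rightarrow> 'h \<Rightarrow> 'u" where
  "relabel G \<psi> H R e y = (if y \<in> H then e (\<psi> y) else \<zero>\<^bsub>R\<^esub>)"

text \<open>The decomposition of Spec R stays the same and only the labels of its pieces change,
  from p to \<open>\<phi> p\<close>. Hence the pieces of the original section serve as detecting set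
  on the H side.\<close>

lemma relabel_section:
  fixes G :: "'g monoid" and H :: "'h monoid" and R :: "'u ring"
  assumes R: "cring R" "comm_group G" "comm_group H" and \<phi>: "\<phi> \<in> iso G H" and \<psi>: "\<psi> \<in> iso H G"
    and inv: "\<And>g. g \<in> carrier G \<Longrightarrow> \<psi> (\<phi> g) = g" "\<And>y. y \<in> carrier H \<Longrightarrow> \<phi> (\<psi> y) = y"
  shows "relabel G \<psi> (carrier H) R \<in> hom (constant_sections G R) (constant_sections H R)"
proof -
  interpret G: constant_section_group R G using R by (simp add: constant_section_group_def)
  interpret H: constant_section_group R H using R by (simp add: constant_section_group_def)
  let ?m = "relabel G \<psi> (carrier H) R"
  have \<psi>c: "\<psi> y \<in> carrier G" if "y \<in> carrier H" for y using \<psi> that by (auto simp: iso_def hom_def)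
  have \<phi>c: "\<phi> g \<in> carrier H" if "g \<in> carrier G" for g using \<phi> that by (auto simp: iso_def hom_def)
  have val: "H.has_value (?m e) t (\<phi> p)" if "G.has_value e t p" for e t p
    using that \<phi>c inv by (auto simp: G.has_value_def H.has_value_def relabel_def)
  have closed: "?m e \<in> carrier H.S" if e: "e \<in> carrier G.S" for e
  proof (rule H.S_memI)
    show "H.detecting (e ` carrier G)" by (rule G.detecting_section[OF e])
    have "H.support (?m e) \<subseteq> \<phi> ` G.support e"
    proof
      fix y assume "y \<in> H.support (?m e)"
      then have "y \<in> carrier H" "\<psi> y \<in> G.support e"
        by (auto simp: H.support_def G.support_def relabel_def split: if_splits)
      then show "y \<in> \<phi> ` G.support e" using inv(2) by (metis imageI)
    qed
    then show "finite (H.support (?m e))" using G.S_finite[OF e] by (meson finite_imageI finite_subset)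
    fix t assume "t \<in> e ` carrier G"
    then obtain p where p: "p \<in> carrier G" "t = e p" by auto
    have "?m e y \<otimes>\<^bsub>R\<^esub> t = (if y = \<phi> p then t else \<zero>\<^bsub>R\<^esub>)" for y
    proof (cases "y = \<phi> p")
      case True
      then show ?thesis using val[OF G.has_value_self[OF e p(1)]] p by (simp add: H.has_value_def)
    next
      case False
      show ?thesis
      proof (cases "y \<in> carrier H")
        case True
        then have "\<psi> y \<noteq> p" using False inv by auto
        from G.S_orthogonal[OF e this] show ?thesis using True False p by (simp add: relabel_def)
      next
        case out: False
        then show ?thesis using False p e by (simp add: relabel_def)
      qed
    qed
    then show "\<exists>p\<in>carrier H. \<forall>y. ?m e y \<otimes>\<^bsub>R\<^esub> t = (if y = p then t else \<zero>\<^bsub>R\<^esub>)"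
      using \<phi>c[OF p(1)] by blast
  qed (use e in \<open>auto simp: relabel_def\<close>)
  show ?thesis
  proof (rule homI[OF closed])
    fix e e' assume e: "e \<in> carrier G.S" "e' \<in> carrier G.S"
    show "?m (e \<otimes>\<^bsub>G.S\<^esub> e') = ?m e \<otimes>\<^bsub>H.S\<^esub> ?m e'"
    proof (rule H.S_eqI)
      show "H.detecting (G.common e e')" by (rule G.detecting_common[OF e])
      fix t assume "t \<in> G.common e e'"
      then obtain p q where v: "G.has_value e t p" "G.has_value e' t q" "t \<in> carrier R" "p \<in> carrier G" "q \<in> carrier G"
        by (rule G.commonE[OF _ e])
      have "H.has_value (?m (e \<otimes>\<^bsub>G.S\<^esub> e')) t (\<phi> (p \<otimes>\<^bsub>G\<^esub> q))"
        by (intro val G.has_value_mult e v)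
      moreover have "H.has_value (?m e \<otimes>\<^bsub>H.S\<^esub> ?m e') t (\<phi> p \<otimes>\<^bsub>H\<^esub> \<phi> q)"
        by (intro H.has_value_mult closed e val v)
      moreover have "\<phi> (p \<otimes>\<^bsub>G\<^esub> q) = \<phi> p \<otimes>\<^bsub>H\<^esub> \<phi> q" using \<phi> v(4,5) by (simp add: iso_def hom_def)
      ultimately show "\<exists>p. H.has_value (?m (e \<otimes>\<^bsub>G.S\<^esub> e')) t p \<and> H.has_value (?m e \<otimes>\<^bsub>H.S\<^esub> ?m e') t p"
        by auto
    qed (use e closed G.S_mult_closed H.S_mult_closed in auto)
  qed
qed

lemma isomorphic_over_constant:
  fixes G :: "'g monoid" and H :: "'h monoid" and A :: "('k, 'u) alg"
  assumes G: "comm_group G" "comm_group H" and "G \<cong> H"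
  shows "isomorphic_over k A (constant_sheaf G) (constant_sheaf H)"
proof -
  obtain \<phi> where \<phi>: "\<phi> \<in> iso G H" using assms(3) by (auto simp: is_iso_def)
  define \<psi> where "\<psi> = inv_into (carrier G) \<phi>"
  have \<psi>: "\<psi> \<in> iso H G" unfolding \<psi>_def
    by (rule group.iso_set_sym[OF _ \<phi>]) (use G in \<open>simp add: comm_group_def\<close>)
  have bij: "bij_betw \<phi> (carrier G) (carrier H)" using \<phi> by (simp add: iso_def)
  have inv: "\<And>g. g \<in> carrier G \<Longrightarrow> \<psi> (\<phi> g) = g" "\<And>y. y \<in> carrier H \<Longrightarrow> \<phi> (\<psi> y) = y"
    using bij by (auto simp: \<psi>_def bij_betw_def inv_into_f_f f_inv_into_f)
  have c: "\<And>g. g \<in> carrier G \<Longrightarrow> \<phi> g \<in> carrier H" "\<And>y. y \<in> carrier H \<Longrightarrow> \<psi> y \<in> carrier G"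
    using \<phi> \<psi> by (auto simp: iso_def hom_def)
  show ?thesis
    unfolding isomorphic_over_def
  proof (intro exI conjI allI impI ballI; (elim conjE)?)
    fix C :: "('k, 'u) alg" and h assume "is_alg_hom k A C h"
    then have C: "is_alg k C" by (rule is_alg_homD)
    interpret G: constant_section_group "fst C" G by (rule constant_section_group_alg[OF C G(1)])
    interpret H: constant_section_group "fst C" H by (rule constant_section_group_alg[OF C G(2)])
    let ?m = "relabel G \<psi> (carrier H) (fst C)" and ?n = "relabel H \<phi> (carrier G) (fst C)"
    have m: "?m \<in> hom G.S H.S" by (rule relabel_section[OF G.R.is_cring G \<phi> \<psi> inv])
    have n: "?n \<in> hom H.S G.S" by (rule relabel_section[OF G.R.is_cring G(2,1) \<psi> \<phi> inv(2,1)])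
    have "bij_betw ?m (carrier G.S) (carrier H.S)"
    proof (rule bij_betw_byWitness[where f' = ?n])
      show "\<forall>e\<in>carrier G.S. ?n (?m e) = e"
        using c inv G.S_outside by (auto simp: relabel_def fun_eq_iff)
      show "\<forall>e\<in>carrier H.S. ?m (?n e) = e"
        using c inv H.S_outside by (auto simp: relabel_def fun_eq_iff)
    qed (use m n in \<open>auto simp: hom_def\<close>)
    with m show "relabel G \<psi> (carrier H) (fst C) \<in> iso (sections (constant_sheaf G) C) (sections (constant_sheaf H) C)"
      by (simp add: iso_def)
  next
    fix C D :: "('k, 'u) alg" and h g and s :: "'g \<Rightarrow> 'u"
    assume "is_alg_hom k C D g"
    then interpret ring_hom_cring "fst C" "fst D" g by (rule is_alg_homD)
    show "relabel G \<psi> (carrier H) (fst D) (restr (constant_sheaf G) C D g s) =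
        restr (constant_sheaf H) C D g (relabel G \<psi> (carrier H) (fst C) s)"
      by (simp add: relabel_def fun_eq_iff)
  qed
qed

section \<open>Constant and trivial lattices\<close>

lemma trivial_sheaf_simps [simp]:
  "sections (trivial_sheaf z) A = singleton_group z" "restr (trivial_sheaf z) A B f s = s"
  by (simp_all add: trivial_sheaf_def)

lemma (in constant_section_group) trivial_sections:
  assumes "carrier G = {\<one>\<^bsub>G\<^esub>}" shows "carrier S = {\<one>\<^bsub>S\<^esub>}"
proof -
  have "e = \<one>\<^bsub>S\<^esub>" if e: "e \<in> carrier S" for e
  proof (rule S_eqI[OF detecting_section[OF e] e S_one_closed])
    fix t assume "t \<in> e ` carrier G"
    then have t: "t = e \<one>\<^bsub>G\<^esub>" using assms by auto
    show "\<exists>p. has_value e t p \<and> has_value \<one>\<^bsub>S\<^esub> t p"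
      unfolding t using has_value_self[OF e G.one_closed] has_value_one[OF S_closed[OF e]] by blast
  qed
  then show ?thesis using S_one_closed by blast
qed

lemma lattice_scheme_constant:
  fixes G :: "'g monoid" and r :: nat
  assumes G: "comm_group G" "G \<cong> free_Abelian_group {..<r}"
  shows "lattice_scheme k (constant_sheaf G :: ('k, 'u::infinite, 'g \<Rightarrow> 'u) group_functor)"
  unfolding lattice_scheme_def
proof (intro conjI allI impI fppf_sheaf_constant[OF G(1)])
  fix A :: "('k, 'u) alg" assume A: "is_alg k A"
  have "isomorphic_over k A (constant_sheaf G) (constant_sheaf (free_Abelian_group {..<r}))"
    by (rule isomorphic_over_constant[OF G(1) abelian_free_Abelian_group G(2)])
  then show "\<exists>U. fppf_covering k A U \<and> (\<forall>(B, f)\<in>U. \<exists>r::nat. isomorphic_over k B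
      (constant_sheaf G :: ('k, 'u, 'g \<Rightarrow> 'u) group_functor) (constant_sheaf (free_Abelian_group {..<r})))"
    by (intro exI[of _ "{(A, id)}"] conjI fppf_covering_id[OF A]) auto
qed

text \<open>The case of rank 0. The constant sheaf of the trivial group consists of functions and is
  not literally a one-point sheaf of the given type, but it has exactly one section over each
  algebra.\<close>

lemma lattice_scheme_trivial: "lattice_scheme k (trivial_sheaf z :: ('k, 'u::infinite, 's) group_functor)"
  unfolding lattice_scheme_def
proof (intro conjI allI impI fppf_sheaf_trivial)
  fix A :: "('k, 'u) alg" assume A: "is_alg k A"
  let ?G = "free_Abelian_group {..<0::nat}"
  have G: "comm_group ?G" by (rule abelian_free_Abelian_group)
  have "isomorphic_over k A (trivial_sheaf z) (constant_sheaf ?G)"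
    unfolding isomorphic_over_def
  proof (intro exI conjI allI impI ballI; (elim conjE)?)
    fix C :: "('k, 'u) alg" and h assume "is_alg_hom k A C h"
    then have "is_alg k C" by (rule is_alg_homD)
    then interpret C: constant_section_group "fst C" ?G by (rule constant_section_group_alg[OF _ G])
    have "carrier ?G = {\<one>\<^bsub>?G\<^esub>}" by auto
    note S = C.trivial_sections[OF this]
    interpret S: comm_group C.S by (rule C.comm_group_S)
    show "(\<lambda>_. \<one>\<^bsub>constant_sections ?G (fst C)\<^esub>) \<in> iso (sections (trivial_sheaf z) C) (sections (constant_sheaf ?G) C)"
      using S by (auto simp: iso_def hom_def bij_betw_def simp del: lessThan_0)
  next
    fix C D :: "('k, 'u) alg" and h g and s :: 's
    assume "is_alg_hom k C D g"
    then interpret ring_hom_cring "fst C" "fst D" g by (rule is_alg_homD)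
    show "\<one>\<^bsub>constant_sections ?G (fst D)\<^esub> = restr (constant_sheaf ?G) C D g \<one>\<^bsub>constant_sections ?G (fst C)\<^esub>"
      by (simp add: constant_sections_def fun_eq_iff)
  qed
  then show "\<exists>U. fppf_covering k A U \<and> (\<forall>(B, f)\<in>U. \<exists>r::nat. isomorphic_over k B
      (trivial_sheaf z :: ('k, 'u, 's) group_functor) (constant_sheaf (free_Abelian_group {..<r})))"
    by (intro exI[of _ "{(A, id)}"] conjI fppf_covering_id[OF A]) (auto simp del: lessThan_0)
qed

lemma extension_of_by_trivial:
  fixes F :: "('k, 'u, 's) group_functor"
  assumes "fppf_sheaf k F" "P F" "\<And>z. Q (trivial_sheaf z :: ('k, 'u, 'u) group_functor)"
  shows "extension_of_by k F Q P"
  unfolding extension_of_by_def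
  by (intro exI conjI, rule short_exact_id_trivial[OF assms(1), of undefined], rule assms(2), rule assms(3))

section \<open>Motives of subgroups of the torus\<close>

locale unit_subgroup =
  k: cring k for k :: "'k ring" +
  fixes M assumes M: "subgroup M (unit_pairs k)"
begin

abbreviation "G \<equiv> (unit_pairs k)\<lparr>carrier := M\<rparr>"

lemma comm_group_unit_pairs: "comm_group (unit_pairs k)"
  unfolding unit_pairs_def by (rule comm_group_units_times[OF k.is_cring])

lemma comm_group_G: "comm_group G"
proof -
  interpret U: comm_group "unit_pairs k" by (rule comm_group_unit_pairs)
  interpret M: subgroup M "unit_pairs k" by (rule M)
  show ?thesis
    by (rule group.group_comm_groupI[OF M.subgroup_is_group[OF U.is_group]]) (use U.m_comm in auto)
qed

lemma M_carrier: "g \<in> M \<Longrightarrow> fst g \<in> Units k \<and> snd g \<in> Units k"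
  using subgroup.subset[OF M] by (auto simp: unit_pairs_def units_of_def)

lemma G_simps: "carrier G = M" "g \<otimes>\<^bsub>unit_pairs k\<^esub> h = (fst g \<otimes>\<^bsub>k\<^esub> fst h, snd g \<otimes>\<^bsub>k\<^esub> snd h)"
  "\<one>\<^bsub>unit_pairs k\<^esub> = (\<one>\<^bsub>k\<^esub>, \<one>\<^bsub>k\<^esub>)"
  by (simp_all add: unit_pairs_def units_of_def mult_DirProd')

text \<open>Both coordinates are \<open>evaluate\<close> along a projection of M to the units of k,
  pushed to A. Homomorphy and compatibility with restriction are therefore instances of
  \<open>evaluate_hom\<close> and \<open>evaluate_restr\<close>.\<close>

lemma sheaf_hom_inclusion:
  "sheaf_hom k (constant_sheaf G :: ('k, 'u, 'k \<times> 'k \<Rightarrow> 'u) group_functor) Gm_times_Gm inclusion_map"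
  unfolding sheaf_hom_def
proof (intro conjI allI impI ballI)
  have algc: "ring_hom_cring k (fst A) (snd A)" if "is_alg k A" for A :: "('k, 'u) alg"
    using that k.is_cring by (auto simp: is_alg_def intro: ring_hom_cring.intro ring_hom_cring_axioms.intro)
  have Uc: "fst g \<in> carrier k" "snd g \<in> carrier k" if "g \<in> M" for g
    using M_carrier[OF that] k.Units_closed by auto
  fix A :: "('k, 'u) alg"
  {
    assume A: "is_alg k A"
    interpret A: constant_section_group "fst A" G by (rule constant_section_group_alg[OF A comm_group_G])
    interpret s: ring_hom_cring k "fst A" "snd A" by (rule algc[OF A])
    have 1: "(\<lambda>e. A.evaluate e (\<lambda>g. snd A (fst g))) \<in> hom A.S (units_of (fst A))"
      by (rule A.evaluate_hom) (use Uc in \<open>auto simp: G_simps simp del: mult_DirProd\<close>)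
    have 2: "(\<lambda>e. A.evaluate e (\<lambda>g. snd A (snd g))) \<in> hom A.S (units_of (fst A))"
      by (rule A.evaluate_hom) (use Uc in \<open>auto simp: G_simps simp del: mult_DirProd\<close>)
    have "inclusion_map A = (\<lambda>e. (A.evaluate e (\<lambda>g. snd A (fst g)), A.evaluate e (\<lambda>g. snd A (snd g))))"
      by (simp add: inclusion_map_def[abs_def] A.evaluate_def A.support_def)
    then show "inclusion_map A \<in> hom (sections (constant_sheaf G) A) (sections Gm_times_Gm A)"
      using 1 2 by (simp add: hom_paired Gm_times_Gm_def)
  }
  fix B f and s :: "'k \<times> 'k \<Rightarrow> 'u"
  assume f: "is_alg_hom k A B f" and s: "s \<in> carrier (sections (constant_sheaf G) A)"
  interpret m: constant_section_map "fst A" "fst B" G f by (rule constant_section_map_alg[OF f comm_group_G])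
  interpret s: ring_hom_cring k "fst A" "snd A" by (rule algc[OF is_alg_homD(1)[OF f]])
  have incl: "inclusion_map A e = (m.R.evaluate e (\<lambda>g. snd A (fst g)), m.R.evaluate e (\<lambda>g. snd A (snd g)))"
    "inclusion_map B e' = (m.R'.evaluate e' (\<lambda>g. snd B (fst g)), m.R'.evaluate e' (\<lambda>g. snd B (snd g)))" for e e'
    by (simp_all add: inclusion_map_def m.R.evaluate_def m.R.support_def m.R'.evaluate_def m.R'.support_def)
  have "f (m.R.evaluate s (\<lambda>g. snd A (fst g))) = m.R'.evaluate (f \<circ> s) (\<lambda>g. snd B (fst g))"
    "f (m.R.evaluate s (\<lambda>g. snd A (snd g))) = m.R'.evaluate (f \<circ> s) (\<lambda>g. snd B (snd g))"
    using s Uc is_alg_homD(5)[OF f] by (auto intro!: m.evaluate_restr)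
  then show "inclusion_map B (restr (constant_sheaf G) A B f s) = restr Gm_times_Gm A B f (inclusion_map A s)"
    by (simp add: incl Gm_times_Gm_def)
qed

lemma one_motive_diagram_inclusion:
  "one_motive_diagram k (inclusion_motive k M :: ('k, 'u::infinite) inclusion_motive_type)"
  unfolding one_motive_diagram_def inclusion_motive_def one_motive.simps
proof (intro conjI)
  show "short_exact k (Gm_times_Gm :: ('k, 'u, 'u \<times> 'u) group_functor) (\<lambda>A x. x) Gm_times_Gm (\<lambda>A z. ()) zero_sheaf"
    unfolding zero_sheaf_eq_trivial by (rule short_exact_id_trivial[OF fppf_sheaf_Gm])
  show "is_zero_sheaf k (zero_sheaf :: ('k, 'u, unit) group_functor)"
    unfolding zero_sheaf_eq_trivial is_zero_sheaf_def using fppf_sheaf_trivial by auto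
qed (rule fppf_sheaf_constant[OF comm_group_G] sheaf_hom_inclusion)+

lemma Deligne_inclusion:
  fixes r :: nat
  assumes "G \<cong> free_Abelian_group {..<r}"
  shows "Deligne_one_motive k (inclusion_motive k M :: ('k, 'u::infinite) inclusion_motive_type)"
  unfolding Deligne_one_motive_def
proof (intro conjI one_motive_diagram_inclusion)
qed (simp_all add: inclusion_motive_def lattice_scheme_constant[OF comm_group_G assms] torus_Gm)

text \<open>Y is itself finite flat, with zero lattice as quotient, and X is itself a torus, with
  zero finite flat quotient. The second assumption is about the latter zero sheaf, with sections in
  \<open>'u\<close>.\<close>

lemma torsion_inclusion:
  assumes "finite_flat_group_scheme k (constant_sheaf G :: ('k, 'u::infinite, 'k \<times> 'k \<Rightarrow> 'u) group_functor)"
    and "\<And>z. finite_flat_group_scheme k (trivial_sheaf z :: ('k, 'u, 'u) group_functor)"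
  shows "torsion_one_motive k (inclusion_motive k M :: ('k, 'u) inclusion_motive_type)"
  unfolding torsion_one_motive_def
proof (intro conjI one_motive_diagram_inclusion)
  show "extension_of_by k (Ypart (inclusion_motive k M :: ('k, 'u) inclusion_motive_type))
      (lattice_scheme k) (finite_flat_group_scheme k)"
    unfolding inclusion_motive_def one_motive.simps
    by (rule extension_of_by_trivial) (rule fppf_sheaf_constant[OF comm_group_G] assms(1) lattice_scheme_trivial)+
  show "extension_of_by k (Xpart (inclusion_motive k M :: ('k, 'u) inclusion_motive_type))
      (finite_flat_group_scheme k) (torus k)"
    unfolding inclusion_motive_def one_motive.simps
    by (rule extension_of_by_trivial) (rule fppf_sheaf_Gm torus_Gm assms(2))+
qed

end

section \<open>Finite constant group schemes\<close>

text \<open>The algebra of functions from I to k, known through its projections: the carrier has to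
  lie in \<open>'u\<close>, so its elements are not literally functions. The last two axioms
  identify an element with an arbitrary family of coordinates.\<close>

locale split_algebra = ring_hom_cring k E \<sigma>
  for k :: "'k ring" and E :: "'u ring" and \<sigma> +
  fixes I :: "'g set" and \<pi> :: "'g \<Rightarrow> 'u \<Rightarrow> 'k"
  assumes finite_I: "finite I" and \<pi>_hom: "i \<in> I \<Longrightarrow> \<pi> i \<in> ring_hom E k"
    and \<pi>_\<sigma>: "i \<in> I \<Longrightarrow> c \<in> carrier k \<Longrightarrow> \<pi> i (\<sigma> c) = c"
    and \<pi>_inj: "x \<in> carrier E \<Longrightarrow> y \<in> carrier E \<Longrightarrow> (\<And>i. i \<in> I \<Longrightarrow> \<pi> i x = \<pi> i y) \<Longrightarrow> x = y"
    and \<pi>_surj: "(\<And>i. i \<in> I \<Longrightarrow> v i \<in> carrier k) \<Longrightarrow> \<exists>x\<in>carrier E. \<forall>i\<in>I. \<pi> i x = v i"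
begin

definition \<delta> :: "'g \<Rightarrow> 'u" where
  "\<delta> i = (SOME x. x \<in> carrier E \<and> (\<forall>j\<in>I. \<pi> j x = (if j = i then \<one>\<^bsub>k\<^esub> else \<zero>\<^bsub>k\<^esub>)))"

lemma \<delta>: "\<delta> i \<in> carrier E" "j \<in> I \<Longrightarrow> \<pi> j (\<delta> i) = (if j = i then \<one>\<^bsub>k\<^esub> else \<zero>\<^bsub>k\<^esub>)"
proof -
  have "\<exists>x. x \<in> carrier E \<and> (\<forall>j\<in>I. \<pi> j x = (if j = i then \<one>\<^bsub>k\<^esub> else \<zero>\<^bsub>k\<^esub>))"
    using \<pi>_surj[of "\<lambda>j. if j = i then \<one>\<^bsub>k\<^esub> else \<zero>\<^bsub>k\<^esub>"] by (auto simp: Bex_def)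
  from someI_ex[OF this] show "\<delta> i \<in> carrier E" "j \<in> I \<Longrightarrow> \<pi> j (\<delta> i) = (if j = i then \<one>\<^bsub>k\<^esub> else \<zero>\<^bsub>k\<^esub>)"
    by (auto simp: \<delta>_def)
qed

lemma \<pi>_cring: "i \<in> I \<Longrightarrow> ring_hom_cring E k (\<pi> i)"
  using \<pi>_hom by (intro ring_hom_cring.intro ring_hom_cring_axioms.intro S.is_cring R.is_cring)

lemma \<pi>_closed: "i \<in> I \<Longrightarrow> x \<in> carrier E \<Longrightarrow> \<pi> i x \<in> carrier k"
  using ring_hom_closed[OF \<pi>_hom] .

lemma expansion: "x \<in> carrier E \<Longrightarrow> x = (\<Oplus>\<^bsub>E\<^esub>i\<in>I. \<sigma> (\<pi> i x) \<otimes>\<^bsub>E\<^esub> \<delta> i)"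
proof (rule \<pi>_inj)
  assume x: "x \<in> carrier E"
  have c: "\<sigma> (\<pi> i x) \<otimes>\<^bsub>E\<^esub> \<delta> i \<in> carrier E" if "i \<in> I" for i using \<delta> \<pi>_closed[OF that x] by simp
  then show "(\<Oplus>\<^bsub>E\<^esub>i\<in>I. \<sigma> (\<pi> i x) \<otimes>\<^bsub>E\<^esub> \<delta> i) \<in> carrier E" by (intro S.finsum_closed) auto
  fix j assume j: "j \<in> I"
  interpret \<pi>: ring_hom_cring E k "\<pi> j" by (rule \<pi>_cring[OF j])
  have "\<pi> j (\<Oplus>\<^bsub>E\<^esub>i\<in>I. \<sigma> (\<pi> i x) \<otimes>\<^bsub>E\<^esub> \<delta> i) = (\<Oplus>\<^bsub>k\<^esub>i\<in>I. if j = i then \<pi> i x else \<zero>\<^bsub>k\<^esub>)"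
    using c \<delta> \<pi>_closed[OF _ x] j
    by (subst \<pi>.hom_finsum) (auto simp: \<pi>_\<sigma> intro!: R.finsum_cong')
  also have "\<dots> = \<pi> j x"
    using j finite_I \<pi>_closed[OF _ x] by (intro R.add.finprod_singleton) auto
  finally show "\<pi> j x = \<pi> j (\<Oplus>\<^bsub>E\<^esub>i\<in>I. \<sigma> (\<pi> i x) \<otimes>\<^bsub>E\<^esub> \<delta> i)" by simp
qed

text \<open>The elements \<open>\<delta> i\<close> form a basis of E over k. The coordinate matrix
  of the \<open>b i\<close> gives the factorization, and a projection applied to the relation shows
  that the corresponding column is killed.\<close>

lemma flat_\<sigma>: "flat_hom k E \<sigma>"
  unfolding flat_hom_def
proof (intro allI impI; elim conjE)
  fix n :: nat and a b
  assume a: "a \<in> {..<n} \<rightarrow> carrier k" and b: "b \<in> {..<n} \<rightarrow> carrier E"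
    and eq: "(\<Oplus>\<^bsub>E\<^esub>i\<in>{..<n}. \<sigma> (a i) \<otimes>\<^bsub>E\<^esub> b i) = \<zero>\<^bsub>E\<^esub>"
  obtain h where h: "bij_betw h {..<card I} I"
    using ex_bij_betw_nat_finite[OF finite_I] by (auto simp: atLeast0LessThan)
  have hI: "h j \<in> I" if "j < card I" for j using h that by (auto simp: bij_betw_def)
  let ?c = "\<lambda>i j. \<pi> (h j) (b i)" and ?d = "\<lambda>j. \<delta> (h j)"
  have "b i = (\<Oplus>\<^bsub>E\<^esub>j\<in>{..<card I}. \<sigma> (?c i j) \<otimes>\<^bsub>E\<^esub> ?d j)" if "i < n" for i
  proof -
    have bi: "b i \<in> carrier E" using b that by auto
    have "b i = (\<Oplus>\<^bsub>E\<^esub>i'\<in>h ` {..<card I}. \<sigma> (\<pi> i' (b i)) \<otimes>\<^bsub>E\<^esub> \<delta> i')"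
      using expansion[OF bi] h by (simp add: bij_betw_def)
    also have "\<dots> = (\<Oplus>\<^bsub>E\<^esub>j\<in>{..<card I}. \<sigma> (?c i j) \<otimes>\<^bsub>E\<^esub> ?d j)"
      using \<pi>_closed[OF _ bi] \<delta>(1) h by (intro S.finsum_reindex) (auto simp: bij_betw_def)
    finally show ?thesis .
  qed
  moreover have "(\<Oplus>\<^bsub>k\<^esub>i\<in>{..<n}. a i \<otimes>\<^bsub>k\<^esub> ?c i j) = \<zero>\<^bsub>k\<^esub>" if j: "j < card I" for j
  proof -
    interpret \<pi>: ring_hom_cring E k "\<pi> (h j)" by (rule \<pi>_cring[OF hI[OF j]])
    have "(\<Oplus>\<^bsub>k\<^esub>i\<in>{..<n}. a i \<otimes>\<^bsub>k\<^esub> ?c i j) = \<pi> (h j) (\<Oplus>\<^bsub>E\<^esub>i\<in>{..<n}. \<sigma> (a i) \<otimes>\<^bsub>E\<^esub> b i)"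
      using a b hI[OF j] by (subst \<pi>.hom_finsum) (auto simp: \<pi>_\<sigma> Pi_iff intro!: R.finsum_cong')
    then show ?thesis by (simp add: eq)
  qed
  moreover have "?c i j \<in> carrier k" if "i < n" "j < card I" for i j
    using \<pi>_closed[OF hI[OF that(2)]] b that(1) by auto
  ultimately show "\<exists>(m::nat) c d. (\<forall>i<n. \<forall>j<m. c i j \<in> carrier k) \<and> d \<in> {..<m} \<rightarrow> carrier E \<and>
      (\<forall>i<n. b i = (\<Oplus>\<^bsub>E\<^esub>j\<in>{..<m}. \<sigma> (c i j) \<otimes>\<^bsub>E\<^esub> d j)) \<and>
      (\<forall>j<m. (\<Oplus>\<^bsub>k\<^esub>i\<in>{..<n}. a i \<otimes>\<^bsub>k\<^esub> c i j) = \<zero>\<^bsub>k\<^esub>)"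
    using \<delta>(1)
    by - (rule exI[of _ "card I"], rule exI[of _ ?c], rule exI[of _ ?d], auto)
qed

text \<open>The sum runs over a set of generators and not over a family;
  \<open>\<one> \<noteq> \<zero>\<close> makes the elements \<open>\<delta> i\<close> distinct, so
  that this set can be reindexed by I.\<close>

lemma finite_generation:
  assumes "\<one>\<^bsub>k\<^esub> \<noteq> \<zero>\<^bsub>k\<^esub>" and y: "y \<in> carrier E"
  shows "\<exists>c\<in>\<delta> ` I \<rightarrow> carrier k. y = (\<Oplus>\<^bsub>E\<^esub>t\<in>\<delta> ` I. \<sigma> (c t) \<otimes>\<^bsub>E\<^esub> t)"
proof -
  have inj: "inj_on \<delta> I"
    using \<delta>(2) assms(1) by (intro inj_onI) metis
  let ?c = "\<lambda>t. \<pi> (inv_into I \<delta> t) y"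
  have c: "?c (\<delta> i) = \<pi> i y" if "i \<in> I" for i using inj that by simp
  have "(\<Oplus>\<^bsub>E\<^esub>t\<in>\<delta> ` I. \<sigma> (?c t) \<otimes>\<^bsub>E\<^esub> t) = (\<Oplus>\<^bsub>E\<^esub>i\<in>I. \<sigma> (?c (\<delta> i)) \<otimes>\<^bsub>E\<^esub> \<delta> i)"
    using \<pi>_closed[OF _ y] \<delta>(1) inj c by (intro S.finsum_reindex) auto
  also have "\<dots> = (\<Oplus>\<^bsub>E\<^esub>i\<in>I. \<sigma> (\<pi> i y) \<otimes>\<^bsub>E\<^esub> \<delta> i)"
    using \<pi>_closed[OF _ y] \<delta>(1) c by (intro S.finsum_cong') auto
  also have "\<dots> = y" using expansion[OF y] by simp
  finally have "y = (\<Oplus>\<^bsub>E\<^esub>t\<in>\<delta> ` I. \<sigma> (?c t) \<otimes>\<^bsub>E\<^esub> t)" by simp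
  moreover have "?c \<in> \<delta> ` I \<rightarrow> carrier k" using c \<pi>_closed[OF _ y] by auto
  ultimately show ?thesis by (rule bexI[where x = ?c])
qed

end

locale split_group_algebra = split_algebra k E \<sigma> "carrier G" \<pi> + constant_section_group E G
  for k :: "'k ring" and E :: "'u ring" and \<sigma> and G :: "'g monoid" and \<pi>
begin

text \<open>The section over \<open>E\<close> that equals \<open>g\<close> on the \<open>g\<close>-th point of \<open>Spec E\<close>; every other section is its pullback.\<close>

definition universal :: "'g \<Rightarrow> 'u" where "universal g = (if g \<in> carrier G then \<delta> g else \<zero>\<^bsub>E\<^esub>)"

lemma universal_closed: "universal \<in> carrier (constant_sections G E)"
  unfolding in_S_iff
proof (intro conjI allI impI)
  have sub: "support universal \<subseteq> carrier G" by (auto simp: universal_def support_def)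
  show "finite (support universal)" by (rule finite_subset[OF sub finite_I])
  have c: "universal g \<in> carrier E" for g using \<delta>(1) by (simp add: universal_def)
  have "(\<Oplus>\<^bsub>E\<^esub>g\<in>support universal. universal g) = (\<Oplus>\<^bsub>E\<^esub>g\<in>carrier G. universal g)"
    using c by (intro S.add.finprod_mono_neutral_cong_left[OF finite_I sub]) (auto simp: support_def)
  also have "\<dots> = (\<Oplus>\<^bsub>E\<^esub>g\<in>carrier G. \<sigma> (\<pi> g \<one>\<^bsub>E\<^esub>) \<otimes>\<^bsub>E\<^esub> \<delta> g)"
    using \<delta>(1) ring_hom_one[OF \<pi>_hom] by (intro S.finsum_cong') (auto simp: universal_def)
  finally show "(\<Oplus>\<^bsub>E\<^esub>g\<in>support universal. universal g) = \<one>\<^bsub>E\<^esub>" using expansion[OF S.one_closed] by simp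
  show "universal g \<otimes>\<^bsub>E\<^esub> universal h = \<zero>\<^bsub>E\<^esub>" if "g \<noteq> h" for g h
  proof (rule \<pi>_inj)
    fix i assume i: "i \<in> carrier G"
    interpret \<pi>: ring_hom_cring E k "\<pi> i" by (rule \<pi>_cring[OF i])
    show "\<pi> i (universal g \<otimes>\<^bsub>E\<^esub> universal h) = \<pi> i \<zero>\<^bsub>E\<^esub>"
      using c \<delta> i that by (auto simp: universal_def ring_hom_cring.hom_zero[OF \<pi>_cring])
  qed (use c in auto)
qed (use \<delta>(1) in \<open>auto simp: universal_def\<close>)

text \<open>An element v of E is a function on G. It is sent to the element of A that equals v(g) on
  the piece where y has the value g, and all identities are checked on the pieces of y.\<close>

lemma universal_hom:
  fixes A :: "('k, 'v) alg"
  assumes A: "is_alg k A" and y: "y \<in> carrier (constant_sections G (fst A))"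
  shows "\<exists>f\<in>ring_hom E (fst A). (\<forall>c\<in>carrier k. f (\<sigma> c) = snd A c) \<and> f \<circ> universal = y"
proof -
  interpret A: constant_section_group "fst A" G by (rule constant_section_group_alg[OF A G.comm_group_axioms])
  interpret s: ring_hom_cring k "fst A" "snd A"
    using A R.is_cring A.R.is_cring by (auto simp: is_alg_def intro: ring_hom_cring.intro ring_hom_cring_axioms.intro)
  define f where "f v = A.evaluate y (\<lambda>g. snd A (\<pi> g v))" for v
  have c: "snd A (\<pi> g v) \<in> carrier (fst A)" if "v \<in> carrier E" "g \<in> carrier G" for g v
    using \<pi>_closed that by simp
  have fc: "f v \<in> carrier (fst A)" if "v \<in> carrier E" for v
    unfolding f_def using y c that by (intro A.evaluate_closed) auto
  have at: "f v \<otimes>\<^bsub>fst A\<^esub> y g = snd A (\<pi> g v) \<otimes>\<^bsub>fst A\<^esub> y g" if "v \<in> carrier E" "g \<in> carrier G" for v g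
    unfolding f_def using A.evaluate_at[OF y A.has_value_self[OF y that(2)] _ c[OF that(1)]] y by simp
  have eqI: "x = x'" if x: "x \<in> carrier (fst A)" "x' \<in> carrier (fst A)"
    and "\<And>g. g \<in> carrier G \<Longrightarrow> x \<otimes>\<^bsub>fst A\<^esub> y g = x' \<otimes>\<^bsub>fst A\<^esub> y g" for x x'
    using that(3) by (intro A.detecting_eq[OF A.detecting_section[OF y] x]) auto
  have hom: "f \<in> ring_hom E (fst A)"
  proof (rule ring_hom_memI)
    fix v w assume v: "v \<in> carrier E" and w: "w \<in> carrier E"
    show "f v \<in> carrier (fst A)" by (rule fc[OF v])
    show "f (v \<otimes>\<^bsub>E\<^esub> w) = f v \<otimes>\<^bsub>fst A\<^esub> f w"
    proof (rule eqI)
      fix g assume g: "g \<in> carrier G"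
      interpret \<pi>: ring_hom_cring E k "\<pi> g" by (rule \<pi>_cring[OF g])
      have yg: "y g \<in> carrier (fst A)" using y by simp
      have "f v \<otimes>\<^bsub>fst A\<^esub> f w \<otimes>\<^bsub>fst A\<^esub> y g = f v \<otimes>\<^bsub>fst A\<^esub> (snd A (\<pi> g w) \<otimes>\<^bsub>fst A\<^esub> y g)"
        using fc v w yg at[OF w g] by (simp add: A.R.m_assoc)
      also have "\<dots> = snd A (\<pi> g w) \<otimes>\<^bsub>fst A\<^esub> (f v \<otimes>\<^bsub>fst A\<^esub> y g)"
        using fc[OF v] c[OF w g] yg by (rule A.R.m_lcomm)
      also have "\<dots> = snd A (\<pi> g (v \<otimes>\<^bsub>E\<^esub> w)) \<otimes>\<^bsub>fst A\<^esub> y g"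
        using at[OF v g] c[OF v g] c[OF w g] v w yg by (simp add: A.R.m_ac)
      finally show "f (v \<otimes>\<^bsub>E\<^esub> w) \<otimes>\<^bsub>fst A\<^esub> y g = f v \<otimes>\<^bsub>fst A\<^esub> f w \<otimes>\<^bsub>fst A\<^esub> y g"
        using at[of "v \<otimes>\<^bsub>E\<^esub> w" g] v w g by simp
    qed (use fc v w in auto)
    show "f (v \<oplus>\<^bsub>E\<^esub> w) = f v \<oplus>\<^bsub>fst A\<^esub> f w"
    proof (rule eqI)
      fix g assume g: "g \<in> carrier G"
      interpret \<pi>: ring_hom_cring E k "\<pi> g" by (rule \<pi>_cring[OF g])
      have yg: "y g \<in> carrier (fst A)" using y by simp
      show "f (v \<oplus>\<^bsub>E\<^esub> w) \<otimes>\<^bsub>fst A\<^esub> y g = (f v \<oplus>\<^bsub>fst A\<^esub> f w) \<otimes>\<^bsub>fst A\<^esub> y g"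
        using at[of "v \<oplus>\<^bsub>E\<^esub> w" g] at[OF v g] at[OF w g] c[OF v g] c[OF w g] v w g yg fc
        by (simp add: A.R.l_distr)
    qed (use fc v w in auto)
  next
    show "f \<one>\<^bsub>E\<^esub> = \<one>\<^bsub>fst A\<^esub>"
    proof (rule eqI)
      fix g assume g: "g \<in> carrier G"
      show "f \<one>\<^bsub>E\<^esub> \<otimes>\<^bsub>fst A\<^esub> y g = \<one>\<^bsub>fst A\<^esub> \<otimes>\<^bsub>fst A\<^esub> y g"
        using at[OF _ g, of "\<one>\<^bsub>E\<^esub>"] ring_hom_one[OF \<pi>_hom[OF g]] by simp
    qed (use fc in auto)
  qed
  moreover have "f (\<sigma> c) = snd A c" if c: "c \<in> carrier k" for c
  proof (rule eqI)
    fix g assume g: "g \<in> carrier G"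
    show "f (\<sigma> c) \<otimes>\<^bsub>fst A\<^esub> y g = snd A c \<otimes>\<^bsub>fst A\<^esub> y g"
      using at[OF _ g, of "\<sigma> c"] c \<pi>_\<sigma>[OF g c] by simp
  qed (use fc c in auto)
  moreover have "f \<circ> universal = y"
  proof
    fix g
    show "(f \<circ> universal) g = y g"
    proof (cases "g \<in> carrier G")
      case True
      have "f (\<delta> g) = y g"
      proof (rule eqI)
        fix h assume h: "h \<in> carrier G"
        show "f (\<delta> g) \<otimes>\<^bsub>fst A\<^esub> y h = y g \<otimes>\<^bsub>fst A\<^esub> y h"
          using at[OF \<delta>(1) h] \<delta>(2)[OF h] A.S_orthogonal[OF y, of g h] A.has_value_self[OF y h] y
          by (auto simp: A.has_value_def)
      qed (use fc \<delta>(1) y in auto)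
      then show ?thesis using True by (simp add: universal_def)
    next
      case False
      interpret f: ring_hom_cring E "fst A" f
        using hom by (intro ring_hom_cring.intro ring_hom_cring_axioms.intro S.is_cring A.R.is_cring)
      show ?thesis using False A.S_outside[OF y False] by (simp add: universal_def)
    qed
  qed
  ultimately show ?thesis by blast
qed

text \<open>A homomorphism out of E is determined by its effect on constants and on the basis
  \<open>\<delta> g\<close>, whose members are the values of \<open>universal\<close> on G.\<close>

lemma universal_unique:
  assumes A: "cring A" and f: "f \<in> ring_hom E A" "f' \<in> ring_hom E A"
    and s: "\<And>c. c \<in> carrier k \<Longrightarrow> f (\<sigma> c) = f' (\<sigma> c)" and u: "f \<circ> universal = f' \<circ> universal"
    and z: "z \<in> carrier E"
  shows "f z = f' z"
proof -
  interpret f: ring_hom_cring E A f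
    using f A by (intro ring_hom_cring.intro ring_hom_cring_axioms.intro S.is_cring)
  interpret f': ring_hom_cring E A f'
    using f A by (intro ring_hom_cring.intro ring_hom_cring_axioms.intro S.is_cring)
  have d: "f (\<delta> g) = f' (\<delta> g)" if "g \<in> carrier G" for g
    using fun_cong[OF u, of g] that by (simp add: universal_def)
  have "f z = f (\<Oplus>\<^bsub>E\<^esub>g\<in>carrier G. \<sigma> (\<pi> g z) \<otimes>\<^bsub>E\<^esub> \<delta> g)" using expansion[OF z] by simp
  also have "\<dots> = (\<Oplus>\<^bsub>A\<^esub>g\<in>carrier G. f (\<sigma> (\<pi> g z)) \<otimes>\<^bsub>A\<^esub> f (\<delta> g))"
    using \<pi>_closed[OF _ z] \<delta>(1) by (subst f.hom_finsum) (auto intro!: f.S.finsum_cong')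
  also have "\<dots> = (\<Oplus>\<^bsub>A\<^esub>g\<in>carrier G. f' (\<sigma> (\<pi> g z)) \<otimes>\<^bsub>A\<^esub> f' (\<delta> g))"
    using \<pi>_closed[OF _ z] \<delta>(1) by (intro f.S.finsum_cong') (auto simp: d s)
  also have "\<dots> = f' (\<Oplus>\<^bsub>E\<^esub>g\<in>carrier G. \<sigma> (\<pi> g z) \<otimes>\<^bsub>E\<^esub> \<delta> g)"
    using \<pi>_closed[OF _ z] \<delta>(1) by (subst f'.hom_finsum) (auto intro!: f.S.finsum_cong')
  also have "\<dots> = f' z" using expansion[OF z] by simp
  finally show ?thesis .
qed

lemma finite_flat_constant:
  assumes "\<one>\<^bsub>k\<^esub> \<noteq> \<zero>\<^bsub>k\<^esub>"
  shows "finite_flat_group_scheme k (constant_sheaf G :: ('k, 'u, 'g \<Rightarrow> 'u) group_functor)"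
  unfolding finite_flat_group_scheme_def
proof (rule conjI, rule group_presheaf_constant[OF G.comm_group_axioms],
    rule exI[of _ "(E, \<sigma>)"], rule exI[of _ universal], intro conjI)
  show E: "is_alg k (E, \<sigma>)" using S.is_cring by (simp add: is_alg_def)
  show "flat_hom k (fst (E, \<sigma>)) (snd (E, \<sigma>))" using flat_\<sigma> by simp
  show "\<exists>T. finite T \<and> T \<subseteq> carrier (fst (E, \<sigma>)) \<and>
      (\<forall>y\<in>carrier (fst (E, \<sigma>)). \<exists>c\<in>T \<rightarrow> carrier k.
         y = (\<Oplus>\<^bsub>fst (E, \<sigma>)\<^esub>t\<in>T. snd (E, \<sigma>) (c t) \<otimes>\<^bsub>fst (E, \<sigma>)\<^esub> t))"
    unfolding fst_conv snd_conv
    using finite_I \<delta>(1) finite_generation[OF assms] by (intro exI[of _ "\<delta> ` carrier G"] conjI) auto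
  show "universal \<in> carrier (sections (constant_sheaf G) (E, \<sigma>))" using universal_closed by simp
  show "\<forall>A. is_alg k A \<longrightarrow> (\<forall>y\<in>carrier (sections (constant_sheaf G) A).
     (\<exists>f. is_alg_hom k (E, \<sigma>) A f \<and> restr (constant_sheaf G) (E, \<sigma>) A f universal = y) \<and>
     (\<forall>f g. is_alg_hom k (E, \<sigma>) A f \<and> is_alg_hom k (E, \<sigma>) A g \<and>
        restr (constant_sheaf G) (E, \<sigma>) A f universal = y \<and> restr (constant_sheaf G) (E, \<sigma>) A g universal = y \<longrightarrow>
        (\<forall>z\<in>carrier (fst (E, \<sigma>)). f z = g z)))"
  proof (intro allI impI ballI conjI; (elim conjE)?)
    fix A :: "('k, 'u) alg" and y assume A: "is_alg k A" and y: "y \<in> carrier (sections (constant_sheaf G) A)"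
    show "\<exists>f. is_alg_hom k (E, \<sigma>) A f \<and> restr (constant_sheaf G) (E, \<sigma>) A f universal = y"
      using universal_hom[OF A, of y] y A E by (auto simp: is_alg_hom_def)
    fix f g z
    assume f: "is_alg_hom k (E, \<sigma>) A f" and g: "is_alg_hom k (E, \<sigma>) A g"
      and fy: "restr (constant_sheaf G) (E, \<sigma>) A f universal = y"
      and gy: "restr (constant_sheaf G) (E, \<sigma>) A g universal = y" and z: "z \<in> carrier (fst (E, \<sigma>))"
    show "f z = g z"
    proof (rule universal_unique[where A = "fst A" and f = f and f' = g])
      show "cring (fst A)" by (rule is_alg_homD(7)[OF f])
      show "f \<in> ring_hom E (fst A)" "g \<in> ring_hom E (fst A)"
        using is_alg_homD(4)[OF f] is_alg_homD(4)[OF g] by (simp_all only: fst_conv)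
      show "f (\<sigma> c) = g (\<sigma> c)" if "c \<in> carrier k" for c
        using is_alg_homD(5)[OF f that] is_alg_homD(5)[OF g that] by (simp only: snd_conv)
      show "f \<circ> universal = g \<circ> universal" using fy gy by (simp only: constant_sheaf_simps)
      show "z \<in> carrier E" using z by (simp only: fst_conv)
    qed
  qed
qed

end

text \<open>The one-point sheaf and the constant sheaf of the trivial group have a single section
  over each algebra. For both, representability says that E has exactly one map to each algebra, so
  the same E represents them.\<close>

lemma finite_flat_trivial:
  fixes G :: "'g monoid"
  assumes G: "comm_group G" "carrier G = {\<one>\<^bsub>G\<^esub>}"
    and ff: "finite_flat_group_scheme k (constant_sheaf G :: ('k, 'u, 'g \<Rightarrow> 'u) group_functor)"
  shows "finite_flat_group_scheme k (trivial_sheaf z :: ('k, 'u, 's) group_functor)"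
proof -
  let ?F = "constant_sheaf G :: ('k, 'u, 'g \<Rightarrow> 'u) group_functor"
  have "\<exists>E x. is_alg k E \<and> flat_hom k (fst E) (snd E) \<and>
    (\<exists>T. finite T \<and> T \<subseteq> carrier (fst E) \<and> (\<forall>y\<in>carrier (fst E). \<exists>c\<in>T \<rightarrow> carrier k.
       y = (\<Oplus>\<^bsub>fst E\<^esub>t\<in>T. snd E (c t) \<otimes>\<^bsub>fst E\<^esub> t))) \<and> x \<in> carrier (sections ?F E) \<and>
    (\<forall>A. is_alg k A \<longrightarrow> (\<forall>y\<in>carrier (sections ?F A).
           (\<exists>f. is_alg_hom k E A f \<and> restr ?F E A f x = y) \<and>
           (\<forall>f g. is_alg_hom k E A f \<and> is_alg_hom k E A g \<and>
              restr ?F E A f x = y \<and> restr ?F E A g x = y \<longrightarrow> (\<forall>z\<in>carrier (fst E). f z = g z))))"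
    using ff unfolding finite_flat_group_scheme_def by (rule conjunct2)
  then obtain E x where all: "is_alg k E \<and> flat_hom k (fst E) (snd E) \<and>
    (\<exists>T. finite T \<and> T \<subseteq> carrier (fst E) \<and> (\<forall>y\<in>carrier (fst E). \<exists>c\<in>T \<rightarrow> carrier k.
       y = (\<Oplus>\<^bsub>fst E\<^esub>t\<in>T. snd E (c t) \<otimes>\<^bsub>fst E\<^esub> t))) \<and> x \<in> carrier (sections ?F E) \<and>
    (\<forall>A. is_alg k A \<longrightarrow> (\<forall>y\<in>carrier (sections ?F A).
           (\<exists>f. is_alg_hom k E A f \<and> restr ?F E A f x = y) \<and>
           (\<forall>f g. is_alg_hom k E A f \<and> is_alg_hom k E A g \<and>
              restr ?F E A f x = y \<and> restr ?F E A g x = y \<longrightarrow> (\<forall>z\<in>carrier (fst E). f z = g z))))"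
    by (elim exE)
  note E = conjunct1[OF all] conjunct1[OF conjunct2[OF all]] conjunct1[OF conjunct2[OF conjunct2[OF all]]]
  note x = conjunct1[OF conjunct2[OF conjunct2[OF conjunct2[OF all]]]]
  note u = conjunct2[OF conjunct2[OF conjunct2[OF conjunct2[OF all]]]]
  have single: "carrier (sections ?F A) = {\<one>\<^bsub>sections ?F A\<^esub>}" if "is_alg k A" for A
    using constant_section_group.trivial_sections[OF constant_section_group_alg[OF that G(1)] G(2)] by simp
  have r: "restr ?F E A f x = \<one>\<^bsub>sections ?F A\<^esub>" if "is_alg_hom k E A f" for A f
  proof -
    have "restr ?F E A f x \<in> carrier (sections ?F A)"
      using group_presheafD(2)[OF group_presheaf_constant[OF G(1)] that] x by (rule hom_in_carrier)
    then show ?thesis using single[OF is_alg_homD(2)[OF that]] by simp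
  qed
  have p: "group_presheaf k (trivial_sheaf z :: ('k, 'u, 's) group_functor)"
    using fppf_sheaf_trivial[of k z] unfolding fppf_sheaf_def by (rule conjunct1)
  show ?thesis
    unfolding finite_flat_group_scheme_def
  proof (rule conjI[OF p], rule exI[of _ E], rule exI[of _ z], intro conjI E allI impI ballI; (elim conjE)?)
    show "z \<in> carrier (sections (trivial_sheaf z) E)" by simp
    fix A :: "('k, 'u) alg" and y assume A: "is_alg k A" and y: "y \<in> carrier (sections (trivial_sheaf z) A)"
    have uA: "(\<exists>f. is_alg_hom k E A f \<and> restr ?F E A f x = \<one>\<^bsub>sections ?F A\<^esub>) \<and>
           (\<forall>f g. is_alg_hom k E A f \<and> is_alg_hom k E A g \<and>
              restr ?F E A f x = \<one>\<^bsub>sections ?F A\<^esub> \<and> restr ?F E A g x = \<one>\<^bsub>sections ?F A\<^esub> \<longrightarrow>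
              (\<forall>z\<in>carrier (fst E). f z = g z))"
      by (rule bspec[OF mp[OF spec[OF u] A]]) (use single[OF A] in blast)
    show "\<exists>f. is_alg_hom k E A f \<and> restr (trivial_sheaf z) E A f z = y"
      using conjunct1[OF uA] y by auto
    show "f w = g w" if "is_alg_hom k E A f" "is_alg_hom k E A g" "w \<in> carrier (fst E)" for f g w
      using conjunct2[OF uA] r that by blast
  qed
qed

section \<open>Subgroups of the integers, split algebras, free groups and a shifted linear
  system\<close>

lemma int_subgroup_principal:
  fixes J :: "int set"
  assumes "0 \<in> J" and diff: "\<And>x y. x \<in> J \<Longrightarrow> y \<in> J \<Longrightarrow> x - y \<in> J"
  shows "\<exists>d\<in>J. d \<ge> 0 \<and> (\<forall>x\<in>J. d dvd x)"
proof (cases "J = {0}")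
  case False
  have neg: "- x \<in> J" if "x \<in> J" for x using diff[OF assms(1) that] by simp
  have add: "x + y \<in> J" if "x \<in> J" "y \<in> J" for x y using diff[OF that(1) neg[OF that(2)]] by simp
  have nat_mult: "int n * x \<in> J" if "x \<in> J" for n x
    by (induction n) (use assms(1) add that in \<open>auto simp: algebra_simps\<close>)
  have mult: "k * x \<in> J" if "x \<in> J" for k x
    using nat_mult[OF that, of "nat k"] nat_mult[OF neg[OF that], of "nat (- k)"] by (cases "k \<ge> 0") auto
  obtain x where "x \<in> J" "x \<noteq> 0" using False assms(1) by blast
  then have "\<exists>n. n > 0 \<and> int n \<in> J"
    using neg[of x] by (intro exI[of _ "nat \<bar>x\<bar>"]) (auto simp: abs_if)
  then obtain n where n: "n > 0" "int n \<in> J" and least: "\<And>m. m < n \<Longrightarrow> \<not> (m > 0 \<and> int m \<in> J)"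
    using exists_least_iff[of "\<lambda>n. n > 0 \<and> int n \<in> J"] by blast
  have "int n dvd y" if "y \<in> J" for y
  proof -
    have "y mod int n = y - (y div int n) * int n" by (simp add: minus_div_mult_eq_mod)
    then have "y mod int n \<in> J" using diff[OF that mult[OF n(2)]] by metis
    then have "int (nat (y mod int n)) \<in> J" using n(1) by simp
    moreover have "nat (y mod int n) < n" using n(1) by (simp add: nat_less_iff)
    ultimately have "\<not> nat (y mod int n) > 0" using least[of "nat (y mod int n)"] by simp
    moreover have "y mod int n \<ge> 0" using n(1) by simp
    ultimately have "y mod int n = 0" by simp
    then show ?thesis by (rule mod_0_imp_dvd)
  qed
  with n show ?thesis by (intro bexI[of _ "int n"]) auto
qed (use assms in auto)

text \<open>With I and k finite there are finitely many functions from I to k, so they embed in the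
  infinite type \<open>'u\<close>; the pointwise ring structure is carried over along the
  embedding.\<close>

lemma ex_split_algebra:
  fixes k :: "'k ring" and I :: "'g set"
  assumes k: "cring k" "finite (carrier k)" and I: "finite I"
  shows "\<exists>(E :: 'u::infinite ring) \<sigma> \<pi>. split_algebra k E \<sigma> I \<pi>"
proof -
  interpret k: cring k by (rule k)
  define P where "P = \<lparr>carrier = I \<rightarrow>\<^sub>E carrier k, monoid.mult = (\<lambda>v w. \<lambda>i\<in>I. v i \<otimes>\<^bsub>k\<^esub> w i),
    one = (\<lambda>i\<in>I. \<one>\<^bsub>k\<^esub>), ring.zero = (\<lambda>i\<in>I. \<zero>\<^bsub>k\<^esub>), ring.add = (\<lambda>v w. \<lambda>i\<in>I. v i \<oplus>\<^bsub>k\<^esub> w i)\<rparr>"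
  have mem: "x i \<in> carrier k" if "x \<in> I \<rightarrow>\<^sub>E carrier k" "i \<in> I" for x i using that by (rule PiE_mem)
  have P: "cring P"
  proof (rule cringI)
    show "abelian_group P"
    proof (rule abelian_groupI)
      fix x assume x: "x \<in> carrier P"
      then show "\<exists>y\<in>carrier P. y \<oplus>\<^bsub>P\<^esub> x = \<zero>\<^bsub>P\<^esub>"
        by (intro bexI[of _ "\<lambda>i\<in>I. \<ominus>\<^bsub>k\<^esub> x i"]) (auto simp: P_def mem k.l_neg intro!: restrict_ext)
      show "\<zero>\<^bsub>P\<^esub> \<oplus>\<^bsub>P\<^esub> x = x"
        using x by (auto simp: P_def mem PiE_def extensional_def fun_eq_iff Pi_iff)
    qed (auto simp: P_def mem k.a_ac intro!: restrict_ext)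
    show "Group.comm_monoid P"
    proof (rule comm_monoidI)
      fix x assume x: "x \<in> carrier P"
      then show "\<one>\<^bsub>P\<^esub> \<otimes>\<^bsub>P\<^esub> x = x"
        by (auto simp: P_def mem PiE_def extensional_def fun_eq_iff Pi_iff)
    qed (auto simp: P_def mem k.m_ac intro!: restrict_ext)
  qed (auto simp: P_def mem k.l_distr intro!: restrict_ext)
  interpret P: cring P by (rule P)
  have "finite (carrier P)" using k I by (simp add: P_def finite_PiE)
  then have "carrier P \<lesssim> (UNIV :: 'u set)" by (rule finite_lepoll_infinite[OF infinite_UNIV])
  then obtain \<iota> :: "('g \<Rightarrow> 'k) \<Rightarrow> 'u" where \<iota>: "inj_on \<iota> (carrier P)" by (auto simp: lepoll_def)
  define E where "E = image_ring \<iota> P"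
  have E: "cring E" unfolding E_def by (rule cring_image_ring[OF P \<iota>])
  have \<iota>h: "\<iota> \<in> ring_hom P E" unfolding E_def by (rule image_ring_hom[OF \<iota>])
  have Ec: "carrier E = \<iota> ` carrier P" by (simp add: E_def image_ring_carrier)
  define \<pi> where "\<pi> i x = inv_into (carrier P) \<iota> x i" for i x
  have \<pi>\<iota>: "\<pi> i (\<iota> v) = v i" if "v \<in> carrier P" for i v using \<iota> that by (simp add: \<pi>_def)
  define \<sigma> where "\<sigma> c = \<iota> (\<lambda>i\<in>I. c)" for c
  have const: "(\<lambda>i\<in>I. c) \<in> carrier P" if "c \<in> carrier k" for c using that by (simp add: P_def)
  have \<sigma>: "\<sigma> \<in> ring_hom k E"
  proof (rule ring_hom_memI)
    fix c c' assume c: "c \<in> carrier k" "c' \<in> carrier k"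
    show "\<sigma> c \<in> carrier E" using const[OF c(1)] by (simp add: \<sigma>_def Ec)
    have "(\<lambda>i\<in>I. c \<otimes>\<^bsub>k\<^esub> c') = (\<lambda>i\<in>I. c) \<otimes>\<^bsub>P\<^esub> (\<lambda>i\<in>I. c')"
      "(\<lambda>i\<in>I. c \<oplus>\<^bsub>k\<^esub> c') = (\<lambda>i\<in>I. c) \<oplus>\<^bsub>P\<^esub> (\<lambda>i\<in>I. c')"
      by (auto simp: P_def intro!: restrict_ext)
    then show "\<sigma> (c \<otimes>\<^bsub>k\<^esub> c') = \<sigma> c \<otimes>\<^bsub>E\<^esub> \<sigma> c'" "\<sigma> (c \<oplus>\<^bsub>k\<^esub> c') = \<sigma> c \<oplus>\<^bsub>E\<^esub> \<sigma> c'"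
      unfolding \<sigma>_def using ring_hom_mult[OF \<iota>h const const] ring_hom_add[OF \<iota>h const const] c by simp_all
  next
    show "\<sigma> \<one>\<^bsub>k\<^esub> = \<one>\<^bsub>E\<^esub>" using ring_hom_one[OF \<iota>h] by (simp add: \<sigma>_def P_def)
  qed
  have "split_algebra k E \<sigma> I \<pi>"
  proof (intro split_algebra.intro split_algebra_axioms.intro ring_hom_cring.intro ring_hom_cring_axioms.intro k(1) E \<sigma> I)
    fix i assume i: "i \<in> I"
    show "\<pi> i \<in> ring_hom E k"
    proof (rule ring_hom_memI)
      fix x y assume "x \<in> carrier E" "y \<in> carrier E"
      then obtain v w where v: "v \<in> carrier P" "x = \<iota> v" and w: "w \<in> carrier P" "y = \<iota> w" by (auto simp: Ec)
      show "\<pi> i x \<in> carrier k" using v i \<pi>\<iota> by (auto simp: P_def)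
      have "x \<otimes>\<^bsub>E\<^esub> y = \<iota> (v \<otimes>\<^bsub>P\<^esub> w)" "x \<oplus>\<^bsub>E\<^esub> y = \<iota> (v \<oplus>\<^bsub>P\<^esub> w)"
        using ring_hom_mult[OF \<iota>h v(1) w(1)] ring_hom_add[OF \<iota>h v(1) w(1)] v w by simp_all
      moreover have "(v \<otimes>\<^bsub>P\<^esub> w) i = v i \<otimes>\<^bsub>k\<^esub> w i" "(v \<oplus>\<^bsub>P\<^esub> w) i = v i \<oplus>\<^bsub>k\<^esub> w i" using i by (simp_all add: P_def)
      ultimately show "\<pi> i (x \<otimes>\<^bsub>E\<^esub> y) = \<pi> i x \<otimes>\<^bsub>k\<^esub> \<pi> i y" "\<pi> i (x \<oplus>\<^bsub>E\<^esub> y) = \<pi> i x \<oplus>\<^bsub>k\<^esub> \<pi> i y"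
        using v w \<pi>\<iota> by simp_all
    next
      show "\<pi> i \<one>\<^bsub>E\<^esub> = \<one>\<^bsub>k\<^esub>"
        using \<pi>\<iota>[OF P.one_closed, of i] ring_hom_one[OF \<iota>h] i by (simp add: P_def)
    qed
    show "\<pi> i (\<sigma> c) = c" if "c \<in> carrier k" for c using \<pi>\<iota>[OF const[OF that]] i by (simp add: \<sigma>_def)
  next
    fix x y assume "x \<in> carrier E" "y \<in> carrier E" and eq: "\<And>i. i \<in> I \<Longrightarrow> \<pi> i x = \<pi> i y"
    then obtain v w where v: "v \<in> carrier P" "x = \<iota> v" and w: "w \<in> carrier P" "y = \<iota> w" by (auto simp: Ec)
    have "v = w" using v w eq \<pi>\<iota> by (intro PiE_ext[of v I "\<lambda>_. carrier k" w]) (auto simp: P_def)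
    then show "x = y" using v w by simp
  next
    fix v :: "'g \<Rightarrow> 'k" assume v: "\<And>i. i \<in> I \<Longrightarrow> v i \<in> carrier k"
    then have "restrict v I \<in> carrier P" by (auto simp: P_def)
    then show "\<exists>x\<in>carrier E. \<forall>i\<in>I. \<pi> i x = v i"
      using \<pi>\<iota>[of "restrict v I"] by (intro bexI[of _ "\<iota> (restrict v I)"]) (auto simp: Ec)
  qed
  then show ?thesis by blast
qed

text \<open>Induction on the number of valuations. The kernel of the last one is free by induction,
  and the image of the last one is generated by its value at some h. If that value is 0, the kernel
  is all of H. Otherwise H is the direct product of the kernel and the powers of h, and the rank
  grows by one. The basis map \<open>\<phi>\<close> is part of the conclusion because the next stage
  extends it.\<close>

lemma (in comm_group) free_of_valuations_aux:
  fixes v :: "nat \<Rightarrow> 'a \<Rightarrow> int"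
  assumes "subgroup H G"
    and "\<And>j x y. j < m \<Longrightarrow> x \<in> H \<Longrightarrow> y \<in> H \<Longrightarrow> v j (x \<otimes> y) = v j x + v j y"
    and "\<And>x. x \<in> H \<Longrightarrow> (\<And>j. j < m \<Longrightarrow> v j x = 0) \<Longrightarrow> x = \<one>"
  shows "\<exists>r \<phi>. (\<forall>c c'. Poly_Mapping.keys c \<subseteq> {..<r} \<longrightarrow> Poly_Mapping.keys c' \<subseteq> {..<r} \<longrightarrow>
      \<phi> (c + c') = \<phi> c \<otimes> \<phi> c') \<and> bij_betw \<phi> {c :: nat \<Rightarrow>\<^sub>0 int. Poly_Mapping.keys c \<subseteq> {..<r}} H"
  using assms
proof (induction m arbitrary: H)
  case 0
  then have "H = {\<one>}" using subgroup.one_closed by fastforce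
  then show ?case by (intro exI[of _ 0] exI[of _ "\<lambda>_. \<one>"]) (auto simp: bij_betw_def)
next
  case (Suc m)
  interpret H: subgroup H G by (rule Suc.prems)
  note add = Suc.prems(2)
  have v1: "v j \<one> = 0" if "j < Suc m" for j using add[OF that H.one_closed H.one_closed] by simp
  have vinv: "v j (inv x) = - v j x" if "j < Suc m" "x \<in> H" for j x
    using add[OF that H.m_inv_closed[OF that(2)]] v1[OF that(1)] that(2) by simp
  let ?K = "{x \<in> H. v m x = 0}"
  have K: "subgroup ?K G"
  proof (rule subgroupI)
    show "?K \<noteq> {}" using v1[of m] H.one_closed by blast
  qed (use vinv[of m] add[of m] in auto)
  have "\<exists>r \<phi>. (\<forall>c c'. Poly_Mapping.keys c \<subseteq> {..<r} \<longrightarrow> Poly_Mapping.keys c' \<subseteq> {..<r} \<longrightarrow>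
      \<phi> (c + c') = \<phi> c \<otimes> \<phi> c') \<and> bij_betw \<phi> {c :: nat \<Rightarrow>\<^sub>0 int. Poly_Mapping.keys c \<subseteq> {..<r}} ?K"
  proof (rule Suc.IH[OF K])
    show "v j (x \<otimes> y) = v j x + v j y" if "j < m" "x \<in> ?K" "y \<in> ?K" for j x y using add that by simp
    show "x = \<one>" if "x \<in> ?K" "\<And>j. j < m \<Longrightarrow> v j x = 0" for x
      using that by (intro Suc.prems(3)) (auto simp: less_Suc_eq)
  qed
  then obtain r \<phi> where hom: "\<And>c c'. Poly_Mapping.keys c \<subseteq> {..<r} \<Longrightarrow> Poly_Mapping.keys c' \<subseteq> {..<r} \<Longrightarrow>
      \<phi> (c + c') = \<phi> c \<otimes> \<phi> c'" and bij: "bij_betw \<phi> {c :: nat \<Rightarrow>\<^sub>0 int. Poly_Mapping.keys c \<subseteq> {..<r}} ?K"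
    by blast
  have "\<exists>d\<in>v m ` H. d \<ge> 0 \<and> (\<forall>x\<in>v m ` H. d dvd x)"
  proof (rule int_subgroup_principal)
    show "0 \<in> v m ` H" using v1[of m] by (intro image_eqI[of _ _ \<one>]) auto
    fix a b assume "a \<in> v m ` H" "b \<in> v m ` H"
    then obtain x y where "x \<in> H" "y \<in> H" "a = v m x" "b = v m y" by blast
    then show "a - b \<in> v m ` H"
      using add[of m x "inv y"] vinv[of m y] by (intro image_eqI[of _ _ "x \<otimes> inv y"]) auto
  qed
  then obtain h where h: "h \<in> H" and dvd: "\<And>x. x \<in> H \<Longrightarrow> v m h dvd v m x" by blast
  show ?case
  proof (cases "v m h = 0")
    case True
    then have "?K = H" using dvd by auto
    then have "bij_betw \<phi> {c. Poly_Mapping.keys c \<subseteq> {..<r}} H" using bij by simp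
    then show ?thesis using hom by (intro exI[of _ r] exI[of _ \<phi>]) simp
  next
    case False
    have hc: "h \<in> carrier G" using h by auto
    have pow_H: "h [^] (q::int) \<in> H" for q
      using h by (simp add: subgroup_int_pow_closed Suc.prems(1))
    have vpow: "v m (h [^] (q::int)) = q * v m h" for q
    proof -
      have nat: "v m (h [^] (n::nat)) = int n * v m h" for n
        by (induction n) (use v1[of m] add[of m] h pow_H[of "int _"] hc in \<open>auto simp: algebra_simps int_pow_int\<close>)
      show ?thesis
      proof (cases "q \<ge> 0")
        case True
        then show ?thesis using nat[of "nat q"] int_pow_int[of G h "nat q"] by simp
      next
        case False
        then show ?thesis
          using nat[of "nat (- q)"] int_pow_int[of G h "nat (- q)"] int_pow_neg[OF hc, of "- q"]
            vinv[OF _ pow_H[of "- q"]] by simp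
      qed
    qed
    \<comment> \<open>Removes coordinate r, which is reserved for the exponent of h.\<close>
    define \<rho> where "\<rho> c = c - frag_cmul (Poly_Mapping.lookup c r) (frag_of r)" for c :: "nat \<Rightarrow>\<^sub>0 int"
    have \<rho>_lookup: "Poly_Mapping.lookup (\<rho> c) i = (if i = r then 0 else Poly_Mapping.lookup c i)" for c i
      by (simp add: \<rho>_def lookup_minus lookup_single when_def)
    have \<rho>_keys: "Poly_Mapping.keys (\<rho> c) \<subseteq> {..<r}" if "Poly_Mapping.keys c \<subseteq> {..<Suc r}" for c
      using that by (auto simp: in_keys_iff \<rho>_lookup less_Suc_eq split: if_splits)
    have \<rho>_add: "\<rho> (c + c') = \<rho> c + \<rho> c'" for c c'
      by (rule poly_mapping_eqI) (simp add: \<rho>_lookup lookup_add)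
    have \<phi>K: "\<phi> (\<rho> c) \<in> ?K" if "Poly_Mapping.keys c \<subseteq> {..<Suc r}" for c
      using bij_betwE[OF bij] \<rho>_keys[OF that] by blast
    define \<psi> where "\<psi> c = \<phi> (\<rho> c) \<otimes> h [^] Poly_Mapping.lookup c r" for c
    let ?F = "{c :: nat \<Rightarrow>\<^sub>0 int. Poly_Mapping.keys c \<subseteq> {..<Suc r}}"
    have \<psi>_add: "\<psi> (c + c') = \<psi> c \<otimes> \<psi> c'" if "c \<in> ?F" "c' \<in> ?F" for c c'
    proof -
      have "\<phi> (\<rho> c) \<in> carrier G" "\<phi> (\<rho> c') \<in> carrier G" using \<phi>K that by auto
      then show ?thesis
        using hom[OF \<rho>_keys \<rho>_keys] that hc
        by (simp add: \<psi>_def \<rho>_add lookup_add int_pow_mult m_ac)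
    qed
    have v\<psi>: "v m (\<psi> c) = Poly_Mapping.lookup c r * v m h" if "c \<in> ?F" for c
      using \<phi>K[of c] that add[of m "\<phi> (\<rho> c)"] pow_H vpow by (simp add: \<psi>_def)
    have inj: "inj_on \<psi> ?F"
    proof (rule inj_onI)
      fix c c' assume c: "c \<in> ?F" "c' \<in> ?F" and eq: "\<psi> c = \<psi> c'"
      have "Poly_Mapping.lookup c r * v m h = Poly_Mapping.lookup c' r * v m h"
        using v\<psi>[OF c(1)] v\<psi>[OF c(2)] unfolding eq by (rule trans[OF sym])
      then have l: "Poly_Mapping.lookup c r = Poly_Mapping.lookup c' r" using False by simp
      have "\<phi> (\<rho> c) \<in> carrier G" "\<phi> (\<rho> c') \<in> carrier G" using \<phi>K c by auto
      with eq l hc have "\<phi> (\<rho> c) = \<phi> (\<rho> c')" by (simp add: \<psi>_def)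
      then have "\<rho> c = \<rho> c'"
        using inj_onD[OF bij_betw_imp_inj_on[OF bij], of "\<rho> c" "\<rho> c'"] \<rho>_keys c by simp
      show "c = c'"
      proof (rule poly_mapping_eqI)
        fix i
        have "Poly_Mapping.lookup (\<rho> c) i = Poly_Mapping.lookup (\<rho> c') i" by (simp only: \<open>\<rho> c = \<rho> c'\<close>)
        then show "Poly_Mapping.lookup c i = Poly_Mapping.lookup c' i"
          using l by (cases "i = r") (simp_all add: \<rho>_lookup)
      qed
    qed
    have "\<psi> ` ?F = H"
    proof (intro equalityI subsetI)
      fix x assume "x \<in> \<psi> ` ?F"
      then obtain c where "c \<in> ?F" "x = \<psi> c" by blast
      then show "x \<in> H" using \<phi>K[of c] pow_H by (auto simp: \<psi>_def)
    next
      fix x assume x: "x \<in> H"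
      obtain q where q: "v m x = v m h * q" using dvd[OF x] by blast
      \<comment> \<open>Dividing x by the power of h with the same last valuation lands in the
        kernel.\<close>
      let ?y = "x \<otimes> h [^] (- q)"
      have "?y \<in> ?K" using x pow_H add[of m x "h [^] (- q)"] vpow[of "- q"] q by auto
      then have "?y \<in> \<phi> ` {c. Poly_Mapping.keys c \<subseteq> {..<r}}" unfolding bij_betw_imp_surj_on[OF bij] .
      then obtain c where c: "Poly_Mapping.keys c \<subseteq> {..<r}" "\<phi> c = ?y" by auto
      let ?c = "c + frag_cmul q (frag_of r)"
      have "r \<notin> Poly_Mapping.keys c" using c(1) by auto
      then have cr: "Poly_Mapping.lookup c r = 0" by (simp add: in_keys_iff)
      have "?c \<in> ?F" using c(1) keys_add[of c "frag_cmul q (frag_of r)"] keys_cmul[of q "frag_of r"]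
        by (fastforce simp: keys_frag_of)
      moreover have "\<rho> ?c = c"
        by (rule poly_mapping_eqI) (simp add: \<rho>_lookup cr lookup_add lookup_single when_def)
      then have "\<psi> ?c = x \<otimes> h [^] (- q) \<otimes> h [^] q"
        by (simp add: \<psi>_def c(2) cr lookup_add)
      then have "\<psi> ?c = x" using x hc by (simp add: m_assoc flip: int_pow_mult)
      ultimately show "x \<in> \<psi> ` ?F" by force
    qed
    then show ?thesis using inj \<psi>_add by (intro exI[of _ "Suc r"] exI[of _ \<psi>]) (auto simp: bij_betw_def)
  qed
qed

lemma (in comm_group) free_of_valuations:
  fixes v :: "nat \<Rightarrow> 'a \<Rightarrow> int"
  assumes H: "subgroup H G"
    and "\<And>j x y. j < m \<Longrightarrow> x \<in> H \<Longrightarrow> y \<in> H \<Longrightarrow> v j (x \<otimes> y) = v j x + v j y"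
    and "\<And>x. x \<in> H \<Longrightarrow> (\<And>j. j < m \<Longrightarrow> v j x = 0) \<Longrightarrow> x = \<one>"
  shows "\<exists>r::nat. G\<lparr>carrier := H\<rparr> \<cong> free_Abelian_group {..<r}"
proof -
  obtain r \<phi> where hom: "\<forall>c c'. Poly_Mapping.keys c \<subseteq> {..<r} \<longrightarrow> Poly_Mapping.keys c' \<subseteq> {..<r} \<longrightarrow>
      \<phi> (c + c') = \<phi> c \<otimes> \<phi> c'" and bij: "bij_betw \<phi> {c :: nat \<Rightarrow>\<^sub>0 int. Poly_Mapping.keys c \<subseteq> {..<r}} H"
    using free_of_valuations_aux[where H = H and m = m and v = v, OF assms] by blast
  have "\<phi> \<in> iso (free_Abelian_group {..<r}) (G\<lparr>carrier := H\<rparr>)"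
    using hom bij bij_betwE[OF bij] by (auto simp: iso_def hom_def free_Abelian_group_def)
  then have "free_Abelian_group {..<r} \<cong> G\<lparr>carrier := H\<rparr>" by (auto simp: is_iso_def)
  then show ?thesis using group.iso_sym[OF group_free_Abelian_group] by blast
qed

text \<open>The reachable pairs form a subgroup of Z x Z. The integers t for which both (t, 0) and
  (0, t) are reachable form a subgroup of Z that contains a power of each f i. A prime dividing its
  generator would thus divide every f i, so the generator is 1.\<close>

lemma shift_surj:
  fixes f :: "nat \<Rightarrow> int"
  assumes coprime: "\<And>l. prime l \<Longrightarrow> \<exists>i\<in>{1..n}. \<not> l dvd f i"
  shows "\<exists>x. (\<Sum>i\<in>{1..n}. f i * x i) = \<alpha> \<and> (\<Sum>i\<in>{1..n}. f i * x (Suc i)) = \<beta>"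
proof -
  define H where "H \<alpha> \<beta> \<longleftrightarrow> (\<exists>x. (\<Sum>i\<in>{1..n}. f i * x i) = \<alpha> \<and> (\<Sum>i\<in>{1..n}. f i * x (Suc i)) = \<beta>)" for \<alpha> \<beta>
  have lin: "H (s * \<alpha> + t * \<alpha>') (s * \<beta> + t * \<beta>')" if H: "H \<alpha> \<beta>" "H \<alpha>' \<beta>'" for s t \<alpha> \<beta> \<alpha>' \<beta>'
  proof -
    obtain x y where x: "(\<Sum>i\<in>{1..n}. f i * x i) = \<alpha>" "(\<Sum>i\<in>{1..n}. f i * x (Suc i)) = \<beta>"
      and y: "(\<Sum>i\<in>{1..n}. f i * y i) = \<alpha>'" "(\<Sum>i\<in>{1..n}. f i * y (Suc i)) = \<beta>'"
      using H unfolding H_def by blast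
    have "(\<Sum>i\<in>{1..n}. f i * (s * x (k i) + t * y (k i))) =
        s * (\<Sum>i\<in>{1..n}. f i * x (k i)) + t * (\<Sum>i\<in>{1..n}. f i * y (k i))" for k :: "nat \<Rightarrow> nat"
      by (simp add: algebra_simps sum.distrib sum_distrib_left)
    from this[of "\<lambda>i. i"] this[of Suc] show ?thesis
      unfolding H_def x[symmetric] y[symmetric] by (intro exI[of _ "\<lambda>i. s * x i + t * y i"]) simp
  qed
  \<comment> \<open>Extension by 0 to the indices 0 and n + 1, so that the unit vectors at 1 and at
    n + 1, which reach (f 1, 0) and (0, f n), fit the general formula.\<close>
  define F where "F j = (if j \<in> {1..n} then f j else 0)" for j
  have base: "H (F (Suc j)) (F j)" if "j \<le> n" for j
  proof -
    have "(\<Sum>i\<in>{1..n}. f i * (if i = Suc j then 1 else 0)) = F (Suc j)"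
      by (simp add: F_def if_distrib[of "\<lambda>z. _ * z"] sum.delta cong: if_cong)
    moreover have "(\<Sum>i\<in>{1..n}. f i * (if Suc i = Suc j then 1 else 0)) = F j"
      by (simp add: F_def if_distrib[of "\<lambda>z. _ * z"] sum.delta cong: if_cong)
    ultimately show ?thesis
      unfolding H_def by (intro exI[of _ "\<lambda>i. if i = Suc j then 1 else 0"] conjI)
  qed
  have zero: "H 0 0" using base[of 0] lin[of "F (Suc 0)" "F 0" "F (Suc 0)" "F 0" 0 0] by simp
  have scale: "H (s * \<alpha>) (s * \<beta>)" if "H \<alpha> \<beta>" for s \<alpha> \<beta> using lin[OF that zero, of s 0] by simp
  define J where "J = {t. H t 0 \<and> H 0 t}"
  \<comment> \<open>The classes \<open>(1, 0)\<close> and \<open>(0, 1)\<close> modulo \<open>H\<close> are killed by a power of each \<open>f j\<close>.\<close>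
  have nil: "\<exists>k. F j ^ k \<in> J" if "j \<le> n" for j
    using that
  proof (induction j)
    case 0
    then show ?case using zero by (intro exI[of _ 1]) (simp add: J_def F_def)
  next
    case (Suc j)
    then obtain k where k: "F j ^ k \<in> J" by auto
    define c g c' where "c = F (Suc j)" and "g = F j" and "c' = F (Suc (Suc j))"
    have 1: "H c g" "H c' c" unfolding c_def g_def c'_def using Suc.prems by (auto intro: base)
    \<comment> \<open>Elimination between the neighbouring pairs (c, g) and (c', c): their
      determinant annihilates the class of (1, 0). As a power of g annihilates it too, so does a
      power of c.\<close>
    have 2: "H (c\<^sup>2 - g * c') 0"
      using lin[OF 1, of c "- g"] by (simp add: power2_eq_square algebra_simps)
    have "(c\<^sup>2 - g * c') dvd (c\<^sup>2) ^ k - (g * c') ^ k" by (simp add: power_diff_sumr2)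
    then obtain s where s: "(c\<^sup>2) ^ k - (g * c') ^ k = (c\<^sup>2 - g * c') * s" by blast
    have "H (s * (c\<^sup>2 - g * c')) 0" using scale[OF 2, of s] by simp
    then have 3: "H ((c\<^sup>2) ^ k - (g * c') ^ k) 0" unfolding s by (subst mult.commute)
    have "H (g ^ k) 0" using k by (simp add: J_def g_def)
    from lin[OF 3 this, of 1 "c' ^ k"] have 4: "H ((c\<^sup>2) ^ k) 0" by (simp add: power_mult_distrib algebra_simps)
    have 5: "H (c * (c\<^sup>2) ^ k) 0" using scale[OF 4, of c] by simp
    \<comment> \<open>The pair (c', c) is scaled by a power of c that annihilates the class of (1,
      0); its first coordinate can then be subtracted, and only the second remains.\<close>
    have 6: "H 0 (c * (c\<^sup>2) ^ k)" using lin[OF 1(2) 4, of "(c\<^sup>2) ^ k" "- c'"] by (simp add: algebra_simps)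
    have "c * (c\<^sup>2) ^ k = c ^ (2 * k + 1)" by (simp add: power_mult)
    with 5 6 show ?case unfolding J_def c_def by (intro exI[of _ "2 * k + 1"]) simp
  qed
  have "\<exists>d\<in>J. d \<ge> 0 \<and> (\<forall>x\<in>J. d dvd x)"
  proof (rule int_subgroup_principal)
    show "0 \<in> J" using zero by (simp add: J_def)
    show "x - y \<in> J" if "x \<in> J" "y \<in> J" for x y
      using lin[of x 0 y 0 1 "-1"] lin[of 0 x 0 y 1 "-1"] that by (simp add: J_def)
  qed
  then obtain d where d: "d \<in> J" "d \<ge> 0" and dvd: "\<And>x. x \<in> J \<Longrightarrow> d dvd x" by blast
  have "d = 1"
  proof (rule ccontr)
    assume "d \<noteq> 1"
    \<comment> \<open>The value d = 0 is still possible at this point; every prime divides it, and 2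
      is taken.\<close>
    have "\<exists>l. prime l \<and> l dvd d"
    proof (cases "d = 0")
      case True
      then show ?thesis using two_is_prime_nat by (intro exI[of _ 2]) auto
    next
      case False
      then show ?thesis using prime_divisor_exists[of d] \<open>d \<noteq> 1\<close> d(2) by auto
    qed
    then obtain l where l: "prime l" "l dvd d" by blast
    obtain i where i: "i \<in> {1..n}" "\<not> l dvd f i" using coprime[OF l(1)] by blast
    obtain k where "F i ^ k \<in> J" using nil[of i] i(1) by auto
    then have "l dvd f i ^ k" using dvd_trans[OF l(2) dvd] i(1) by (simp add: F_def)
    then show False using i(2) l(1) prime_dvd_power by blast
  qed
  then have "H 1 0" "H 0 1" using d(1) by (simp_all add: J_def)
  from lin[OF this, of \<alpha> \<beta>] show ?thesis by (simp add: H_def)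
qed

text \<open>Division by the gcd d of the e i leaves coefficients without a common prime factor, for
  which every pair of right-hand sides is attained. The right-hand sides here are divisible by d
  because they come from vectors u and w.\<close>

lemma shift_solve:
  fixes e u w :: "nat \<Rightarrow> int"
  shows "\<exists>x. (\<Sum>i\<in>{1..n}. e i * x i) = (\<Sum>i\<in>{1..n}. e i * u i) \<and>
    (\<Sum>i\<in>{1..n}. e i * x (Suc i)) = (\<Sum>i\<in>{1..n}. e i * w i)"
proof (cases "\<forall>i\<in>{1..n}. e i = 0")
  case False
  define d where "d = Gcd (e ` {1..n})"
  define f where "f i = e i div d" for i
  have d0: "d \<noteq> 0" using False by (auto simp: d_def Gcd_0_iff)
  have ef: "e i = d * f i" if "i \<in> {1..n}" for i
    using that by (simp add: f_def d_def)
  have "\<exists>x. (\<Sum>i\<in>{1..n}. f i * x i) = (\<Sum>i\<in>{1..n}. f i * u i) \<and>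
      (\<Sum>i\<in>{1..n}. f i * x (Suc i)) = (\<Sum>i\<in>{1..n}. f i * w i)"
  proof (rule shift_surj, rule ccontr)
    fix l :: int assume l: "prime l" "\<not> (\<exists>i\<in>{1..n}. \<not> l dvd f i)"
    then have "d * l dvd e i" if "i \<in> {1..n}" for i using ef[OF that] that by auto
    then have "d * l dvd d" unfolding d_def by (intro Gcd_greatest) auto
    then have "l dvd 1" using d0 by (metis dvd_mult_cancel_left mult.right_neutral)
    then show False using l(1) not_prime_unit by blast
  qed
  then obtain x where "(\<Sum>i\<in>{1..n}. f i * x i) = (\<Sum>i\<in>{1..n}. f i * u i)"
    "(\<Sum>i\<in>{1..n}. f i * x (Suc i)) = (\<Sum>i\<in>{1..n}. f i * w i)" by blast
  moreover have "(\<Sum>i\<in>{1..n}. e i * y i) = d * (\<Sum>i\<in>{1..n}. f i * y i)" for y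
    unfolding sum_distrib_left by (intro sum.cong) (auto simp: ef)
  ultimately show ?thesis by (intro exI[of _ x]) simp
qed (auto)

section \<open>Units of the ring of S-integers\<close>

lemma S_integers_simps [simp]: "x \<otimes>\<^bsub>S_integers S\<^esub> y = x * y" "\<one>\<^bsub>S_integers S\<^esub> = 1" "x \<oplus>\<^bsub>S_integers S\<^esub> y = x + y" "\<zero>\<^bsub>S_integers S\<^esub> = 0"
  by (simp_all add: S_integers_def)

lemma S_integers_memI: "m > 0 \<Longrightarrow> prime_factors m \<subseteq> S \<Longrightarrow> of_int a / of_nat m \<in> carrier (S_integers S)"
  by (auto simp: S_integers_def)

lemma S_integers_memE:
  assumes "x \<in> carrier (S_integers S)"
  obtains a m where "x = of_int a / of_nat m" "m > 0" "prime_factors m \<subseteq> S"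
  using assms by (auto simp: S_integers_def)

lemma S_integers_closed:
  assumes "x \<in> carrier (S_integers S)" "y \<in> carrier (S_integers S)" shows "x + y \<in> carrier (S_integers S)" "x * y \<in> carrier (S_integers S)" "- x \<in> carrier (S_integers S)"
proof -
  obtain a m where x: "x = of_int a / of_nat m" "m > 0" "prime_factors m \<subseteq> S"
    using assms(1) by (rule S_integers_memE)
  obtain b l where y: "y = of_int b / of_nat l" "l > 0" "prime_factors l \<subseteq> S"
    using assms(2) by (rule S_integers_memE)
  have ml: "m * l > 0" "prime_factors (m * l) \<subseteq> S"
    using x y by (auto simp: prime_factors_product)
  have "x + y = of_int (a * int l + b * int m) / of_nat (m * l)"
    using x y by (simp add: field_simps)
  then show "x + y \<in> carrier (S_integers S)" using S_integers_memI[OF ml] by metis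
  have "x * y = of_int (a * b) / of_nat (m * l)" using x y by simp
  then show "x * y \<in> carrier (S_integers S)" using S_integers_memI[OF ml] by metis
  show "- x \<in> carrier (S_integers S)" using S_integers_memI[OF x(2,3), of "- a"] x(1) by simp
qed

lemma S_integers_one: "1 \<in> carrier (S_integers S)" and S_integers_zero: "0 \<in> carrier (S_integers S)"
  using S_integers_memI[of 1 S 1] S_integers_memI[of 1 S 0] by simp_all

lemma cring_S_integers: "cring (S_integers S)"
proof (rule cringI)
  show "abelian_group (S_integers S)"
  proof (rule abelian_groupI)
    show "\<exists>y\<in>carrier (S_integers S). y \<oplus>\<^bsub>S_integers S\<^esub> x = \<zero>\<^bsub>S_integers S\<^esub>" if "x \<in> carrier (S_integers S)" for x
      using S_integers_closed[OF that that] by (intro bexI[of _ "- x"]) auto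
  qed (auto simp: S_integers_closed S_integers_zero)
  show "Group.comm_monoid (S_integers S)"
    by (rule comm_monoidI) (auto simp: S_integers_closed S_integers_one)
qed (auto simp: algebra_simps)

locale prime_family =
  fixes n :: nat and p :: "nat \<Rightarrow> nat"
  assumes prime_p: "i \<in> {1..n} \<Longrightarrow> prime (p i)" and inj_p: "inj_on p {1..n}"
begin

definition S where "S = p ` {1..n}"

abbreviation "Z \<equiv> S_integers S"

text \<open>The positive S-unit with exponent vector x. Values of x outside {1..n} are ignored, and
  the shifts of vectors below rely on this.\<close>

definition E :: "(nat \<Rightarrow> int) \<Rightarrow> rat" where
  "E x = (\<Prod>i\<in>{1..n}. of_nat (p i) powi x i)"

lemma p_pos: "i \<in> {1..n} \<Longrightarrow> p i > 0"
  using prime_p prime_gt_0_nat by blast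

lemma E_add: "E (\<lambda>i. x i + y i) = E x * E y"
  unfolding E_def prod.distrib[symmetric] using p_pos by (intro prod.cong) (auto simp: power_int_add)

lemma E_zero [simp]: "E (\<lambda>i. 0) = 1"
  by (simp add: E_def)

lemma E_cong: "(\<And>i. i \<in> {1..n} \<Longrightarrow> x i = y i) \<Longrightarrow> E x = E y"
  by (auto simp: E_def intro!: prod.cong)

lemma E_neg: "E x * E (\<lambda>i. - x i) = 1"
  using E_add[of x "\<lambda>i. - x i"] by simp

lemma E_single: "E (\<lambda>i. if i = j then k else 0) = (if j \<in> {1..n} then of_nat (p j) powi k else 1)"
proof -
  have "E (\<lambda>i. if i = j then k else 0) = (\<Prod>i\<in>{1..n}. if i = j then of_nat (p i) powi k else 1)"
    unfolding E_def by (intro prod.cong) auto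
  then show ?thesis by (simp add: prod.delta)
qed

lemma E_closed: "E x \<in> carrier Z"
proof -
  have "of_nat (p i) powi k \<in> carrier Z" if i: "i \<in> {1..n}" for i k
  proof (cases "k \<ge> 0")
    case True
    then show ?thesis using S_integers_memI[of 1 S "int (p i) ^ nat k"] by (simp add: power_int_def)
  next
    case False
    have "prime_factors (p i ^ nat (- k)) \<subseteq> S"
      using False i prime_prime_factors[OF prime_p[OF i]] by (auto simp: prime_factors_power S_def)
    from S_integers_memI[OF _ this, of 1] show ?thesis
      using False p_pos[OF i] by (simp add: power_int_def divide_inverse power_inverse)
  qed
  note powi = this
  have "(\<Prod>i\<in>F. of_nat (p i) powi x i) \<in> carrier Z" if "finite F" "F \<subseteq> {1..n}" for F
    using that
  proof (induction rule: finite_induct)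
    case (insert i F)
    then show ?case using powi[of i "x i"] by (simp add: S_integers_closed)
  qed (simp add: S_integers_one)
  then show ?thesis by (simp add: E_def)
qed

lemma E_Units: "E x \<in> Units Z"
  unfolding Units_def using E_neg[of x] E_closed by (auto simp: mult.commute intro!: bexI[of _ "E (\<lambda>i. - x i)"])

text \<open>Unique factorization after clearing denominators: an integer exponent is the difference
  of the natural numbers \<open>nat (x i)\<close> and \<open>nat (- x i)\<close>, and the negative
  parts are moved to the other side of the equation.\<close>

lemma E_inj:
  assumes "E x = E y" "j \<in> {1..n}" shows "x j = y j"
proof -
  define A where "A z = (\<Prod>i\<in>{1..n}. p i ^ z i)" for z :: "nat \<Rightarrow> nat"
  have clear: "of_nat (A (\<lambda>i. nat (x i))) = E x * of_nat (A (\<lambda>i. nat (- x i)))" for x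
  proof -
    have "of_nat (p i) ^ nat k = (of_nat (p i) powi k * of_nat (p i) ^ nat (- k) :: rat)" if "i \<in> {1..n}" for i k
      using p_pos[OF that] by (cases "k \<ge> 0") (auto simp: power_int_def field_simps)
    note factor = this
    show ?thesis
      unfolding A_def E_def of_nat_prod of_nat_power prod.distrib[symmetric] by (intro prod.cong refl factor)
  qed
  have mult: "multiplicity (p j) (A z) = z j" for z
  proof -
    have "multiplicity (p j) (A z) = (\<Sum>i\<in>{1..n}. multiplicity (p j) (p i ^ z i))"
      unfolding A_def
    proof (rule prime_elem_multiplicity_prod_distrib)
      show "0 \<notin> (\<lambda>i. p i ^ z i) ` {1..n}"
      proof
        assume "0 \<in> (\<lambda>i. p i ^ z i) ` {1..n}"
        then obtain i where i: "0 = p i ^ z i" "i \<in> {1..n}" by (rule imageE)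
        with p_pos[OF i(2)] show False by simp
      qed
    qed (use prime_p[OF assms(2)] in auto)
    also have "\<dots> = (\<Sum>i\<in>{1..n}. if i = j then z i else 0)"
    proof (intro sum.cong refl)
      fix i assume i: "i \<in> {1..n}"
      show "multiplicity (p j) (p i ^ z i) = (if i = j then z i else 0)"
      proof (cases "i = j")
        case True
        then show ?thesis using prime_p[OF i] by simp
      next
        case False
        then have "p i \<noteq> p j" using inj_p i assms(2) by (auto dest: inj_onD)
        have "\<not> p j dvd p i ^ z i"
        proof
          assume "p j dvd p i ^ z i"
          then have "p j dvd p i" using prime_p[OF assms(2)] prime_dvd_power by blast
          then show False
            using \<open>p i \<noteq> p j\<close> primes_dvd_imp_eq[OF prime_p[OF assms(2)] prime_p[OF i]] by simp
        qed
        then show ?thesis using False by (simp add: not_dvd_imp_multiplicity_0)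
      qed
    qed
    also have "\<dots> = z j" using assms(2) by (simp add: sum.delta)
    finally show ?thesis .
  qed
  have A_add: "A (\<lambda>i. z i + z' i) = A z * A z'" for z z'
    by (simp add: A_def power_add prod.distrib)
  have "(of_nat (A (\<lambda>i. nat (x i) + nat (- y i))) :: rat) = of_nat (A (\<lambda>i. nat (y i) + nat (- x i)))"
    unfolding A_add of_nat_mult clear[of x] clear[of y] assms(1) by (simp only: mult_ac)
  then have "A (\<lambda>i. nat (x i) + nat (- y i)) = A (\<lambda>i. nat (y i) + nat (- x i))" by (simp only: of_nat_eq_iff)
  then have "multiplicity (p j) (A (\<lambda>i. nat (x i) + nat (- y i))) = multiplicity (p j) (A (\<lambda>i. nat (y i) + nat (- x i)))"
    by (rule arg_cong)
  then have "nat (x j) + nat (- y j) = nat (y j) + nat (- x j)" unfolding mult .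
  then show ?thesis by linarith
qed

end

section \<open>Pairs of S-units described by exponent vectors\<close>

context prime_family
begin

abbreviation "G \<equiv> unit_pairs Z"

lemma comm_group_G: "comm_group G"
  unfolding unit_pairs_def by (rule comm_group_units_times[OF cring_S_integers])

interpretation G: comm_group G by (rule comm_group_G)

definition P :: "(nat \<Rightarrow> int) \<Rightarrow> (nat \<Rightarrow> int) \<Rightarrow> rat \<times> rat" where
  "P x y = (E x, E y)"

lemma P_closed [simp]: "P x y \<in> carrier G"
  using E_Units by (simp add: P_def unit_pairs_def units_of_def)

lemma P_mult: "P x y \<otimes>\<^bsub>G\<^esub> P x' y' = P (\<lambda>i. x i + x' i) (\<lambda>i. y i + y' i)"
  by (simp add: P_def unit_pairs_def units_of_def E_add)

lemma P_one: "\<one>\<^bsub>G\<^esub> = P (\<lambda>i. 0) (\<lambda>i. 0)"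
  by (simp add: P_def unit_pairs_def units_of_def)

lemma P_inv: "inv\<^bsub>G\<^esub> P x y = P (\<lambda>i. - x i) (\<lambda>i. - y i)"
  by (rule G.inv_equality) (simp_all add: P_mult P_one)

lemma P_cong: "(\<And>i. i \<in> {1..n} \<Longrightarrow> x i = x' i) \<Longrightarrow> (\<And>i. i \<in> {1..n} \<Longrightarrow> y i = y' i) \<Longrightarrow> P x y = P x' y'"
  unfolding P_def using E_cong[of x x'] E_cong[of y y'] by simp

lemma P_pow: "P x y [^]\<^bsub>G\<^esub> (k::int) = P (\<lambda>i. k * x i) (\<lambda>i. k * y i)"
proof -
  have nat: "P x y [^]\<^bsub>G\<^esub> (m::nat) = P (\<lambda>i. int m * x i) (\<lambda>i. int m * y i)" for m
    by (induction m) (simp_all add: P_one P_mult algebra_simps)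
  show ?thesis
  proof (cases "k \<ge> 0")
    case True
    then show ?thesis using nat[of "nat k"] int_pow_int[of G "P x y" "nat k"] by simp
  next
    case False
    then show ?thesis
      using nat[of "nat (- k)"] int_pow_int[of G "P x y" "nat (- k)"] G.int_pow_neg[of "P x y" "- k"]
      by (simp add: P_inv)
  qed
qed

lemma P_finprod:
  assumes "finite I"
  shows "(\<Otimes>\<^bsub>G\<^esub>i\<in>I. P (X i) (Y i)) = P (\<lambda>j. \<Sum>i\<in>I. X i j) (\<lambda>j. \<Sum>i\<in>I. Y i j)"
  using assms by (induction I) (simp_all add: P_one P_mult)

text \<open>The subgroup generated by \<open>\<lambda>\<^sub>1, \<dots>, \<lambda>\<^sub>n\<^sub>+\<^sub>1\<close>.\<close>

definition base_lattice :: "(rat \<times> rat) set" where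
  "base_lattice = range (\<lambda>x. P x (\<lambda>j. x (Suc j)))"

text \<open>The two end generators obey the general pattern: for i = 1 the second indicator sits at
  index 0, for i = n + 1 the first one sits at n + 1, and \<open>E\<close> ignores both
  positions.\<close>

lemma lam_idx_P:
  assumes n: "n \<ge> 1" and i: "i \<in> {1..n + 1}"
  shows "lam_idx p n i = P (\<lambda>j. if j = i then 1 else 0) (\<lambda>j. if j = i - 1 then 1 else 0)"
proof (cases "i = n + 1")
  case True
  then show ?thesis using n unfolding P_def E_single lam_idx_def by auto
next
  case False
  then show ?thesis using n i unfolding P_def E_single lam_idx_def by auto
qed

lemma lam_P: "n \<ge> 1 \<Longrightarrow> lam p N = P (\<lambda>i. 0) (\<lambda>j. if j = 1 then int N else 0)"
  unfolding P_def E_single lam_def by (simp add: power_int_def)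

lemma lam'_P: "n \<ge> 1 \<Longrightarrow> lam' p n N' = P (\<lambda>j. if j = n then int N' else 0) (\<lambda>i. 0)"
  unfolding P_def E_single lam'_def by (simp add: power_int_def)

text \<open>The exponent x i is attached to p i in the first coordinate and to p (i - 1) in the
  second. This produces the shift by one that \<open>shift_solve\<close> is about.\<close>

lemma finprod_lam_idx:
  assumes "n \<ge> 1"
  shows "(\<Otimes>\<^bsub>G\<^esub>i\<in>{1..n + 1}. lam_idx p n i [^]\<^bsub>G\<^esub> (x i :: int)) = P x (\<lambda>j. x (Suc j))"
proof -
  have "(\<Otimes>\<^bsub>G\<^esub>i\<in>{1..n + 1}. lam_idx p n i [^]\<^bsub>G\<^esub> x i) =
      (\<Otimes>\<^bsub>G\<^esub>i\<in>{1..n + 1}. P (\<lambda>j. x i * (if j = i then 1 else 0)) (\<lambda>j. x i * (if j = i - 1 then 1 else 0)))"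
    by (intro G.finprod_cong') (simp_all add: lam_idx_P[OF assms] P_pow del: One_nat_def)
  also have "\<dots> = P (\<lambda>j. \<Sum>i\<in>{1..n + 1}. x i * (if j = i then 1 else 0))
      (\<lambda>j. \<Sum>i\<in>{1..n + 1}. x i * (if j = i - 1 then 1 else 0))"
    by (rule P_finprod) simp
  also have "\<dots> = P x (\<lambda>j. x (Suc j))"
  proof (rule P_cong)
    fix j assume j: "j \<in> {1..n}"
    have "(\<Sum>i\<in>{1..n + 1}. x i * (if j = i then 1 else 0)) = (\<Sum>i\<in>{1..n + 1}. if i = j then x i else 0)"
      by (intro sum.cong) auto
    then show "(\<Sum>i\<in>{1..n + 1}. x i * (if j = i then 1 else 0)) = x j"
      using j by (simp add: sum.delta)
    have "(\<Sum>i\<in>{1..n + 1}. x i * (if j = i - 1 then 1 else 0)) = (\<Sum>i\<in>{1..n + 1}. if i = Suc j then x i else 0)"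
      using j by (intro sum.cong) auto
    then show "(\<Sum>i\<in>{1..n + 1}. x i * (if j = i - 1 then 1 else 0)) = x (Suc j)"
      using j by (simp add: sum.delta)
  qed
  finally show ?thesis .
qed

lemma range_pair: "{F a x | a x. True} = range (\<lambda>z. F (fst z) (snd z))"
proof (intro equalityI subsetI)
  fix y assume "y \<in> {F a x | a x. True}"
  then obtain a x where "y = F a x" by blast
  then show "y \<in> range (\<lambda>z. F (fst z) (snd z))" by (intro image_eqI[of _ _ "(a, x)"]) simp_all
qed blast

text \<open>The extra generator moves a single exponent by multiples of N, that of p 1 in the second
  coordinate; in \<open>Lam'_P\<close> it is the exponent of p n in the first coordinate.\<close>

lemma Lam_P:
  assumes "n \<ge> 1"
  shows "Lam p n N = range (\<lambda>z. P (snd z) (\<lambda>j. snd z (Suc j) + (if j = 1 then fst z * int N else 0)))"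
proof -
  have "lam p N [^]\<^bsub>G\<^esub> a \<otimes>\<^bsub>G\<^esub> (\<Otimes>\<^bsub>G\<^esub>i\<in>{1..n + 1}. lam_idx p n i [^]\<^bsub>G\<^esub> x i) =
      P x (\<lambda>j. x (Suc j) + (if j = 1 then a * int N else 0))" for a :: int and x
    unfolding lam_P[OF assms] finprod_lam_idx[OF assms] P_pow P_mult by (intro P_cong) auto
  then have "Lam p n N = {P x (\<lambda>j. x (Suc j) + (if j = 1 then a * int N else 0)) | (a :: int) x. True}"
    unfolding Lam_def Let_def S_def[symmetric] by (simp only:)
  then show ?thesis
    by (rule trans) (rule range_pair[of "\<lambda>a x. P x (\<lambda>j. x (Suc j) + (if j = 1 then a * int N else 0))"])
qed

lemma Lam'_P:
  assumes "n \<ge> 1"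
  shows "Lam' p n N' = range (\<lambda>z. P (\<lambda>j. snd z j + (if j = n then fst z * int N' else 0)) (\<lambda>j. snd z (Suc j)))"
proof -
  have "(\<Otimes>\<^bsub>G\<^esub>i\<in>{1..n + 1}. lam_idx p n i [^]\<^bsub>G\<^esub> x i) \<otimes>\<^bsub>G\<^esub> lam' p n N' [^]\<^bsub>G\<^esub> a =
      P (\<lambda>j. x j + (if j = n then a * int N' else 0)) (\<lambda>j. x (Suc j))" for a :: int and x
    unfolding lam'_P[OF assms] finprod_lam_idx[OF assms] P_pow P_mult by (intro P_cong) auto
  then have "Lam' p n N' = {P (\<lambda>j. x j + (if j = n then a * int N' else 0)) (\<lambda>j. x (Suc j)) | (a :: int) x. True}"
    unfolding Lam'_def Let_def S_def[symmetric] by (simp only:)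
  then show ?thesis
    by (rule trans) (rule range_pair[of "\<lambda>a x. P (\<lambda>j. x j + (if j = n then a * int N' else 0)) (\<lambda>j. x (Suc j))"])
qed

lemma subgroup_P:
  assumes "M = range (\<lambda>z. P (X z) (Y z))"
    and "\<And>z z'. \<exists>w. (\<forall>i\<in>{1..n}. X w i = X z i + X z' i) \<and> (\<forall>i\<in>{1..n}. Y w i = Y z i + Y z' i)"
    and "\<And>z. \<exists>w. (\<forall>i\<in>{1..n}. X w i = - X z i) \<and> (\<forall>i\<in>{1..n}. Y w i = - Y z i)"
  shows "subgroup M G"
proof (rule G.subgroupI)
  show "M \<subseteq> carrier G" "M \<noteq> {}" using assms(1) by auto
  fix a assume "a \<in> M"
  then obtain z where a: "a = P (X z) (Y z)" using assms(1) by blast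
  obtain w where "\<forall>i\<in>{1..n}. X w i = - X z i" "\<forall>i\<in>{1..n}. Y w i = - Y z i" using assms(3) by blast
  then have "inv\<^bsub>G\<^esub> a = P (X w) (Y w)" unfolding a P_inv by (intro P_cong) auto
  then show "inv\<^bsub>G\<^esub> a \<in> M" using assms(1) by blast
  fix b assume "b \<in> M"
  then obtain z' where b: "b = P (X z') (Y z')" using assms(1) by blast
  obtain w where "\<forall>i\<in>{1..n}. X w i = X z i + X z' i" "\<forall>i\<in>{1..n}. Y w i = Y z i + Y z' i"
    using assms(2) by blast
  then have "a \<otimes>\<^bsub>G\<^esub> b = P (X w) (Y w)" unfolding a b P_mult by (intro P_cong) auto
  then show "a \<otimes>\<^bsub>G\<^esub> b \<in> M" using assms(1) by blast
qed

lemma subgroup_Lam: "n \<ge> 1 \<Longrightarrow> subgroup (Lam p n N) G"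
proof (rule subgroup_P)
  assume "n \<ge> 1"
  then show "Lam p n N = range (\<lambda>z. P (snd z) (\<lambda>j. snd z (Suc j) + (if j = 1 then fst z * int N else 0)))"
    by (rule Lam_P)
  fix z z' :: "int \<times> (nat \<Rightarrow> int)"
  show "\<exists>w. (\<forall>i\<in>{1..n}. snd w i = snd z i + snd z' i) \<and>
      (\<forall>i\<in>{1..n}. snd w (Suc i) + (if i = 1 then fst w * int N else 0) =
        snd z (Suc i) + (if i = 1 then fst z * int N else 0) + (snd z' (Suc i) + (if i = 1 then fst z' * int N else 0)))"
    by (intro exI[of _ "(fst z + fst z', \<lambda>i. snd z i + snd z' i)"]) (auto simp: algebra_simps)
  show "\<exists>w. (\<forall>i\<in>{1..n}. snd w i = - snd z i) \<and>
      (\<forall>i\<in>{1..n}. snd w (Suc i) + (if i = 1 then fst w * int N else 0) =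
        - (snd z (Suc i) + (if i = 1 then fst z * int N else 0)))"
    by (intro exI[of _ "(- fst z, \<lambda>i. - snd z i)"]) (auto simp: algebra_simps)
qed

lemma subgroup_Lam': "n \<ge> 1 \<Longrightarrow> subgroup (Lam' p n N') G"
proof (rule subgroup_P)
  assume "n \<ge> 1"
  then show "Lam' p n N' = range (\<lambda>z. P (\<lambda>j. snd z j + (if j = n then fst z * int N' else 0)) (\<lambda>j. snd z (Suc j)))"
    by (rule Lam'_P)
  fix z z' :: "int \<times> (nat \<Rightarrow> int)"
  show "\<exists>w. (\<forall>i\<in>{1..n}. snd w i + (if i = n then fst w * int N' else 0) =
        snd z i + (if i = n then fst z * int N' else 0) + (snd z' i + (if i = n then fst z' * int N' else 0))) \<and>
      (\<forall>i\<in>{1..n}. snd w (Suc i) = snd z (Suc i) + snd z' (Suc i))"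
    by (intro exI[of _ "(fst z + fst z', \<lambda>i. snd z i + snd z' i)"]) (auto simp: algebra_simps)
  show "\<exists>w. (\<forall>i\<in>{1..n}. snd w i + (if i = n then fst w * int N' else 0) =
        - (snd z i + (if i = n then fst z * int N' else 0))) \<and>
      (\<forall>i\<in>{1..n}. snd w (Suc i) = - snd z (Suc i))"
    by (intro exI[of _ "(- fst z, \<lambda>i. - snd z i)"]) (auto simp: algebra_simps)
qed

lemma base_lattice_Lam: "n \<ge> 1 \<Longrightarrow> base_lattice \<subseteq> Lam p n N"
  unfolding Lam_P base_lattice_def by (auto intro!: image_eqI[of _ _ "(0, _)"] P_cong)

lemma base_lattice_Lam': "n \<ge> 1 \<Longrightarrow> base_lattice \<subseteq> Lam' p n N'"
  unfolding Lam'_P base_lattice_def by (auto intro!: image_eqI[of _ _ "(0, _)"] P_cong)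

text \<open>The 2n exponents of a pair are additive, well defined by \<open>E_inj\<close>, and
  vanish together only at the identity, so \<open>free_of_valuations\<close> applies.\<close>

lemma free_subgroup:
  assumes M: "subgroup M G" "M \<subseteq> range (case_prod P)"
  shows "\<exists>r::nat. G\<lparr>carrier := M\<rparr> \<cong> free_Abelian_group {..<r}"
proof (rule G.free_of_valuations[OF M(1)])
  define e where "e c = (SOME x. E x = c)" for c
  have e: "e (E x) j = x j" if "j \<in> {1..n}" for x j
  proof -
    have "E (e (E x)) = E x" unfolding e_def by (rule someI[of "\<lambda>y. E y = E x" x]) (rule refl)
    then show ?thesis by (rule E_inj[OF _ that])
  qed
  \<comment> \<open>Valuations are numbered from 0 and exponents from 1: the first n read off the
    first coordinate, the next n the second.\<close>
  define v where "v j z = (if j < n then e (fst z) (Suc j) else e (snd z) (Suc (j - n)))" for j z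
  have v: "v j (P x y) = (if j < n then x (Suc j) else y (Suc (j - n)))" if "j < 2 * n" for j x y
    using that by (auto simp: v_def P_def intro!: e)
  show "v j (a \<otimes>\<^bsub>G\<^esub> b) = v j a + v j b" if j: "j < 2 * n" and a: "a \<in> M" and b: "b \<in> M" for j a b
  proof -
    obtain x y where "a = P x y" using a M(2) by auto
    moreover obtain x' y' where "b = P x' y'" using b M(2) by auto
    ultimately show ?thesis using j by (simp add: P_mult v)
  qed
  show "a = \<one>\<^bsub>G\<^esub>" if a: "a \<in> M" "\<And>j. j < 2 * n \<Longrightarrow> v j a = 0" for a
  proof -
    obtain x y where axy: "a = P x y" using a(1) M(2) by auto
    show ?thesis
      unfolding axy P_one
    proof (rule P_cong)
      fix i assume i: "i \<in> {1..n}"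
      then obtain j where j: "i = Suc j" "j < n" by (cases i) auto
      show "x i = 0" using a(2)[of j] v[of j x y] j by (simp add: axy)
      show "y i = 0" using a(2)[of "n + j"] v[of "n + j" x y] j by (simp add: axy)
    qed
  qed
qed

end

section \<open>Reduction modulo a prime\<close>

text \<open>\<open>reduce_mod\<close> is defined by the fraction in lowest terms; here its residue
  is characterized through any fraction a / b with b prime to q. If q divided the reduced
  denominator, it would also divide the reduced numerator.\<close>

lemma reduce_mod_cong:
  assumes q: "prime q" and b: "\<not> int q dvd b" and x: "x * of_int b = of_int a"
  shows "[reduce_mod q x * b = a] (mod int q)" "reduce_mod q x \<in> {0..<int q}"
proof -
  interpret F: residues_prime q "prime_field q" by unfold_locales (use q in simp_all)
  have pq: "prime (int q)" using q by simp
  obtain a0 b0 where x0: "quotient_of x = (a0, b0)" by (cases "quotient_of x")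
  note den = quotient_of_denom_pos[OF x0] and cop = quotient_of_coprime[OF x0] and div = quotient_of_div[OF x0]
  have "of_int (a0 * b) = (of_int (a * b0) :: rat)"
    using x den unfolding div by (simp add: field_simps)
  then have ab: "a0 * b = a * b0" by (simp only: of_int_eq_iff)
  have b0: "\<not> int q dvd b0"
  proof
    assume d: "int q dvd b0"
    then have "int q dvd a0 * b" unfolding ab by simp
    then have "int q dvd a0" using b pq by (simp add: prime_dvd_mult_iff)
    with d cop have "is_unit (int q)" using coprime_common_divisor by blast
    then show False using pq not_prime_unit by blast
  qed
  have u: "b0 mod int q \<in> Units (prime_field q)"
  proof -
    have "int q > 0" using F.m_gt_one by simp
    then have "0 \<le> b0 mod int q" "b0 mod int q < int q" by (rule pos_mod_sign, rule pos_mod_bound)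
    moreover have "b0 mod int q \<noteq> 0" using b0 by (simp add: dvd_eq_mod_eq_0)
    ultimately show ?thesis unfolding F.res_prime_units_eq by simp
  qed
  define i where "i = inv\<^bsub>prime_field q\<^esub> (b0 mod int q)"
  have r: "reduce_mod q x = (a0 mod int q * i) mod int q"
    by (simp add: reduce_mod_def x0 F.res_mult_eq i_def)
  have "i \<otimes>\<^bsub>prime_field q\<^esub> (b0 mod int q) = \<one>\<^bsub>prime_field q\<^esub>" unfolding i_def by (rule F.Units_l_inv[OF u])
  then have "[i * b0 = 1] (mod int q)"
    using F.m_gt_one by (simp add: F.res_mult_eq F.res_one_eq cong_def mod_mult_right_eq)
  then have "[a0 * (i * b0) = a0 * 1] (mod int q)" by (rule cong_scalar_left)
  moreover have "[reduce_mod q x * b0 = a0 * (i * b0)] (mod int q)"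
    unfolding r cong_def by (metis mod_mult_left_eq mult.assoc)
  ultimately have "[reduce_mod q x * b0 = a0] (mod int q)" by (simp add: cong_trans)
  then have "[reduce_mod q x * b0 * b = a0 * b] (mod int q)" by (rule cong_scalar_right)
  then have "[reduce_mod q x * b * b0 = a * b0] (mod int q)" by (simp add: ab mult.commute mult.left_commute)
  moreover have "coprime b0 (int q)" using prime_imp_coprime[OF pq b0] by (simp only: coprime_commute)
  ultimately show "[reduce_mod q x * b = a] (mod int q)" by (simp add: cong_mult_rcancel)
  show "reduce_mod q x \<in> {0..<int q}" unfolding r using F.m_gt_one by simp
qed

lemma reduce_mod_unique:
  assumes q: "prime q" and b: "\<not> int q dvd b" and x: "x * of_int b = of_int a"
    and r: "r \<in> {0..<int q}" "[r * b = a] (mod int q)"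
  shows "reduce_mod q x = r"
proof -
  note c = reduce_mod_cong[OF q b x]
  have "prime (int q)" using q by simp
  then have "coprime b (int q)" using prime_imp_coprime[OF _ b] by (simp only: coprime_commute)
  moreover have "[reduce_mod q x * b = r * b] (mod int q)" using c(1) r(2) by (metis cong_sym cong_trans)
  ultimately have "[reduce_mod q x = r] (mod int q)" by (simp add: cong_mult_rcancel)
  then show ?thesis using c(2) r(1) by (simp add: cong_def)
qed

lemma (in prime_family) P_in_range: "P x y \<in> range (case_prod P)"
  by (rule image_eqI[of _ _ "(x, y)"]) simp_all

lemma (in prime_family) range_P: "range (\<lambda>z. P (X z) (Y z)) \<subseteq> range (case_prod P)"
  by (rule image_subsetI) (rule P_in_range)

locale prime_family_mod = prime_family +
  fixes q :: nat
  assumes prime_q: "prime q" and q_notin: "q \<notin> S"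
begin

interpretation F: residues_prime q "prime_field q" by unfold_locales (use prime_q in simp_all)

abbreviation "U \<equiv> units_of Z"
abbreviation "V \<equiv> units_of (prime_field q)"

lemma group_U: "comm_group U"
  using cring.axioms(2)[OF cring_S_integers] by (rule comm_monoid.units_comm_group)

lemma group_V: "comm_group V"
  by (rule F.units_comm_group)

lemma S_integers_num_denom:
  assumes "x \<in> carrier Z"
  shows "\<exists>a b. \<not> int q dvd b \<and> x * of_int b = of_int a"
proof -
  obtain a m where x: "x = of_int a / of_nat m" "m > 0" "prime_factors m \<subseteq> S"
    using assms by (rule S_integers_memE)
  have "\<not> q dvd m" using x(2,3) q_notin prime_q by (auto simp: prime_factors_dvd)
  then have "\<not> int q dvd int m" by simp
  then show ?thesis using x by (intro exI[of _ a] exI[of _ "int m"]) simp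
qed

lemma reduce_mod_mult:
  assumes "x \<in> carrier Z" "y \<in> carrier Z"
  shows "reduce_mod q (x * y) = reduce_mod q x \<otimes>\<^bsub>prime_field q\<^esub> reduce_mod q y"
proof -
  obtain a b where x: "\<not> int q dvd b" "x * of_int b = of_int a" using S_integers_num_denom[OF assms(1)] by blast
  obtain c d where y: "\<not> int q dvd d" "y * of_int d = of_int c" using S_integers_num_denom[OF assms(2)] by blast
  have "prime (int q)" using prime_q by simp
  then have bd: "\<not> int q dvd b * d" using x(1) y(1) by (simp add: prime_dvd_mult_iff)
  show ?thesis
  proof (rule reduce_mod_unique[OF prime_q bd])
    show "x * y * of_int (b * d) = of_int (a * c)"
      unfolding of_int_mult x(2)[symmetric] y(2)[symmetric] by (simp only: mult_ac)
    have "[reduce_mod q x * b * (reduce_mod q y * d) = a * c] (mod int q)"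
      by (rule cong_mult[OF reduce_mod_cong(1)[OF prime_q x] reduce_mod_cong(1)[OF prime_q y]])
    moreover have "[reduce_mod q x * reduce_mod q y mod int q * (b * d) = reduce_mod q x * reduce_mod q y * (b * d)] (mod int q)"
      by (rule cong_scalar_right) (simp only: cong_def mod_mod_trivial)
    moreover have "reduce_mod q x * reduce_mod q y * (b * d) = reduce_mod q x * b * (reduce_mod q y * d)"
      by (simp only: mult_ac)
    ultimately show "[reduce_mod q x \<otimes>\<^bsub>prime_field q\<^esub> reduce_mod q y * (b * d) = a * c] (mod int q)"
      unfolding F.res_mult_eq by (simp only: cong_trans)
    show "reduce_mod q x \<otimes>\<^bsub>prime_field q\<^esub> reduce_mod q y \<in> {0..<int q}"
      unfolding F.res_mult_eq using F.m_gt_one by simp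
  qed
qed

lemma reduce_mod_one: "reduce_mod q 1 = 1"
  by (rule reduce_mod_unique[OF prime_q, of 1 _ 1]) (use F.m_gt_one in \<open>auto simp: zdvd1_eq\<close>)

lemma reduce_mod_hom: "reduce_mod q \<in> hom U V"
proof (rule homI)
  fix x assume x: "x \<in> carrier U"
  then obtain y where y: "x \<in> carrier Z" "y \<in> carrier Z" "x * y = 1"
    by (auto simp: units_of_def Units_def mult.commute)
  have car: "reduce_mod q z \<in> carrier (prime_field q)" if z: "z \<in> carrier Z" for z
  proof -
    obtain a b where "\<not> int q dvd b" "z * of_int b = of_int a" using S_integers_num_denom[OF z] by blast
    from reduce_mod_cong(2)[OF prime_q this] show ?thesis by (simp add: F.res_carrier_eq)
  qed
  have "reduce_mod q x \<otimes>\<^bsub>prime_field q\<^esub> reduce_mod q y = \<one>\<^bsub>prime_field q\<^esub>"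
    using reduce_mod_mult[OF y(1,2)] y(3) reduce_mod_one by (simp add: F.res_one_eq)
  then show "reduce_mod q x \<in> carrier V"
    using car[OF y(1)] car[OF y(2)] F.m_comm[OF car[OF y(1)] car[OF y(2)]] unfolding units_of_def Units_def by auto
  fix x' assume "x' \<in> carrier U"
  then have "x' \<in> carrier Z" by (auto simp: units_of_def Units_def)
  then show "reduce_mod q (x \<otimes>\<^bsub>U\<^esub> x') = reduce_mod q x \<otimes>\<^bsub>V\<^esub> reduce_mod q x'"
    using reduce_mod_mult[OF y(1)] by (simp add: units_of_def)
qed

lemma reduce_pair_hom: "reduce_pair q \<in> hom G (unit_pairs (prime_field q))"
proof (rule homI)
  fix z z' assume z: "z \<in> carrier G" "z' \<in> carrier G"
  show "reduce_pair q z \<in> carrier (unit_pairs (prime_field q))"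
    using z(1) hom_in_carrier[OF reduce_mod_hom] by (auto simp: unit_pairs_def)
  show "reduce_pair q (z \<otimes>\<^bsub>G\<^esub> z') = reduce_pair q z \<otimes>\<^bsub>unit_pairs (prime_field q)\<^esub> reduce_pair q z'"
    using z hom_mult[OF reduce_mod_hom] by (auto simp: unit_pairs_def)
qed

text \<open>Cyclicity of the multiplicative group of a finite field. The natural exponents obtained
  here become the coefficients of the linear system.\<close>

lemma V_generator: "\<exists>g\<in>carrier V. \<forall>z\<in>carrier V. \<exists>i::nat. z = g [^]\<^bsub>V\<^esub> i"
proof -
  have pow: "a [^]\<^bsub>prime_field q\<^esub> (i::nat) = a [^]\<^bsub>V\<^esub> i" for a i
    by (simp add: nat_pow_def units_of_def)
  have car: "carrier (mult_of (prime_field q)) = carrier V"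
    using F.field_Units by (simp add: units_of_def)
  show ?thesis using F.finite_field_mult_group_has_gen[OF F.finite] unfolding car pow by blast
qed

text \<open>Reduction is a homomorphism, so on exponent vectors it is the linear form whose
  coefficients are the discrete logarithms of the primes. The vector is assembled one prime at a
  time.\<close>

lemma reduce_E:
  assumes g: "g \<in> carrier V" and e: "\<And>i. i \<in> {1..n} \<Longrightarrow> reduce_mod q (of_nat (p i)) = g [^]\<^bsub>V\<^esub> e i"
  shows "reduce_mod q (E x) = g [^]\<^bsub>V\<^esub> (\<Sum>i\<in>{1..n}. int (e i) * x i)"
proof -
  interpret U: comm_group U by (rule group_U)
  interpret V: comm_group V by (rule group_V)
  interpret r: group_hom U V "reduce_mod q" by unfold_locales (rule reduce_mod_hom)
  have EU: "E y \<in> carrier U" for y using E_Units by (simp add: units_of_def)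
  have Emult: "E y \<otimes>\<^bsub>U\<^esub> E z = E (\<lambda>i. y i + z i)" for y z by (simp add: units_of_def E_add)
  have Eone: "\<one>\<^bsub>U\<^esub> = E (\<lambda>i. 0)" by (simp add: units_of_def)
  have Einv: "inv\<^bsub>U\<^esub> E y = E (\<lambda>i. - y i)" for y
    by (rule U.inv_equality) (simp_all only: EU Emult Eone, simp)
  have nat: "E y [^]\<^bsub>U\<^esub> (m::nat) = E (\<lambda>i. int m * y i)" for y m
    by (induction m) (simp_all add: Emult Eone[unfolded E_zero] algebra_simps)
  have int: "E y [^]\<^bsub>U\<^esub> (k::int) = E (\<lambda>i. k * y i)" for y k
  proof (cases "k \<ge> 0")
    case True
    then show ?thesis using nat[of y "nat k"] int_pow_int[of U "E y" "nat k"] by simp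
  next
    case False
    then show ?thesis
      using nat[of y "nat (- k)"] int_pow_int[of U "E y" "nat (- k)"] U.int_pow_neg[OF EU, of y "- k"]
      by (simp add: Einv)
  qed
  have single: "reduce_mod q (E (\<lambda>i. if i = j then k else 0)) = g [^]\<^bsub>V\<^esub> (int (e j) * k)" if j: "j \<in> {1..n}" for j k
  proof -
    let ?d = "\<lambda>i. if i = j then 1 else 0 :: int"
    have "(\<lambda>i. if i = j then k else 0) = (\<lambda>i. k * ?d i)" by auto
    then have "reduce_mod q (E (\<lambda>i. if i = j then k else 0)) = reduce_mod q (E ?d [^]\<^bsub>U\<^esub> k)" by (simp only: int)
    also have "\<dots> = reduce_mod q (E ?d) [^]\<^bsub>V\<^esub> k" by (rule r.hom_int_pow[OF EU])
    also have "E ?d = of_nat (p j)" using j by (simp add: E_single)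
    also have "reduce_mod q (of_nat (p j)) = g [^]\<^bsub>V\<^esub> int (e j)" by (simp only: e[OF j] int_pow_int)
    finally show ?thesis using g by (simp add: V.int_pow_pow)
  qed
  have "reduce_mod q (E (\<lambda>i. if i \<in> I then x i else 0)) = g [^]\<^bsub>V\<^esub> (\<Sum>i\<in>I. int (e i) * x i)"
    if "finite I" "I \<subseteq> {1..n}" for I
    using that
  proof (induction rule: finite_induct)
    case empty
    then show ?case by (simp add: reduce_mod_one units_of_def F.res_one_eq)
  next
    case (insert j I)
    have "(\<lambda>i. if i \<in> insert j I then x i else 0) = (\<lambda>i. (if i = j then x j else 0) + (if i \<in> I then x i else 0))"
      using insert.hyps by auto
    then have "reduce_mod q (E (\<lambda>i. if i \<in> insert j I then x i else 0)) =
        reduce_mod q (E (\<lambda>i. if i = j then x j else 0)) \<otimes>\<^bsub>V\<^esub> reduce_mod q (E (\<lambda>i. if i \<in> I then x i else 0))"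
      using r.hom_mult[OF EU EU] by (simp only: Emult[symmetric])
    also have "\<dots> = g [^]\<^bsub>V\<^esub> (int (e j) * x j) \<otimes>\<^bsub>V\<^esub> g [^]\<^bsub>V\<^esub> (\<Sum>i\<in>I. int (e i) * x i)"
      using insert single[of j "x j"] by simp
    also have "\<dots> = g [^]\<^bsub>V\<^esub> (\<Sum>i\<in>insert j I. int (e i) * x i)"
      using insert.hyps g by (simp add: V.int_pow_mult)
    finally show ?case .
  qed
  from this[of "{1..n}"] have "reduce_mod q (E (\<lambda>i. if i \<in> {1..n} then x i else 0)) =
      g [^]\<^bsub>V\<^esub> (\<Sum>i\<in>{1..n}. int (e i) * x i)" by (simp only: finite_atLeastAtMost subset_refl)
  moreover have "E (\<lambda>i. if i \<in> {1..n} then x i else 0) = E x" by (rule E_cong) simp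
  ultimately show ?thesis by simp
qed

text \<open>The two coordinates of \<open>P u w\<close> reduce to powers of g that depend only on
  the values of one linear form at u and at w, and \<open>shift_solve\<close> attains both values
  with a vector and its shift. The vector found depends on q; the lattice does not.\<close>

lemma reduce_base_lattice:
  "\<exists>z\<in>base_lattice. reduce_pair q (P u w) = reduce_pair q z"
proof -
  obtain g where g: "g \<in> carrier V" "\<forall>z\<in>carrier V. \<exists>i::nat. z = g [^]\<^bsub>V\<^esub> i" using V_generator by blast
  have "\<exists>k::nat. i \<in> {1..n} \<longrightarrow> reduce_mod q (of_nat (p i)) = g [^]\<^bsub>V\<^esub> k" for i
  proof (cases "i \<in> {1..n}")
    case True
    have "of_nat (p i) = E (\<lambda>j. if j = i then 1 else 0)" using True by (simp add: E_single)
    then have "of_nat (p i) \<in> carrier U" using E_Units by (simp add: units_of_def)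
    then show ?thesis using g(2) hom_in_carrier[OF reduce_mod_hom] by blast
  next
    case False
    then show ?thesis by blast
  qed
  then obtain e :: "nat \<Rightarrow> nat" where e: "\<And>i. i \<in> {1..n} \<Longrightarrow> reduce_mod q (of_nat (p i)) = g [^]\<^bsub>V\<^esub> e i"
    by metis
  obtain x where x: "(\<Sum>i\<in>{1..n}. int (e i) * x i) = (\<Sum>i\<in>{1..n}. int (e i) * u i)"
    "(\<Sum>i\<in>{1..n}. int (e i) * x (Suc i)) = (\<Sum>i\<in>{1..n}. int (e i) * w i)"
    using shift_solve[of "\<lambda>i. int (e i)" n u w] by blast
  have "reduce_pair q (P u w) = reduce_pair q (P x (\<lambda>j. x (Suc j)))"
    using reduce_E[OF g(1) e] x by (simp only: P_def map_prod_simp)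
  then show ?thesis unfolding base_lattice_def by blast
qed

text \<open>Squeezing M between the base lattice and the pairs of positive S-units treats all four
  subgroups with a single argument.\<close>

lemma reduce_image_eq:
  assumes "base_lattice \<subseteq> M" "M \<subseteq> range (case_prod P)"
  shows "reduce_pair q ` M = reduce_pair q ` base_lattice"
proof (rule equalityI[OF image_subsetI image_mono[OF assms(1)]])
  fix z assume "z \<in> M"
  with assms(2) have "z \<in> range (case_prod P)" by (rule subsetD)
  then obtain v where "z = case_prod P v" by (rule imageE)
  then have uw: "z = P (fst v) (snd v)" by (simp only: split_beta)
  obtain z' where "z' \<in> base_lattice" "reduce_pair q (P (fst v) (snd v)) = reduce_pair q z'"
    using reduce_base_lattice by (rule bexE)
  then show "reduce_pair q z \<in> reduce_pair q ` base_lattice" unfolding uw by (simp only: imageI)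
qed

text \<open>The image is a subgroup of a finite group, so its constant group scheme is represented
  by a split algebra. The one-element group supplies, in the same way, the zero quotient in the
  torus part.\<close>

lemma torsion_reduction:
  assumes M: "subgroup M G"
  shows "torsion_one_motive (prime_field q)
    (inclusion_motive (prime_field q) (reduce_pair q ` M) :: (int, 'u::infinite) inclusion_motive_type)"
proof -
  interpret G: comm_group G by (rule comm_group_G)
  interpret H: comm_group "unit_pairs (prime_field q)"
    unfolding unit_pairs_def by (rule comm_group_units_times[OF F.is_cring])
  interpret r: group_hom G "unit_pairs (prime_field q)" "reduce_pair q" by unfold_locales (rule reduce_pair_hom)
  have sub: "subgroup (reduce_pair q ` M) (unit_pairs (prime_field q))" by (rule r.subgroup_img_is_subgroup[OF M])
  interpret I: unit_subgroup "prime_field q" "reduce_pair q ` M" 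
    by (intro unit_subgroup.intro unit_subgroup_axioms.intro F.is_cring sub)
  have finU: "finite (carrier (unit_pairs (prime_field q)))"
    by (simp add: unit_pairs_def units_of_def F.finite_Units)
  have fin: "finite (carrier I.G)" using finite_subset[OF subgroup.subset[OF sub] finU] by simp
  have ne: "\<one>\<^bsub>prime_field q\<^esub> \<noteq> \<zero>\<^bsub>prime_field q\<^esub>" by (rule F.one_not_zero)
  have finite_flat: "finite_flat_group_scheme (prime_field q) (constant_sheaf H :: (int, 'u, 'h \<Rightarrow> 'u) group_functor)"
    if H: "comm_group H" "finite (carrier H)" for H :: "'h monoid"
  proof -
    obtain E :: "'u ring" and \<sigma> \<pi> where "split_algebra (prime_field q) E \<sigma> (carrier H) \<pi>"
      using ex_split_algebra[OF F.is_cring F.finite H(2)] by blast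
    then interpret s: split_algebra "prime_field q" E \<sigma> "carrier H" \<pi> .
    interpret s: split_group_algebra "prime_field q" E \<sigma> H \<pi>
      by (intro split_group_algebra.intro s.split_algebra_axioms constant_section_group.intro s.S.is_cring H(1))
    show ?thesis by (rule s.finite_flat_constant[OF ne])
  qed
  show ?thesis
  proof (rule I.torsion_inclusion)
    show "finite_flat_group_scheme (prime_field q) (constant_sheaf I.G :: (int, 'u, int \<times> int \<Rightarrow> 'u) group_functor)"
      by (rule finite_flat[OF I.comm_group_G fin])
  next
    fix z :: 'u
    let ?T = "singleton_group ()"
    have T: "comm_group ?T" "finite (carrier ?T)" by simp_all
    have "carrier ?T = {\<one>\<^bsub>?T\<^esub>}" by (simp add: singleton_group_def)
    then show "finite_flat_group_scheme (prime_field q) (trivial_sheaf z :: (int, 'u, 'u) group_functor)"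
      by (rule finite_flat_trivial[OF T(1) _ finite_flat[OF T]])
  qed
qed

end

theorem theorem3p2:
  fixes n N N' :: nat and p :: "nat \<Rightarrow> nat"
  assumes "n \<ge> 3"
    and "\<forall>i\<in>{1..n}. prime (p i)"
    and "inj_on p {1..n}"
    and "N > 0" and "N' > 0"
  defines "S \<equiv> p ` {1..n}"
  defines "G \<equiv> unit_pairs (S_integers S)"
  defines "L \<equiv> Lam p n N"
    and "L' \<equiv> Lam' p n N'"
  shows "(\<forall>M \<in> {L, L', L \<inter> L', L <#>\<^bsub>G\<^esub> L'}.
             subgroup M G \<and>
             Deligne_one_motive (S_integers S)
               (inclusion_motive (S_integers S) M :: (rat, 'u::infinite) inclusion_motive_type)) \<and>
         (\<forall>q. prime q \<and> q \<notin> S \<longrightarrow>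
            (\<forall>M \<in> {L, L', L \<inter> L', L <#>\<^bsub>G\<^esub> L'}.
               torsion_one_motive (prime_field q)
                 (inclusion_motive (prime_field q) (reduce_pair q ` M)
                    :: (int, 'u) inclusion_motive_type)) \<and>
            (inclusion_motive (prime_field q) (reduce_pair q ` L)
               :: (int, 'u) inclusion_motive_type)
              = inclusion_motive (prime_field q) (reduce_pair q ` L') \<and>
            (inclusion_motive (prime_field q) (reduce_pair q ` L)
               :: (int, 'u) inclusion_motive_type)
              = inclusion_motive (prime_field q) (reduce_pair q ` (L \<inter> L')) \<and>
            (inclusion_motive (prime_field q) (reduce_pair q ` L)
               :: (int, 'u) inclusion_motive_type)
              = inclusion_motive (prime_field q) (reduce_pair q ` (L <#>\<^bsub>G\<^esub> L')))"
proof -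
  interpret f: prime_family n p by unfold_locales (use assms(2,3) in auto)
  have S: "S = f.S" by (simp add: S_def f.S_def)
  have G: "G = f.G" by (simp only: G_def S)
  interpret G: comm_group G unfolding G by (rule f.comm_group_G)
  have n: "n \<ge> 1" using assms(1) by simp
  have L: "subgroup L G" "f.base_lattice \<subseteq> L" "L \<subseteq> range (case_prod f.P)"
    unfolding L_def G by (rule f.subgroup_Lam[OF n] f.base_lattice_Lam[OF n])+ (simp only: f.Lam_P[OF n] f.range_P)
  have L': "subgroup L' G" "f.base_lattice \<subseteq> L'" "L' \<subseteq> range (case_prod f.P)"
    unfolding L'_def G by (rule f.subgroup_Lam'[OF n] f.base_lattice_Lam'[OF n])+ (simp only: f.Lam'_P[OF n] f.range_P)
  have "L <#>\<^bsub>G\<^esub> L' \<subseteq> range (case_prod f.P)"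
  proof
    fix z assume "z \<in> L <#>\<^bsub>G\<^esub> L'"
    then obtain a b where z: "a \<in> L" "b \<in> L'" "z = a \<otimes>\<^bsub>G\<^esub> b" unfolding set_mult_def by blast
    obtain x y where a: "a = f.P x y" using L(3) z(1) by auto
    obtain x' y' where b: "b = f.P x' y'" using L'(3) z(2) by auto
    show "z \<in> range (case_prod f.P)"
      unfolding z(3) a b G f.P_mult by (rule f.P_in_range)
  qed
  moreover have "L \<subseteq> L <#>\<^bsub>G\<^esub> L'"
  proof
    fix z assume z: "z \<in> L"
    then have "z = z \<otimes>\<^bsub>G\<^esub> \<one>\<^bsub>G\<^esub>" using G.r_one subgroup.mem_carrier[OF L(1)] by simp
    then show "z \<in> L <#>\<^bsub>G\<^esub> L'"
      unfolding set_mult_def using z subgroup.one_closed[OF L'(1)] by blast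
  qed
  ultimately have LL': "subgroup (L <#>\<^bsub>G\<^esub> L') G" "f.base_lattice \<subseteq> L <#>\<^bsub>G\<^esub> L'" "L <#>\<^bsub>G\<^esub> L' \<subseteq> range (case_prod f.P)"
    using G.mult_subgroups[OF L(1) L'(1)] L(2) by auto
  have I: "subgroup (L \<inter> L') G" using G.subgroups_Inter_pair[OF L(1) L'(1)] .
  \<comment> \<open>These three properties are all that the freeness and the reduction arguments ask
    of the four subgroups.\<close>
  have M: "subgroup M G \<and> f.base_lattice \<subseteq> M \<and> M \<subseteq> range (case_prod f.P)"
    if "M \<in> {L, L', L \<inter> L', L <#>\<^bsub>G\<^esub> L'}" for M
    using that L L' LL' I by auto
  have D: "Deligne_one_motive (S_integers S) (inclusion_motive (S_integers S) M :: (rat, 'u) inclusion_motive_type)"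
    if "M \<in> {L, L', L \<inter> L', L <#>\<^bsub>G\<^esub> L'}" for M
  proof -
    have sub: "subgroup M f.G" "M \<subseteq> range (case_prod f.P)" using M[OF that] by (simp_all add: G)
    interpret I: unit_subgroup f.Z M
      by (intro unit_subgroup.intro unit_subgroup_axioms.intro cring_S_integers sub(1))
    obtain r :: nat where "I.G \<cong> free_Abelian_group {..<r}" using f.free_subgroup[OF sub] by blast
    then show ?thesis unfolding S by (rule I.Deligne_inclusion)
  qed
  have R: "torsion_one_motive (prime_field q)
      (inclusion_motive (prime_field q) (reduce_pair q ` M) :: (int, 'u) inclusion_motive_type) \<and>
      reduce_pair q ` M = reduce_pair q ` f.base_lattice"
    if q: "prime q \<and> q \<notin> S" and m: "M \<in> {L, L', L \<inter> L', L <#>\<^bsub>G\<^esub> L'}" for q M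
  proof -
    interpret q: prime_family_mod n p q by unfold_locales (use q in \<open>auto simp: S\<close>)
    have sub: "subgroup M f.G" using M[OF m] by (simp add: G)
    show ?thesis using q.torsion_reduction[OF sub] q.reduce_image_eq M[OF m] by blast
  qed
  \<comment> \<open>The motives are equal and not merely isomorphic: over a fixed field
    \<open>inclusion_motive\<close> is determined by the subgroup, and the images coincide as
    sets.\<close>
  have eq: "reduce_pair q ` L = reduce_pair q ` M" if "prime q \<and> q \<notin> S" "M \<in> {L, L', L \<inter> L', L <#>\<^bsub>G\<^esub> L'}" for q M
    by (rule trans[OF conjunct2[OF R[OF that(1) insertI1]] conjunct2[OF R[OF that], symmetric]])
  show ?thesis
    by (intro conjI ballI allI impI arg_cong[where f = "inclusion_motive _"] conjunct1[OF M] D conjunct1[OF R] eq)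
      (simp_all only: insert_iff simp_thms)
qed

end
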